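(* For every $x\in E$, $$\lim_{h\to0}\inf_{V\in\mathbb V_h}J(x,V)=\inf_{V\in\mathbb V}J(x,V).$$
   Context: Process. $X=(X_t)_{t\ge0}$ is a continuous-time standard Feller–Markov process on a filtered space $(\Omega,\mathcal F,(\mathcal F_t))$ (standard in the usual sense of Markov process theory) with values in a compact metric space $(E,\rho)$ with Borel $\sigma$-field $\mathcal E$; $\mathbb P_x,\mathbb E_x$ are the law and expectation for the process started at $x\in E$, and $P_t(x,A):=\mathbb P_x[X_t\in A]$. The set of admissible after-impulse states is $U=E$. $\mathcal C_b(E)$ is the space of bounded continuous real functions on $E$. Standing assumptions. (1) $g:E\to\mathbb R$ is continuous and bounded; $c:E\times U\to\mathbb R_+$ is continuous and bounded, and for some $c_0>0$ we have $0<c_0\le c(x,\xi)\le c(x,\eta)+c(\eta,\xi)$ for $x,\xi,\eta\in E$. (2) For every $f\in\mathcal C_b(E)$ and $t>0$, the map $x\mapsto\mathbb E_x[f(X_t)]$ is in $\mathcal C_b(E)$. (3) For every $t>0$ there is $\Lambda_t\in(0,1)$ with $\sup_{x,y\in E}\sup_{A\in\mathcal E}|P_t(x,A)-P_t(y,A)|\le\Lambda_t$. Impulse control. A strategy is a sequence $V=(\tau_i,\xi_i)_{i=1}^\infty$ with $(\tau_i)$ an increasing (weakly, values in $[0,\infty]$) sequence of stopping times and $\xi_i$ $\mathcal F_{\tau_i}$-measurable $U$-valued random variables; $\mathbb V$ is the family of all strategies, and for $h>0$, $\mathbb V_h\subset\mathbb V$ consists of those with impulse times restricted to $\{0,h,2h,\dots\}$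 (or $\infty$, i.e. no impulse). On a countable product of copies of $(\Omega,\mathcal F,(\mathcal F_t))$ with coordinate process $(X^1_t,X^2_t,\dots)$, to each $x\in E$ and $V\in\mathbb V$ one associates a probability $\mathbb P^V_x$ (expectation $\mathbb E^V_x$) under which $X^1$ follows the uncontrolled dynamics from $x$ and, for each $i\ge1$, on $\{\tau_i<\infty\}$, $X^{i+1}_{\tau_i}=\xi_i$ and from time $\tau_i$ on $X^{i+1}$ follows the uncontrolled dynamics started afresh from $\xi_i$ (conditionally on the past). The controlled process is $Y_t:=X^i_t$ for $t\in[\tau_{i-1},\tau_i)$, $\tau_0\equiv0$. Functional. For $x\in E$ and $V\in\mathbb V$, $$J(x,V):=\limsup_{T\to\infty}\frac{\mathbb E^V_x\bigl[\int_0^Tg(Y_s)ds+\sum_{i=1}^\infty1_{\{\tau_i\le T\}}c(X^i_{\tau_i},X^{i+1}_{\tau_i})\bigr]}{T}.$$ *)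

theory Defs
  imports "HOL-Probability.Probability"
begin

text \<open>
  Conventions.  Times at which something happens (stopping times, impulse times) are
  \<^typ>\<open>ennreal\<close>-valued; the value \<open>\<infinity>\<close> means that it never happens.  A filtration is a map
  \<open>F :: ennreal \<Rightarrow> 'w measure\<close>, of which only the underlying measurable spaces matter;
  \<open>F \<infinity>\<close> plays the role of the \<open>\<sigma>\<close>-field of all events and \<open>space (F \<infinity>)\<close> that
  of \<open>\<Omega>\<close>.  A process is a map \<open>X :: real \<Rightarrow> 'w \<Rightarrow> 'e\<close> of which only the values
  at times \<open>t \<ge> 0\<close> are ever used.
\<close>

definition transition ::
    "('e \<Rightarrow> 'w measure) \<Rightarrow> (real \<Rightarrow> 'w \<Rightarrow> 'e) \<Rightarrow> real \<Rightarrow> 'e \<Rightarrow> 'e set \<Rightarrow> real" where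
  "transition P X t x A = measure (P x) {\<omega> \<in> space (P x). X t \<omega> \<in> A}"

text \<open>
  Under \<open>Q\<close>, from the stopping time \<open>T\<close> of the filtration \<open>G\<close> on, the process \<open>Z\<close> moves
  according to the transition function \<open>p\<close>, started afresh from \<open>Z\<^sub>T\<close>, conditionally on the past
  up to \<open>T\<close>: on \<open>T < \<infinity>\<close>, \<open>Q(Z\<^bsub>T+t\<^esub> \<in> A | G\<^sub>T) = p t Z\<^sub>T A\<close>.
\<close>

definition markov_at ::
    "'w measure \<Rightarrow> (ennreal \<Rightarrow> 'w measure) \<Rightarrow> (real \<Rightarrow> 'w \<Rightarrow> 'e::topological_space) \<Rightarrow>
     (real \<Rightarrow> 'e \<Rightarrow> 'e set \<Rightarrow> real) \<Rightarrow> ('w \<Rightarrow> ennreal) \<Rightarrow> bool" where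
  "markov_at Q G Z p T \<longleftrightarrow>
     (\<forall>t\<ge>0. \<forall>A\<in>sets borel. AE \<omega> in Q. T \<omega> < \<infinity> \<longrightarrow>
        real_cond_exp Q (filtration.pre_sigma (space Q) G T)
          (\<lambda>\<omega>. indicator A (Z (enn2real (T \<omega>) + t) \<omega>)) \<omega>
        = p t (Z (enn2real (T \<omega>)) \<omega>) A)"

text \<open>
  A standard process with infinite lifetime in the sense of Blumenthal and Getoor, except that the
  \<open>\<sigma>\<close>-fields are not required to be completed and no shift operators on \<open>\<Omega>\<close> are required.
  Completeness is left out on purpose: a later copy in the controlled process is forced to visit a
  prescribed state at a prescribed time, which typically is a null event for all the \<open>P x\<close>, and
  its law is not determined on subsets of such events.
\<close>

locale standard_process = filtration "space (F \<infinity>)" F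
  for F :: "ennreal \<Rightarrow> 'w measure" +
  fixes X :: "real \<Rightarrow> 'w \<Rightarrow> 'e::polish_space"
    and P :: "'e \<Rightarrow> 'w measure"
  assumes filtration_right_continuous:
      "\<And>t. t < \<infinity> \<Longrightarrow> sets (F t) = (\<Inter>s\<in>{t<..}. sets (F s))"
    and adapted: "\<And>t. 0 \<le> t \<Longrightarrow> X t \<in> F (ennreal t) \<rightarrow>\<^sub>M borel"
    and paths_right_continuous:
      "\<And>\<omega> t. \<omega> \<in> space (F \<infinity>) \<Longrightarrow> 0 \<le> t \<Longrightarrow> continuous (at_right t) (\<lambda>s. X s \<omega>)"
    and paths_left_limits:
      "\<And>\<omega> t. \<omega> \<in> space (F \<infinity>) \<Longrightarrow> 0 < t \<Longrightarrow> \<exists>l. ((\<lambda>s. X s \<omega>) \<longlongrightarrow> l) (at_left t)"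
    and prob_space_P: "\<And>x. prob_space (P x)"
    and sets_P: "\<And>x. sets (P x) = sets (F \<infinity>)"
    and starts: "\<And>x. AE \<omega> in P x. X 0 \<omega> = x"
    and transition_measurable:
      "\<And>t A. 0 \<le> t \<Longrightarrow> A \<in> sets borel \<Longrightarrow> (\<lambda>x. transition P X t x A) \<in> borel \<rightarrow>\<^sub>M borel"
    and strong_markov:
      "\<And>x T. stopping_time F T \<Longrightarrow> markov_at (P x) F X (transition P X) T"
    and quasi_left_continuous:
      "\<And>x T. (\<And>n. stopping_time F (T n)) \<Longrightarrow>
         (\<And>\<omega>. \<omega> \<in> space (F \<infinity>) \<Longrightarrow> incseq (\<lambda>n. T n \<omega>)) \<Longrightarrow>
         AE \<omega> in P x. (SUP n. T n \<omega>) < \<infinity> \<longrightarrow>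
           (\<lambda>n. X (enn2real (T n \<omega>)) \<omega>) \<longlonglongrightarrow> X (enn2real (SUP n. T n \<omega>)) \<omega>"


section \<open>Impulse strategies\<close>

text \<open>
  Copies of \<open>\<Omega>\<close> and impulses are both numbered from 0: copy \<open>k\<close> carries the process usually
  written \<open>X\<^bsup>k+1\<^esup>\<close>, and impulse \<open>k\<close>, usually written \<open>(\<tau>\<^bsub>k+1\<^esub>, \<xi>\<^bsub>k+1\<^esub>)\<close>,
  switches from copy \<open>k\<close> to copy \<open>Suc k\<close>.
\<close>

type_synonym ('w, 'e) strategy =
  "(nat \<Rightarrow> (nat \<Rightarrow> 'w) \<Rightarrow> ennreal) \<times> (nat \<Rightarrow> (nat \<Rightarrow> 'w) \<Rightarrow> 'e)"

definition copies :: "(ennreal \<Rightarrow> 'w measure) \<Rightarrow> (nat \<Rightarrow> 'w) measure" where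
  "copies F = (\<Pi>\<^sub>M k\<in>UNIV. F \<infinity>)"

text \<open>\<open>F\<^sub>t \<otimes> \<dots> \<otimes> F\<^sub>t\<close> on the first \<open>n\<close> copies, as a \<open>\<sigma>\<close>-field on the whole product.\<close>

definition copies_filtration ::
    "(ennreal \<Rightarrow> 'w measure) \<Rightarrow> nat \<Rightarrow> ennreal \<Rightarrow> (nat \<Rightarrow> 'w) measure" where
  "copies_filtration F n t =
     vimage_algebra (space (copies F)) (\<lambda>\<omega>. restrict \<omega> {..<n}) (\<Pi>\<^sub>M k\<in>{..<n}. F t)"

text \<open>
  The decision on impulse \<open>k\<close> is based on the copies \<open>0, \<dots>, k\<close> that have been in use by then.
\<close>

definition strategies :: "(ennreal \<Rightarrow> 'w measure) \<Rightarrow> ('w, 'e::topological_space) strategy set" where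
  "strategies F = {(\<tau>, \<xi>).
     (\<forall>k. stopping_time (copies_filtration F (Suc k)) (\<tau> k)) \<and>
     (\<forall>k. \<forall>\<omega>\<in>space (copies F). \<tau> k \<omega> \<le> \<tau> (Suc k) \<omega>) \<and>
     (\<forall>k. \<xi> k \<in> filtration.pre_sigma (space (copies F)) (copies_filtration F (Suc k)) (\<tau> k)
             \<rightarrow>\<^sub>M borel)}"

definition grid_strategies ::
    "(ennreal \<Rightarrow> 'w measure) \<Rightarrow> real \<Rightarrow> ('w, 'e::topological_space) strategy set" where
  "grid_strategies F h = {(\<tau>, \<xi>) \<in> strategies F.
     \<forall>k. \<forall>\<omega>\<in>space (copies F). \<tau> k \<omega> = \<infinity> \<or> (\<exists>n::nat. \<tau> k \<omega> = ennreal (real n * h))}"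

text \<open>Time and state at which copy \<open>k\<close> is switched on; \<open>x\<close> is the initial state.\<close>

fun switch_time :: "('w, 'e) strategy \<Rightarrow> nat \<Rightarrow> (nat \<Rightarrow> 'w) \<Rightarrow> ennreal" where
  "switch_time (\<tau>, \<xi>) 0 \<omega> = 0"
| "switch_time (\<tau>, \<xi>) (Suc k) \<omega> = \<tau> k \<omega>"

fun switch_state :: "'e \<Rightarrow> ('w, 'e) strategy \<Rightarrow> nat \<Rightarrow> (nat \<Rightarrow> 'w) \<Rightarrow> 'e" where
  "switch_state x (\<tau>, \<xi>) 0 \<omega> = x"
| "switch_state x (\<tau>, \<xi>) (Suc k) \<omega> = \<xi> k \<omega>"

text \<open>
  \<open>Q\<close> is a law of the controlled system for the initial state \<open>x\<close> and the strategy \<open>V\<close>.  Writing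
  \<open>S\<^sub>k\<close> for the switch times, copy \<open>k\<close> is in the prescribed state at time \<open>S\<^sub>k\<close>, and
  \<open>(X\<^bsub>S\<^sub>k + s\<^esub>)\<^bsub>s \<ge> 0\<^esub>\<close> on copy \<open>k\<close> is Markov with the uncontrolled transition function relative
  to the past \<open>(F\<^bsub>S\<^sub>k + s\<^esub> \<otimes> \<dots> \<otimes> F\<^bsub>S\<^sub>k + s\<^esub>)\<^bsub>s \<ge> 0\<^esub>\<close> of the copies \<open>0, \<dots>, k\<close>.  Nothing is
  prescribed for copy \<open>k\<close> before \<open>S\<^sub>k\<close>.
\<close>

definition controlled_law ::
    "(ennreal \<Rightarrow> 'w measure) \<Rightarrow> (real \<Rightarrow> 'w \<Rightarrow> 'e::topological_space) \<Rightarrow> ('e \<Rightarrow> 'w measure) \<Rightarrow>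
     'e \<Rightarrow> ('w, 'e) strategy \<Rightarrow> (nat \<Rightarrow> 'w) measure \<Rightarrow> bool" where
  "controlled_law F X P x V Q \<longleftrightarrow>
     prob_space Q \<and> sets Q = sets (copies F) \<and>
     (\<forall>k. (AE \<omega> in Q. switch_time V k \<omega> < \<infinity> \<longrightarrow>
             X (enn2real (switch_time V k \<omega>)) (\<omega> k) = switch_state x V k \<omega>) \<and>
          (\<forall>s\<ge>0. markov_at Q (copies_filtration F (Suc k)) (\<lambda>t \<omega>. X t (\<omega> k)) (transition P X)
                   (\<lambda>\<omega>. switch_time V k \<omega> + ennreal s)))"


section \<open>The average cost functional\<close>

text \<open>
  If the impulse times accumulate before \<open>t\<close>, then no \<open>k\<close> qualifies and the value of the
  controlled process at \<open>t\<close> is immaterial: infinitely many impulses, each of cost at least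
  \<open>c\<^sub>0 > 0\<close>, have been paid for by then.
\<close>

definition controlled_process ::
    "(real \<Rightarrow> 'w \<Rightarrow> 'e) \<Rightarrow> ('w, 'e) strategy \<Rightarrow> real \<Rightarrow> (nat \<Rightarrow> 'w) \<Rightarrow> 'e" where
  "controlled_process X V t \<omega> =
     X t (\<omega> (THE k. switch_time V k \<omega> \<le> ennreal t \<and> ennreal t < switch_time V (Suc k) \<omega>))"

text \<open>
  The expectation is split into that of the bounded running cost and that of the nonnegative,
  possibly infinite, impulse costs.
\<close>

definition expected_cost ::
    "('e \<Rightarrow> real) \<Rightarrow> ('e \<Rightarrow> 'e \<Rightarrow> real) \<Rightarrow> (real \<Rightarrow> 'w \<Rightarrow> 'e) \<Rightarrow> (nat \<Rightarrow> 'w) measure \<Rightarrow>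
     ('w, 'e) strategy \<Rightarrow> real \<Rightarrow> ereal" where
  "expected_cost g c X Q V T =
     ereal (\<integral>\<omega>. (LBINT s:{0..T}. g (controlled_process X V s \<omega>)) \<partial>Q) +
     enn2ereal (\<integral>\<^sup>+\<omega>. (\<Sum>k. if switch_time V (Suc k) \<omega> \<le> ennreal T
        then ennreal (c (X (enn2real (switch_time V (Suc k) \<omega>)) (\<omega> k))
                        (X (enn2real (switch_time V (Suc k) \<omega>)) (\<omega> (Suc k))))
        else 0) \<partial>Q)"

definition average_cost ::
    "('e \<Rightarrow> real) \<Rightarrow> ('e \<Rightarrow> 'e \<Rightarrow> real) \<Rightarrow> (real \<Rightarrow> 'w \<Rightarrow> 'e) \<Rightarrow> (nat \<Rightarrow> 'w) measure \<Rightarrow>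
     ('w, 'e) strategy \<Rightarrow> ereal" where
  "average_cost g c X Q V = Limsup at_top (\<lambda>T::real. expected_cost g c X Q V T / ereal T)"

end

theory Submission
  imports Defs
begin

text \<open>
  Fix a small step \<open>h\<close>.  A slightly discounted Bellman equation on the grid of width \<open>h\<close> has an
  approximate solution, of oscillation at most \<open>sup c\<close> because every state can be reached from every
  other one at that cost.  Up to a small error \<open>\<epsilon>\<close> per unit of time it therefore yields a function \<open>w\<close>
  and a constant \<open>\<mu>\<close> with \<open>w y \<le> c y \<xi> + w \<xi>\<close> and \<open>w \<le> P\<^sub>h w + h (g - \<mu>)\<close>, and a threshold strategy
  on the grid along which these are almost equalities, so that its average cost is at most \<open>\<mu> + 3 \<epsilon>\<close>.

  For the converse bound, over all strategies, \<open>w\<close> is turned into a subsolution \<open>u\<close> on every finer grid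
  of width \<open>h / N\<close>, by maximising over the functions that arise from \<open>w\<close> by running the uncontrolled
  process for a time less than \<open>h\<close>.  Here \<open>u y \<le> c y \<xi> + u \<xi>\<close> survives up to a small error,
  because over times at most \<open>h\<close> the semigroup moves the functions \<open>c \<cdot> \<xi>\<close> uniformly little.
  Optional stopping along grids of width \<open>h / N\<close> that are attached to the successive switch times, and
  \<open>N \<rightarrow> \<infinity>\<close>, where only the right continuity of paths and the continuity of \<open>c\<close> are used, show that
  no strategy does much better than \<open>\<mu>\<close>.

  The uniform continuity of the semigroup at time \<open>0\<close> is Dini's theorem for continuous excessive
  functions, of which compactness provides enough to separate a point from the complement of a
  neighbourhood.
\<close>

text \<open>A strategy may act at any stopping time, whereas \<open>w\<close> is a subsolution only
  over steps of length exactly \<open>h\<close>. On the finer grids a step that is in progress at an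
  impulse is completed rather than cut, since a subsolution controls steps of fixed length only;
  this is possible because copy \<open>k\<close> keeps running after the impulse that leaves it. The
  inequality \<open>u y \<le> c y \<xi> + u \<xi>\<close> is then applied at the overshot state. So
  \<open>u\<close>, which is only measurable and changes with \<open>N\<close>, is never compared at
  two nearby states; in the limit this happens to \<open>c\<close> alone. The error in that
  inequality is made once per impulse, and as an impulse costs at least \<open>c\<^sub>0\<close>, it
  amounts to a small fraction of the impulse cost. The bounds on \<open>u\<close> depend neither on
  \<open>N\<close> nor on the strategy and disappear after division by the horizon. For each
  \<open>h\<close> both estimates centre on the same \<open>\<mu>\<close>, so it does not matter
  whether \<open>\<mu>\<close> and \<open>w\<close> converge as \<open>h\<close> tends to 0.\<close>

section \<open>The transition semigroup\<close>

(* Keeps the \<infinity> of the definitions from being rewritten to top. *)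
declare infinity_ennreal_def [simp del]

text \<open>Right continuity lets \<open>f t\<close> be replaced by \<open>f\<close> at grid points
  just after \<open>t\<close>. Each approximation uses countably many fixed times and is therefore
  jointly measurable. Negative times are sent to 0 because nothing is known about \<open>f\<close>
  there.\<close>

lemma measurable_right_continuous:
  fixes f :: "real \<Rightarrow> 'a \<Rightarrow> 'b::metric_space"
  assumes f: "\<And>t. 0 \<le> t \<Longrightarrow> f t \<in> M \<rightarrow>\<^sub>M borel"
    and cont: "\<And>t x. 0 \<le> t \<Longrightarrow> x \<in> space M \<Longrightarrow> continuous (at_right t) (\<lambda>s. f s x)"
  shows "(\<lambda>(t, x). f (max 0 t) x) \<in> borel \<Otimes>\<^sub>M M \<rightarrow>\<^sub>M borel"
proof (rule borel_measurable_LIMSEQ_metric)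
  define a where "a n t = real (nat \<lfloor>max 0 t * real (Suc n)\<rfloor> + 1) / real (Suc n)" for n and t :: real
  fix n :: nat
  have "(\<lambda>p. f (real (nat \<lfloor>max 0 (fst p) * real (Suc n)\<rfloor> + 1) / real (Suc n)) (snd p)) \<in> borel \<Otimes>\<^sub>M M \<rightarrow>\<^sub>M borel"
  proof (rule measurable_compose_countable[where f="\<lambda>i p. f (real (i + 1) / real (Suc n)) (snd p)"])
    show "(\<lambda>p. f (real (i + 1) / real (Suc n)) (snd p)) \<in> borel \<Otimes>\<^sub>M M \<rightarrow>\<^sub>M borel" for i
      by (rule measurable_compose[OF measurable_snd f]) simp
  qed measurable
  then show "(\<lambda>p. f (a n (fst p)) (snd p)) \<in> borel \<Otimes>\<^sub>M M \<rightarrow>\<^sub>M borel"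
    unfolding a_def .
next
  define a where "a n t = real (nat \<lfloor>max 0 t * real (Suc n)\<rfloor> + 1) / real (Suc n)" for n and t :: real
  \<comment> \<open>The \<open>+ 1\<close> in \<open>a\<close> puts the point strictly to the right
    of \<open>max 0 t\<close>, so that the approach is within \<open>at_right\<close>.\<close>
  have a_gt: "max 0 t < a n t" and a_le: "a n t \<le> max 0 t + 1 / real (Suc n)" for n t
  proof -
    define z where "z = \<lfloor>max 0 t * real (Suc n)\<rfloor>"
    have "0 \<le> z" by (simp add: z_def)
    moreover have "max 0 t * real (Suc n) < of_int z + 1" "of_int z \<le> max 0 t * real (Suc n)"
      unfolding z_def by linarith+
    moreover have "a n t = (of_int z + 1) / real (Suc n)"
      using \<open>0 \<le> z\<close> by (simp add: a_def z_def)
    ultimately show "max 0 t < a n t" "a n t \<le> max 0 t + 1 / real (Suc n)"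
      by (simp_all only: pos_less_divide_eq pos_divide_le_eq of_nat_0_less_iff zero_less_Suc distrib_right
          nonzero_divide_eq_eq) (simp_all del: of_nat_Suc)
  qed
  fix p :: "real \<times> 'a" assume p: "p \<in> space (borel \<Otimes>\<^sub>M M)"
  obtain t x where [simp]: "p = (t, x)" by (cases p)
  have "(\<lambda>n. a n t) \<longlonglongrightarrow> max 0 t"
  proof (rule tendsto_sandwich[OF _ _ tendsto_const])
    show "(\<lambda>n. max 0 t + 1 / real (Suc n)) \<longlonglongrightarrow> max 0 t"
      using tendsto_add[OF tendsto_const[of "max 0 t"] lim_1_over_n[THEN LIMSEQ_Suc]] by simp
  qed (use a_gt a_le in \<open>auto intro!: always_eventually less_imp_le\<close>)
  then have "filterlim (\<lambda>n. a n t) (at_right (max 0 t)) sequentially"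
    unfolding filterlim_at using a_gt[of t, THEN less_imp_neq] a_gt[of t]
    by (intro conjI always_eventually allI) (simp_all, metis)
  moreover have "((\<lambda>s. f s x) \<longlongrightarrow> f (max 0 t) x) (at_right (max 0 t))"
    using cont[of "max 0 t" x] p by (simp add: continuous_within space_pair_measure)
  ultimately show "(\<lambda>n. f (real (nat \<lfloor>max 0 (fst p) * real (Suc n)\<rfloor> + 1) / real (Suc n)) (snd p))
      \<longlonglongrightarrow> (case p of (t, x) \<Rightarrow> f (max 0 t) x)"
    unfolding a_def \<open>p = (t, x)\<close> prod.case fst_conv snd_conv by (rule filterlim_compose[rotated])
qed

section \<open>Transition kernels and the semigroup on bounded measurable functions\<close>

context standard_process
begin

definition semigroup :: "real \<Rightarrow> ('e \<Rightarrow> real) \<Rightarrow> 'e \<Rightarrow> real" where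
  "semigroup t f x = (\<integral>\<omega>. f (X t \<omega>) \<partial>P x)"

lemma space_P: "space (P x) = space (F \<infinity>)"
  by (rule sets_eq_imp_space_eq[OF sets_P])

lemma sets_F_le: "sets (F t) \<subseteq> sets (F \<infinity>)"
  by (rule sets_F_mono) (simp add: infinity_ennreal_def)

lemma X_measurable [measurable]: "0 \<le> t \<Longrightarrow> X t \<in> F \<infinity> \<rightarrow>\<^sub>M borel"
  by (rule measurable_from_subalg[OF _ adapted]) (simp_all add: subalgebra_def space_F[of "ennreal t"] sets_F_le)

lemma X_measurable_P: "0 \<le> t \<Longrightarrow> X t \<in> P x \<rightarrow>\<^sub>M borel"
  using X_measurable[of t] by (simp add: measurable_cong_sets[OF sets_P refl])

lemma X_joint [measurable]: "(\<lambda>(t, \<omega>). X (max 0 t) \<omega>) \<in> borel \<Otimes>\<^sub>M F \<infinity> \<rightarrow>\<^sub>M borel"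
  by (rule measurable_right_continuous) (auto intro: paths_right_continuous)

text \<open>The transition function as a measure on the state space, so that laws can be composed by
  the bind of the Giry monad.\<close>

definition kernel :: "real \<Rightarrow> 'e \<Rightarrow> 'e measure" where
  "kernel t x = distr (P x) borel (X t)"

lemma sets_kernel [simp]: "sets (kernel t x) = sets borel"
  by (simp add: kernel_def)

lemma prob_space_kernel: "0 \<le> t \<Longrightarrow> prob_space (kernel t x)"
  unfolding kernel_def by (intro prob_space.prob_space_distr prob_space_P X_measurable_P)

lemma emeasure_kernel:
  assumes "0 \<le> t" "A \<in> sets borel"
  shows "emeasure (kernel t x) A = ennreal (transition P X t x A)"
proof -
  interpret prob_space "P x" by (rule prob_space_P)
  have "emeasure (kernel t x) A = emeasure (P x) {\<omega> \<in> space (P x). X t \<omega> \<in> A}"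
    unfolding kernel_def using assms
    by (subst emeasure_distr) (auto intro!: X_measurable_P arg_cong[where f="emeasure _"])
  then show ?thesis
    by (simp add: transition_def emeasure_eq_measure)
qed

lemma kernel_measurable: "0 \<le> t \<Longrightarrow> kernel t \<in> borel \<rightarrow>\<^sub>M subprob_algebra borel"
  by (rule measurable_subprob_algebra)
    (auto intro!: prob_space_imp_subprob_space prob_space_kernel measurable_compose[OF transition_measurable]
      simp: emeasure_kernel)

lemma semigroup_kernel:
  "0 \<le> t \<Longrightarrow> f \<in> borel_measurable borel \<Longrightarrow> semigroup t f x = (\<integral>y. f y \<partial>kernel t x)"
  unfolding semigroup_def kernel_def by (subst integral_distr) (auto intro: X_measurable_P)

lemma semigroup_measurable:
  assumes "0 \<le> t" "f \<in> borel_measurable borel"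
  shows "semigroup t f \<in> borel_measurable borel"
proof -
  have "(\<lambda>x. \<integral>y. f y \<partial>kernel t x) \<in> borel_measurable borel"
    by (rule measurable_compose[OF kernel_measurable integral_measurable_subprob_algebra]) (use assms in auto)
  then show ?thesis
    using semigroup_kernel[OF assms] by (simp cong: measurable_cong)
qed

lemma integrable_X:
  fixes f :: "'e \<Rightarrow> real"
  assumes "0 \<le> t" "f \<in> borel_measurable borel" "\<And>x. \<bar>f x\<bar> \<le> C"
  shows "integrable (P x) (\<lambda>\<omega>. f (X t \<omega>))"
proof -
  interpret prob_space "P x" by (rule prob_space_P)
  show ?thesis
    by (rule integrable_const_bound[of _ C])
      (use assms in \<open>auto intro!: measurable_compose[OF X_measurable_P]\<close>)
qed

lemma semigroup_const: "semigroup t (\<lambda>_. a) x = a"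
proof -
  interpret prob_space "P x" by (rule prob_space_P)
  show ?thesis by (simp add: semigroup_def prob_space)
qed

lemma semigroup_mono:
  assumes "0 \<le> t" "f \<in> borel_measurable borel" "\<And>x. \<bar>f x\<bar> \<le> C"
    "g \<in> borel_measurable borel" "\<And>x. \<bar>g x\<bar> \<le> C'" "\<And>x. f x \<le> g x"
  shows "semigroup t f x \<le> semigroup t g x"
  unfolding semigroup_def by (intro integral_mono integrable_X[where C=C] integrable_X[where C=C'] assms)

lemma semigroup_le:
  assumes "0 \<le> t" "f \<in> borel_measurable borel" "\<And>x. \<bar>f x\<bar> \<le> C" "\<And>x. f x \<le> a"
  shows "semigroup t f x \<le> a"
  using semigroup_mono[of t f C "\<lambda>_. a" "\<bar>a\<bar>" x] assms by (simp add: semigroup_const)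

lemma semigroup_ge:
  assumes "0 \<le> t" "f \<in> borel_measurable borel" "\<And>x. \<bar>f x\<bar> \<le> C" "\<And>x. a \<le> f x"
  shows "a \<le> semigroup t f x"
  using semigroup_mono[of t "\<lambda>_. a" "\<bar>a\<bar>" f C x] assms by (simp add: semigroup_const)

lemma semigroup_bound:
  assumes "0 \<le> t" "f \<in> borel_measurable borel" "\<And>x. \<bar>f x\<bar> \<le> C"
  shows "\<bar>semigroup t f x\<bar> \<le> C"
proof -
  have "f y \<le> C" "- C \<le> f y" for y using assms(3)[of y] by linarith+
  then show ?thesis
    using semigroup_le[of t f C C x] semigroup_ge[of t f C "-C" x] assms by (simp add: abs_le_iff)
qed

lemma semigroup_add:
  assumes "0 \<le> t" "f \<in> borel_measurable borel" "\<And>x. \<bar>f x\<bar> \<le> C"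
    "g \<in> borel_measurable borel" "\<And>x. \<bar>g x\<bar> \<le> C'"
  shows "semigroup t (\<lambda>y. f y + g y) x = semigroup t f x + semigroup t g x"
  unfolding semigroup_def
  by (intro Bochner_Integration.integral_add integrable_X[where C=C] integrable_X[where C=C'] assms)

lemma semigroup_cmult: "semigroup t (\<lambda>y. a * f y) x = a * semigroup t f x"
  unfolding semigroup_def by simp

lemma semigroup_diff:
  assumes "0 \<le> t" "f \<in> borel_measurable borel" "\<And>x. \<bar>f x\<bar> \<le> C"
    "g \<in> borel_measurable borel" "\<And>x. \<bar>g x\<bar> \<le> C'"
  shows "semigroup t (\<lambda>y. f y - g y) x = semigroup t f x - semigroup t g x"
  unfolding semigroup_def
  by (intro Bochner_Integration.integral_diff integrable_X[where C=C] integrable_X[where C=C'] assms)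

lemma semigroup_0:
  assumes "f \<in> borel_measurable borel"
  shows "semigroup 0 f x = f x"
proof -
  interpret prob_space "P x" by (rule prob_space_P)
  have "semigroup 0 f x = (\<integral>\<omega>. f x \<partial>P x)"
    unfolding semigroup_def
    by (rule integral_cong_AE) (use starts[of x] assms in \<open>auto intro!: measurable_compose[OF X_measurable_P]\<close>)
  then show ?thesis by (simp add: prob_space)
qed

section \<open>The Markov property for bounded functions, and the Chapman-Kolmogorov
  equation\<close>

text \<open>\<open>markov_at\<close> speaks of indicators only. Read under \<open>Q\<close>
  restricted to \<open>B\<close>, it says that the law of \<open>Z\<close> at \<open>T + t\<close>
  is the law of \<open>Z\<close> at \<open>T\<close> composed with \<open>kernel t\<close>, and an
  identity of laws can be integrated against any bounded \<open>f\<close>. The event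
  \<open>B\<close> has to lie in the part where \<open>T\<close> is finite, as
  \<open>markov_at\<close> asserts nothing elsewhere.\<close>

lemma markov_integral:
  assumes Q: "prob_space Q" and G: "filtration (space Q) G" "\<And>t. sets (G t) \<subseteq> sets Q"
    and T: "stopping_time G T" and markov: "markov_at Q G Z (transition P X) T"
    and t: "0 \<le> t"
    and Z1: "(\<lambda>\<omega>. Z (enn2real (T \<omega>) + t) \<omega>) \<in> Q \<rightarrow>\<^sub>M borel"
    and Z0: "(\<lambda>\<omega>. Z (enn2real (T \<omega>)) \<omega>) \<in> Q \<rightarrow>\<^sub>M borel"
    and B: "B \<in> sets (filtration.pre_sigma (space Q) G T)" "\<And>\<omega>. \<omega> \<in> B \<Longrightarrow> T \<omega> < \<infinity>"
    and f: "f \<in> borel_measurable borel" "\<And>x. \<bar>f x\<bar> \<le> C"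
  shows "(\<integral>\<omega>. indicator B \<omega> * f (Z (enn2real (T \<omega>) + t) \<omega>) \<partial>Q)
       = (\<integral>\<omega>. indicator B \<omega> * semigroup t f (Z (enn2real (T \<omega>)) \<omega>) \<partial>Q)"
proof -
  interpret Q: prob_space Q by fact
  interpret G: filtration "space Q" G by fact
  let ?S = "filtration.pre_sigma (space Q) G T"
  let ?Z1 = "\<lambda>\<omega>. Z (enn2real (T \<omega>) + t) \<omega>" and ?Z0 = "\<lambda>\<omega>. Z (enn2real (T \<omega>)) \<omega>"
  note [measurable] = Z1 Z0 f(1)
  have sub: "subalgebra Q ?S"
    unfolding subalgebra_def
  proof (intro conjI subsetI)
    show "space ?S = space Q" by (rule G.space_pre_sigma)
    fix A assume A: "A \<in> sets ?S"
    have "{\<omega> \<in> A. T \<omega> \<le> top} \<in> sets (G top)"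
      by (rule G.sets_pre_sigmaD[OF T A])
    then show "A \<in> sets Q" using G(2) by auto
  qed
  interpret sigma_finite_subalgebra Q ?S
    by (rule finite_measure_subalgebra_is_sigma_finite)
      (simp add: finite_measure_subalgebra_def finite_measure_subalgebra_axioms_def sub Q.finite_measure_axioms)
  have BQ [measurable]: "B \<in> sets Q"
    using sub B(1) by (auto simp: subalgebra_def)
  define R where "R = density Q (indicator B)"
  have [simp]: "sets R = sets Q" by (simp add: R_def)
  have Z1R: "?Z1 \<in> R \<rightarrow>\<^sub>M borel" and Z0R: "?Z0 \<in> R \<rightarrow>\<^sub>M borel"
    using Z1 Z0 by (simp_all add: R_def)
  have K: "kernel t \<in> distr R borel ?Z0 \<rightarrow>\<^sub>M subprob_algebra borel"
    using kernel_measurable[OF t] by simp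
  have eq: "distr R borel ?Z1 = distr R borel ?Z0 \<bind> kernel t"
  proof (rule measure_eqI)
    show "sets (distr R borel ?Z1) = sets (distr R borel ?Z0 \<bind> kernel t)"
      by (subst sets_bind[where N=borel]) (auto simp: space_distr)
  next
    fix A assume "A \<in> sets (distr R borel ?Z1)"
    then have A [measurable]: "A \<in> sets borel" by simp
    have tr [measurable]: "(\<lambda>y. transition P X t y A) \<in> borel_measurable borel"
      by (rule transition_measurable[OF t A])
    have tr_bound: "0 \<le> transition P X t y A" "transition P X t y A \<le> 1" for y
      using prob_space.prob_le_1[OF prob_space_P] by (auto simp: transition_def)
    have "emeasure (distr R borel ?Z1) A = emeasure R {\<omega> \<in> space Q. ?Z1 \<omega> \<in> A}"
      by (subst emeasure_distr[OF Z1R A]) (auto simp: R_def intro!: arg_cong2[where f=emeasure])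
    also have "\<dots> = (\<integral>\<^sup>+\<omega>. ennreal (indicator B \<omega> * indicator A (?Z1 \<omega>)) \<partial>Q)"
      unfolding R_def
      by (subst emeasure_density) (auto intro!: nn_integral_cong split: split_indicator)
    also have "\<dots> = ennreal (\<integral>\<omega>. indicator B \<omega> * indicator A (?Z1 \<omega>) \<partial>Q)"
      by (rule nn_integral_eq_integral) (auto intro!: Q.integrable_const_bound[of _ 1] split: split_indicator)
    also have "(\<integral>\<omega>. indicator B \<omega> * indicator A (?Z1 \<omega>) \<partial>Q)
        = (\<integral>\<omega>. indicator B \<omega> * real_cond_exp Q ?S (\<lambda>\<omega>. indicator A (?Z1 \<omega>)) \<omega> \<partial>Q)"
      using B(1) by (intro real_cond_exp_intg(2)[symmetric])
        (auto intro!: Q.integrable_const_bound[of _ 1] split: split_indicator)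
    also have "\<dots> = (\<integral>\<omega>. indicator B \<omega> * transition P X t (?Z0 \<omega>) A \<partial>Q)"
    proof (rule integral_cong_AE)
      have "AE \<omega> in Q. T \<omega> < \<infinity> \<longrightarrow>
          real_cond_exp Q ?S (\<lambda>\<omega>. indicator A (?Z1 \<omega>)) \<omega> = transition P X t (?Z0 \<omega>) A"
        using markov t A unfolding markov_at_def by auto
      then show "AE \<omega> in Q. indicator B \<omega> * real_cond_exp Q ?S (\<lambda>\<omega>. indicator A (?Z1 \<omega>)) \<omega>
          = indicator B \<omega> * transition P X t (?Z0 \<omega>) A"
        using B(2) by (auto split: split_indicator)
    qed measurable
    also have "ennreal \<dots> = (\<integral>\<^sup>+\<omega>. ennreal (indicator B \<omega> * transition P X t (?Z0 \<omega>) A) \<partial>Q)"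
      using tr_bound
      by (intro nn_integral_eq_integral[symmetric])
         (auto intro!: Q.integrable_const_bound[of _ 1] split: split_indicator)
    also have "\<dots> = (\<integral>\<^sup>+\<omega>. ennreal (transition P X t (?Z0 \<omega>) A) \<partial>R)"
      unfolding R_def
      by (subst nn_integral_density) (auto intro!: nn_integral_cong split: split_indicator)
    also have "\<dots> = (\<integral>\<^sup>+y. emeasure (kernel t y) A \<partial>distr R borel ?Z0)"
      by (subst nn_integral_distr[OF Z0R]) (auto simp: emeasure_kernel t)
    also have "\<dots> = emeasure (distr R borel ?Z0 \<bind> kernel t) A"
      by (subst emeasure_bind[OF _ K]) auto
    finally show "emeasure (distr R borel ?Z1) A = \<dots>" .
  qed
  \<comment> \<open>Adding \<open>C\<close> makes the integrand nonnegative, as needed for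
    integration against a bind. The kernel preserves the constant, so it cancels at the end.\<close>
  have nonneg: "0 \<le> f y + C" for y using f(2)[of y] by linarith
  have bound: "\<bar>f y + C\<bar> \<le> 2 * C" for y using f(2)[of y] by linarith
  have sg: "semigroup t (\<lambda>y. f y + C) y = semigroup t f y + C" for y
    using semigroup_add[OF t f, of "\<lambda>_. C" "\<bar>C\<bar>"] by (simp add: semigroup_const)
  have sg_nonneg: "0 \<le> semigroup t f y + C" for y
    using semigroup_bound[OF t f, of y] by linarith
  have [measurable]: "semigroup t f \<in> borel_measurable borel" by (rule semigroup_measurable[OF t f(1)])
  have "integrable Q (\<lambda>\<omega>. indicator B \<omega> * C)"
    by (intro integrable_mult_left integrable_real_indicator) (auto simp: Q.emeasure_eq_measure infinity_ennreal_def)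
  moreover have "integrable Q (\<lambda>\<omega>. indicator B \<omega> * f (?Z1 \<omega>))"
      "integrable Q (\<lambda>\<omega>. indicator B \<omega> * semigroup t f (?Z0 \<omega>))"
    using order_trans[OF f(2) abs_ge_self] order_trans[OF semigroup_bound[OF t f] abs_ge_self]
    by (auto intro!: Q.integrable_const_bound[of _ "\<bar>C\<bar>"] AE_I2 simp: abs_mult split: split_indicator)
  ultimately have int: "integrable Q (\<lambda>\<omega>. indicator B \<omega> * f (?Z1 \<omega>))" "integrable Q (\<lambda>\<omega>. indicator B \<omega> * C)"
      "integrable Q (\<lambda>\<omega>. indicator B \<omega> * semigroup t f (?Z0 \<omega>))"
    by simp_all
  have "ennreal (\<integral>\<omega>. indicator B \<omega> * (f (?Z1 \<omega>) + C) \<partial>Q) = (\<integral>\<^sup>+\<omega>. ennreal (indicator B \<omega> * (f (?Z1 \<omega>) + C)) \<partial>Q)"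
    using nonneg by (intro nn_integral_eq_integral[symmetric])
      (auto simp only: distrib_left intro!: Bochner_Integration.integrable_add int, simp add: distrib_left[symmetric])
  also have "\<dots> = (\<integral>\<^sup>+y. ennreal (f y + C) \<partial>distr R borel ?Z1)"
    unfolding R_def
    by (subst nn_integral_distr) (auto simp: nn_integral_density intro!: nn_integral_cong split: split_indicator)
  also have "\<dots> = (\<integral>\<^sup>+y. \<integral>\<^sup>+z. ennreal (f z + C) \<partial>kernel t y \<partial>distr R borel ?Z0)"
    unfolding eq by (rule nn_integral_bind[OF _ K]) simp
  also have "\<dots> = (\<integral>\<^sup>+y. ennreal (semigroup t f y + C) \<partial>distr R borel ?Z0)"
  proof (rule nn_integral_cong)
    fix y
    interpret K: prob_space "kernel t y" by (rule prob_space_kernel[OF t])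
    have "(\<integral>\<^sup>+z. ennreal (f z + C) \<partial>kernel t y) = ennreal (\<integral>z. f z + C \<partial>kernel t y)"
      using nonneg bound
      by (intro nn_integral_eq_integral K.integrable_const_bound[of _ "2 * C"])
         (auto simp: measurable_cong_sets[OF sets_kernel refl])
    then show "(\<integral>\<^sup>+z. ennreal (f z + C) \<partial>kernel t y) = ennreal (semigroup t f y + C)"
      using semigroup_kernel[OF t, of "\<lambda>y. f y + C"] sg by simp
  qed
  also have "\<dots> = (\<integral>\<^sup>+\<omega>. ennreal (indicator B \<omega> * (semigroup t f (?Z0 \<omega>) + C)) \<partial>Q)"
    unfolding R_def
    by (subst nn_integral_distr) (auto simp: nn_integral_density intro!: nn_integral_cong split: split_indicator)
  also have "\<dots> = ennreal (\<integral>\<omega>. indicator B \<omega> * (semigroup t f (?Z0 \<omega>) + C) \<partial>Q)"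
    using sg_nonneg by (intro nn_integral_eq_integral)
      (auto simp only: distrib_left intro!: Bochner_Integration.integrable_add int, simp add: distrib_left[symmetric])
  finally have "(\<integral>\<omega>. indicator B \<omega> * (f (?Z1 \<omega>) + C) \<partial>Q) = (\<integral>\<omega>. indicator B \<omega> * (semigroup t f (?Z0 \<omega>) + C) \<partial>Q)"
    using nonneg sg_nonneg by (subst (asm) ennreal_inj) (auto intro!: Bochner_Integration.integral_nonneg)
  then show ?thesis
    unfolding distrib_left using int by (simp only: Bochner_Integration.integral_add)
qed

text \<open>The strong Markov property at the constant time \<open>s\<close>, tested on the whole
  space.\<close>

lemma semigroup_semigroup:
  assumes st: "0 \<le> s" "0 \<le> t" and f: "f \<in> borel_measurable borel" "\<And>x. \<bar>f x\<bar> \<le> C"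
  shows "semigroup s (semigroup t f) x = semigroup (s + t) f x"
proof -
  have T: "stopping_time F (\<lambda>_. ennreal s)" by (rule stopping_time_const)
  have fil: "filtration (space (P x)) F"
    using space_F sets_F_mono by (simp add: filtration_def space_P)
  have "space (P x) \<in> sets (filtration.pre_sigma (space (P x)) F (\<lambda>_. ennreal s))"
    using sets.top[of "filtration.pre_sigma (space (P x)) F (\<lambda>_. ennreal s)"]
    by (simp add: filtration.space_pre_sigma[OF fil])
  from markov_integral[OF prob_space_P fil _ T strong_markov[OF T] st(2) _ _ this _ f] st
  have "(\<integral>\<omega>. indicator (space (P x)) \<omega> * f (X (s + t) \<omega>) \<partial>P x)
      = (\<integral>\<omega>. indicator (space (P x)) \<omega> * semigroup t f (X s \<omega>) \<partial>P x)"
    using sets_F_le by (auto simp: sets_P X_measurable_P ennreal_less_top infinity_ennreal_def)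
  moreover have "(\<integral>\<omega>. indicator (space (P x)) \<omega> * f (X (s + t) \<omega>) \<partial>P x) = semigroup (s + t) f x"
    unfolding semigroup_def by (intro Bochner_Integration.integral_cong) auto
  moreover have "(\<integral>\<omega>. indicator (space (P x)) \<omega> * semigroup t f (X s \<omega>) \<partial>P x) = semigroup s (semigroup t f) x"
    unfolding semigroup_def[of s] by (intro Bochner_Integration.integral_cong) auto
  ultimately show ?thesis by simp
qed

end


section \<open>Uniform stochastic continuity\<close>

lemma compact_neighbourhoods_cover:
  assumes "compact K" "\<And>y. open (N y)" "\<And>y. y \<in> K \<Longrightarrow> y \<in> N y"
  obtains Y where "finite Y" "K \<subseteq> (\<Union>y\<in>Y. N y)"
proof -
  have "K \<subseteq> (\<Union>y\<in>K. N y)" using assms(3) by blast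
  with assms(1,2) obtain Y where "Y \<subseteq> K" "finite Y" "K \<subseteq> (\<Union>y\<in>Y. N y)"
    by (rule compactE_image)
  then show ?thesis using that by simp
qed

locale compact_feller_process = standard_process F X P
  for F :: "ennreal \<Rightarrow> 'w measure" and X :: "real \<Rightarrow> 'w \<Rightarrow> 'e::polish_space" and P :: "'e \<Rightarrow> 'w measure" +
  assumes compact_UNIV: "compact (UNIV :: 'e set)"
    and feller: "\<And>f t. continuous_on UNIV f \<Longrightarrow> 0 < t \<Longrightarrow> continuous_on UNIV (semigroup t f)"
begin

lemma continuous_bounded:
  fixes f :: "'e \<Rightarrow> real"
  assumes "continuous_on UNIV f"
  obtains C where "0 \<le> C" "\<And>x. \<bar>f x\<bar> \<le> C"
proof -
  have "bounded (range f)"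
    by (rule compact_imp_bounded[OF compact_continuous_image[OF assms compact_UNIV]])
  then obtain C where "\<And>x. \<bar>f x\<bar> \<le> C" by (auto simp: bounded_iff)
  moreover from this[of undefined] have "0 \<le> C" by linarith
  ultimately show ?thesis using that by blast
qed

lemma continuous_measurable:
  fixes f :: "'e \<Rightarrow> real"
  shows "continuous_on UNIV f \<Longrightarrow> f \<in> borel_measurable borel"
  by (rule borel_measurable_continuous_onI)

section \<open>Continuity of the semigroup in space and in time\<close>

lemma semigroup_continuous:
  assumes "continuous_on UNIV f" "0 \<le> t"
  shows "continuous_on UNIV (semigroup t f)"
proof (cases "t = 0")
  case True
  then have "semigroup t f = f"
    using semigroup_0[OF continuous_measurable[OF assms(1)]] by auto
  then show ?thesis using assms by simp
qed (use feller assms in auto)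

text \<open>Dominated convergence along right-continuous paths, for one starting point at a time;
  uniformity in \<open>x\<close> is what the rest of this section is for.\<close>

lemma semigroup_right_continuous:
  assumes f: "continuous_on UNIV f" and t: "0 \<le> t"
  shows "continuous (at_right t) (\<lambda>s. semigroup s f x)"
  unfolding continuous_within tendsto_at_iff_sequentially o_def
proof safe
  obtain C where C: "\<And>x. \<bar>f x\<bar> \<le> C" using continuous_bounded[OF f] by blast
  have [measurable]: "f \<in> borel_measurable borel" by (rule continuous_measurable[OF f])
  fix s :: "nat \<Rightarrow> real" assume s: "\<forall>i. s i \<in> {t<..} - {t}" "s \<longlonglongrightarrow> t"
  have s_nonneg: "0 \<le> s i" for i using s(1)[rule_format, of i] t by auto
  interpret prob_space "P x" by (rule prob_space_P)
  show "(\<lambda>n. semigroup (s n) f x) \<longlonglongrightarrow> semigroup t f x"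
    unfolding semigroup_def
  proof (rule integral_dominated_convergence[where w="\<lambda>_. C"])
    show "AE \<omega> in P x. (\<lambda>n. f (X (s n) \<omega>)) \<longlonglongrightarrow> f (X t \<omega>)"
    proof (rule AE_I2)
      fix \<omega> assume "\<omega> \<in> space (P x)"
      then have "continuous (at_right t) (\<lambda>s. X s \<omega>)"
        using paths_right_continuous t by (simp add: space_P)
      then have "(\<lambda>n. X (s n) \<omega>) \<longlonglongrightarrow> X t \<omega>"
        using s by (simp add: continuous_within tendsto_at_iff_sequentially o_def)
      then show "(\<lambda>n. f (X (s n) \<omega>)) \<longlonglongrightarrow> f (X t \<omega>)"
        using f by (intro isCont_tendsto_compose[of _ f]) (auto simp: continuous_on_eq_continuous_at)
    qed
  qed (use C t s_nonneg in \<open>auto intro!: measurable_compose[OF X_measurable_P]\<close>)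
qed

section \<open>Resolvents and continuous excessive functions\<close>

lemma semigroup_joint:
  assumes f: "continuous_on UNIV f"
  shows "(\<lambda>(t, x). semigroup (max 0 t) f x) \<in> borel_measurable (borel \<Otimes>\<^sub>M borel)"
  by (rule measurable_right_continuous)
    (auto intro: semigroup_measurable continuous_measurable f semigroup_right_continuous)

text \<open>The resolvent \<open>a R\<^sub>a f\<close>, rescaled so that it becomes an expectation over a fixed exponential time.\<close>

definition smoothed :: "real \<Rightarrow> ('e \<Rightarrow> real) \<Rightarrow> 'e \<Rightarrow> real" where
  "smoothed a f x = (\<integral>s. semigroup (max 0 s / a) f x \<partial>density lborel (exponential_density 1))"

text \<open>The classical \<open>a\<close>-excessive functions, with continuity included because
  Dini's theorem asks for it. Convergence as \<open>t\<close> decreases to 0 need not be required: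
  it follows from the right continuity of paths.\<close>

definition excessive :: "real \<Rightarrow> ('e \<Rightarrow> real) \<Rightarrow> bool" where
  "excessive a u \<longleftrightarrow> continuous_on UNIV u \<and> (\<forall>x. 0 \<le> u x) \<and>
     (\<forall>t\<ge>0. \<forall>x. exp (- a * t) * semigroup t u x \<le> u x)"

lemma semigroup_scaled_measurable:
  assumes f: "continuous_on UNIV f" and a: "0 < a"
  shows "(\<lambda>(s, x). semigroup (max 0 s / a) f x) \<in> borel_measurable (borel \<Otimes>\<^sub>M borel)"
proof -
  have "(\<lambda>(s, x). semigroup (max 0 (s / a)) f x) \<in> borel_measurable (borel \<Otimes>\<^sub>M borel)"
    using measurable_compose[OF _ semigroup_joint[OF f], of "\<lambda>(s, x). (s / a, x)" "borel \<Otimes>\<^sub>M borel"]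
    by (simp add: split_beta')
  moreover have "max 0 (s / a) = max 0 s / a" for s
    using a by (cases "0 \<le> s") (auto simp: max_def divide_le_0_iff zero_le_divide_iff)
  ultimately show ?thesis by simp
qed

lemma smoothed_nonneg:
  assumes "\<And>x. 0 \<le> f x"
  shows "0 \<le> smoothed a f x"
  unfolding smoothed_def semigroup_def using assms by (intro Bochner_Integration.integral_nonneg) auto

lemma smoothed_bound:
  assumes f: "continuous_on UNIV f" "\<And>x. \<bar>f x\<bar> \<le> C" and a: "0 < a"
  shows "\<bar>smoothed a f x\<bar> \<le> C"
proof -
  interpret prob_space "density lborel (exponential_density 1)"
    by (rule prob_space_exponential_density) simp
  have b: "\<bar>semigroup (max 0 s / a) f x\<bar> \<le> C" for s
    using semigroup_bound[of "max 0 s / a" f C x] f a continuous_measurable by simp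
  have [measurable]: "(\<lambda>s. semigroup (max 0 s / a) f x) \<in> borel_measurable borel"
    using measurable_compose[OF _ semigroup_scaled_measurable[OF f(1) a], of "\<lambda>s. (s, x)" borel] by simp
  have int: "integrable (density lborel (exponential_density 1)) (\<lambda>s. semigroup (max 0 s / a) f x)"
    by (rule integrable_const_bound[of _ C]) (use b in auto)
  have "smoothed a f x \<le> C" "- C \<le> smoothed a f x"
    unfolding smoothed_def
    using b by (auto intro!: integral_le_const[OF int] integral_ge_const[OF int] AE_I2 simp: abs_le_iff minus_le_iff)
  then show ?thesis by simp
qed

lemma smoothed_continuous:
  assumes f: "continuous_on UNIV f" and a: "0 < a"
  shows "continuous_on UNIV (smoothed a f)"
  unfolding continuous_on_eq_continuous_at[OF open_UNIV] continuous_at_sequentially o_def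
proof safe
  obtain C where C: "\<And>x. \<bar>f x\<bar> \<le> C" using continuous_bounded[OF f] by blast
  fix x :: 'e and y :: "nat \<Rightarrow> 'e" assume y: "y \<longlonglongrightarrow> x"
  have [measurable]: "(\<lambda>s. semigroup (max 0 s / a) f x) \<in> borel_measurable borel" for x
    using measurable_compose[OF _ semigroup_scaled_measurable[OF f(1) a], of "\<lambda>s. (s, x)" borel] by simp
  interpret prob_space "density lborel (exponential_density 1)"
    by (rule prob_space_exponential_density) simp
  show "(\<lambda>n. smoothed a f (y n)) \<longlonglongrightarrow> smoothed a f x"
    unfolding smoothed_def
  proof (rule integral_dominated_convergence[where w="\<lambda>_. C"])
    show "AE s in density lborel (exponential_density 1).
        (\<lambda>n. semigroup (max 0 s / a) f (y n)) \<longlonglongrightarrow> semigroup (max 0 s / a) f x"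
      using semigroup_continuous[OF f, of "max 0 _ / a"] a
      by (intro AE_I2 isCont_tendsto_compose[OF _ y]) (auto simp: continuous_on_eq_continuous_at)
    show "AE s in density lborel (exponential_density 1). norm (semigroup (max 0 s / a) f (y n)) \<le> C" for n
      using semigroup_bound[of "max 0 _ / a" f C] C a continuous_measurable[OF f] by (intro AE_I2) simp
  qed auto
qed

lemma smoothed_tendsto:
  assumes f: "continuous_on UNIV f"
  shows "(\<lambda>n. smoothed (real (Suc n)) f x) \<longlonglongrightarrow> f x"
proof -
  obtain C where C: "\<And>x. \<bar>f x\<bar> \<le> C" using continuous_bounded[OF f] by blast
  interpret prob_space "density lborel (exponential_density 1)"
    by (rule prob_space_exponential_density) simp
  have [measurable]: "(\<lambda>s. semigroup (max 0 s / real (Suc n)) f x) \<in> borel_measurable borel" for n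
    using measurable_compose[OF _ semigroup_scaled_measurable[OF f(1), of "real (Suc n)"], of "\<lambda>s. (s, x)" borel] by simp
  have "(\<lambda>n. smoothed (real (Suc n)) f x) \<longlonglongrightarrow> (\<integral>s. f x \<partial>density lborel (exponential_density 1))"
    unfolding smoothed_def
  proof (rule integral_dominated_convergence[where w="\<lambda>_. C"])
    show "AE s in density lborel (exponential_density 1).
        (\<lambda>n. semigroup (max 0 s / real (Suc n)) f x) \<longlonglongrightarrow> f x"
    proof (rule AE_I2)
      fix s :: real
      show "(\<lambda>n. semigroup (max 0 s / real (Suc n)) f x) \<longlonglongrightarrow> f x"
      proof (cases "s \<le> 0")
        case True
        then show ?thesis by (simp add: semigroup_0 continuous_measurable[OF f])
      next
        case False
        have "(\<lambda>n. s / real (Suc n)) \<longlonglongrightarrow> 0"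
          using tendsto_mult[OF tendsto_const[of s] lim_1_over_n[THEN LIMSEQ_Suc]] by simp
        then show ?thesis
          using semigroup_right_continuous[OF f order_refl, of x] False
          by (simp add: continuous_within tendsto_at_iff_sequentially o_def semigroup_0 continuous_measurable[OF f])
      qed
    qed
    show "AE s in density lborel (exponential_density 1). norm (semigroup (max 0 s / real (Suc n)) f x) \<le> C" for n
      using semigroup_bound[of "max 0 _ / real (Suc n)" f C] C continuous_measurable[OF f] by (intro AE_I2) simp
  qed (auto simp del: of_nat_Suc)
  then show ?thesis using prob_space by (simp del: of_nat_Suc)
qed

text \<open>Fubini and the semigroup law: a preliminary run of length \<open>t\<close> delays the
  exponential clock by \<open>t\<close>.\<close>

lemma semigroup_smoothed:
  assumes f: "continuous_on UNIV f" and a: "0 < a" and t: "0 \<le> t"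
  shows "semigroup t (smoothed a f) x
    = (\<integral>s. semigroup (t + max 0 s / a) f x \<partial>density lborel (exponential_density 1))"
proof -
  let ?E = "density lborel (exponential_density 1)"
  obtain C where C: "\<And>x. \<bar>f x\<bar> \<le> C" using continuous_bounded[OF f] by blast
  interpret E: prob_space ?E by (rule prob_space_exponential_density) simp
  interpret Px: prob_space "P x" by (rule prob_space_P)
  interpret pair_sigma_finite ?E "P x" ..
  interpret EP: prob_space "?E \<Otimes>\<^sub>M P x" by (intro prob_space_pair E.prob_space_axioms Px.prob_space_axioms)
  note sc = semigroup_scaled_measurable[OF f a]
  have Xt: "X t \<in> P x \<rightarrow>\<^sub>M borel" by (rule X_measurable_P[OF t])
  have "(\<lambda>p. (fst p, X t (snd p))) \<in> borel \<Otimes>\<^sub>M P x \<rightarrow>\<^sub>M borel \<Otimes>\<^sub>M borel"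
    using measurable_compose[OF measurable_snd Xt] by measurable
  from measurable_compose[OF this sc]
  have "(\<lambda>(s, \<omega>). semigroup (max 0 s / a) f (X t \<omega>)) \<in> borel_measurable (borel \<Otimes>\<^sub>M P x)"
    by (simp add: split_beta')
  also have "borel_measurable (borel \<Otimes>\<^sub>M P x) = borel_measurable (?E \<Otimes>\<^sub>M P x)"
    by (intro measurable_cong_sets sets_pair_measure_cong) auto
  finally have meas: "(\<lambda>(s, \<omega>). semigroup (max 0 s / a) f (X t \<omega>)) \<in> borel_measurable (?E \<Otimes>\<^sub>M P x)" .
  have "semigroup t (smoothed a f) x = (\<integral>\<omega>. (\<integral>s. semigroup (max 0 s / a) f (X t \<omega>) \<partial>?E) \<partial>P x)"
    unfolding semigroup_def[of t] smoothed_def ..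
  also have "\<dots> = (\<integral>s. (\<integral>\<omega>. semigroup (max 0 s / a) f (X t \<omega>) \<partial>P x) \<partial>?E)"
  proof (rule Fubini_integral)
    show "integrable (?E \<Otimes>\<^sub>M P x) (\<lambda>(s, \<omega>). semigroup (max 0 s / a) f (X t \<omega>))"
      using semigroup_bound[of "max 0 _ / a" f C] C a continuous_measurable[OF f]
      by (intro EP.integrable_const_bound[of _ C] meas AE_I2) (simp add: split_beta')
  qed
  also have "\<dots> = (\<integral>s. semigroup t (semigroup (max 0 s / a) f) x \<partial>?E)"
    unfolding semigroup_def[of t] ..
  also have "\<dots> = (\<integral>s. semigroup (t + max 0 s / a) f x \<partial>?E)"
    using t a by (intro Bochner_Integration.integral_cong refl semigroup_semigroup[OF t _ continuous_measurable[OF f] C]) auto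
  finally show ?thesis .
qed

text \<open>By the form of the exponential density, \<open>exp (- a * t)\<close> times the integral
  with the clock delayed by \<open>t\<close> is the part of the integral defining
  \<open>smoothed a f\<close> that belongs to times after \<open>t\<close>. The part before
  \<open>t\<close> is nonnegative and is dropped.\<close>

lemma excessive_smoothed:
  assumes f: "continuous_on UNIV f" "\<And>x. 0 \<le> f x" and a: "0 < a"
  shows "excessive a (smoothed a f)"
  unfolding excessive_def
proof safe
  show "continuous_on UNIV (smoothed a f)" by (rule smoothed_continuous[OF f(1) a])
  show "0 \<le> smoothed a f x" for x by (rule smoothed_nonneg[OF f(2)])
  fix t :: real and x assume t: "0 \<le> t"
  obtain C where C: "\<And>x. \<bar>f x\<bar> \<le> C" using continuous_bounded[OF f(1)] by blast
  let ?E = "density lborel (exponential_density 1)"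
  interpret E: prob_space ?E by (rule prob_space_exponential_density) simp
  define S where "S r = semigroup (max 0 r) f x" for r
  have [measurable]: "S \<in> borel_measurable borel"
    unfolding S_def using measurable_compose[OF _ semigroup_joint[OF f(1)], of "\<lambda>s. (s, x)" borel] by simp
  have S_nonneg: "0 \<le> S r" for r
    unfolding S_def semigroup_def using f(2) by (intro Bochner_Integration.integral_nonneg) auto
  have S_bound: "\<bar>S r\<bar> \<le> C" for r
    unfolding S_def using semigroup_bound[of "max 0 r" f C] C continuous_measurable[OF f(1)] by simp
  have max_div: "max 0 (r / a) = max 0 r / a" for r
    using a by (cases "0 \<le> r") (auto simp: max_def divide_le_0_iff zero_le_divide_iff)
  have max_add: "max 0 (t + max 0 r / a) = t + max 0 r / a" for r
    using t a by simp
  have int: "integrable lborel (\<lambda>r. exponential_density 1 r * h r)"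
    if [measurable]: "h \<in> borel_measurable borel" and h: "\<And>r. \<bar>h r\<bar> \<le> C" for h
  proof -
    have "integrable ?E h"
      using h by (intro E.integrable_const_bound[of _ C]) auto
    then show ?thesis
      by (subst (asm) integrable_density) (auto simp: exponential_density_def)
  qed
  have "exp (- a * t) * semigroup t (smoothed a f) x = exp (- a * t) * (\<integral>r. S (t + max 0 r / a) \<partial>?E)"
    by (simp add: semigroup_smoothed[OF f(1) a t] S_def max_add)
  also have "\<dots> = (\<integral>r. exp (- a * t) * (exponential_density 1 r * S (t + max 0 r / a)) \<partial>lborel)"
    by (subst integral_density) (auto simp: exponential_density_def)
  \<comment> \<open>For \<open>r \<ge> 0\<close> the integrands agree; for \<open>r < 0\<close> the
    left one vanishes, and the right one is the nonnegative part that is dropped.\<close>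
  also have "\<dots> \<le> (\<integral>r. exponential_density 1 (a * t + 1 * r) * S ((a * t + 1 * r) / a) \<partial>lborel)"
  proof (rule integral_mono)
    show "integrable lborel (\<lambda>r. exp (- a * t) * (exponential_density 1 r * S (t + max 0 r / a)))"
      using S_bound by (intro integrable_mult_right int) auto
    have "integrable lborel (\<lambda>r. exponential_density 1 r * S (r / a))"
      using S_bound by (intro int) auto
    then show "integrable lborel (\<lambda>r. exponential_density 1 (a * t + 1 * r) * S ((a * t + 1 * r) / a))"
      by (rule lborel_integrable_real_affine) simp
    fix r :: real
    show "exp (- a * t) * (exponential_density 1 r * S (t + max 0 r / a))
        \<le> exponential_density 1 (a * t + 1 * r) * S ((a * t + 1 * r) / a)"
    proof (cases "r < 0")
      case True
      then show ?thesis using S_nonneg by (simp add: exponential_density_def)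
    next
      case False
      then have "t + max 0 r / a = (a * t + 1 * r) / a" "\<not> a * t + r < 0"
        using a t mult_nonneg_nonneg[of a t] by (auto simp: add_divide_distrib not_less)
      then show ?thesis
        using False by (simp add: exponential_density_def mult.assoc[symmetric] exp_add[symmetric])
    qed
  qed
  also have "\<dots> = (\<integral>r. exponential_density 1 r * S (r / a) \<partial>lborel)"
    using lborel_integral_real_affine[of 1 "\<lambda>r. exponential_density 1 r * S (r / a)" "a * t"] by simp
  also have "\<dots> = smoothed a f x"
    using measurable_compose[OF _ semigroup_scaled_measurable[OF f(1) a], of "\<lambda>s. (s, x)" borel]
    unfolding smoothed_def by (subst integral_density) (auto simp: exponential_density_def S_def max_div)
  finally show "exp (- a * t) * semigroup t (smoothed a f) x \<le> smoothed a f x" .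
qed

lemma excessive_mono:
  assumes u: "excessive a u" and ab: "a \<le> b"
  shows "excessive b u"
  unfolding excessive_def
proof safe
  fix t :: real and x assume t: "0 \<le> t"
  have "0 \<le> semigroup t u x"
    unfolding semigroup_def using u by (intro Bochner_Integration.integral_nonneg) (auto simp: excessive_def)
  then have "exp (- b * t) * semigroup t u x \<le> exp (- a * t) * semigroup t u x"
    using ab t by (intro mult_right_mono) (auto intro: mult_right_mono)
  also have "\<dots> \<le> u x" using u t unfolding excessive_def by blast
  finally show "exp (- b * t) * semigroup t u x \<le> u x" .
qed (use u in \<open>auto simp: excessive_def\<close>)

lemma excessive_add_const:
  assumes u: "excessive a u" and a: "0 \<le> a" and k: "0 \<le> k"
  shows "excessive a (\<lambda>x. u x + k)"
  unfolding excessive_def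
proof safe
  have cont: "continuous_on UNIV u" using u by (simp add: excessive_def)
  then show "continuous_on UNIV (\<lambda>x. u x + k)" by (intro continuous_intros)
  show "0 \<le> u x + k" for x using u k by (simp add: excessive_def)
  obtain C where C: "\<And>x. \<bar>u x\<bar> \<le> C" using continuous_bounded[OF cont] by blast
  fix t :: real and x assume t: "0 \<le> t"
  have "semigroup t (\<lambda>x. u x + k) x = semigroup t u x + k"
    using semigroup_add[OF t continuous_measurable[OF cont] C, of "\<lambda>_. k" "\<bar>k\<bar>"] by (simp add: semigroup_const)
  moreover have "exp (- a * t) * semigroup t u x \<le> u x" using u t unfolding excessive_def by blast
  moreover have "exp (- a * t) * k \<le> 1 * k" using a t k by (intro mult_right_mono) auto
  ultimately show "exp (- a * t) * semigroup t (\<lambda>x. u x + k) x \<le> u x + k"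
    by (simp add: distrib_left)
qed

lemma excessive_min:
  assumes u: "excessive a u" and v: "excessive a v"
  shows "excessive a (\<lambda>x. min (u x) (v x))"
  unfolding excessive_def
proof safe
  have cont: "continuous_on UNIV u" "continuous_on UNIV v" using u v by (simp_all add: excessive_def)
  then show cont_min: "continuous_on UNIV (\<lambda>x. min (u x) (v x))" by (intro continuous_intros)
  show "0 \<le> min (u x) (v x)" for x using u v by (simp add: excessive_def)
  obtain C where C: "\<And>x. \<bar>u x\<bar> \<le> C" using continuous_bounded[OF cont(1)] by blast
  obtain C' where C': "\<And>x. \<bar>v x\<bar> \<le> C'" using continuous_bounded[OF cont(2)] by blast
  obtain D where D: "\<And>x. \<bar>min (u x) (v x)\<bar> \<le> D" using continuous_bounded[OF cont_min] by blast
  fix t :: real and x assume t: "0 \<le> t"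
  have "semigroup t (\<lambda>x. min (u x) (v x)) x \<le> semigroup t u x"
    "semigroup t (\<lambda>x. min (u x) (v x)) x \<le> semigroup t v x"
    using semigroup_mono[OF t continuous_measurable[OF cont_min] D continuous_measurable[OF cont(1)] C]
      semigroup_mono[OF t continuous_measurable[OF cont_min] D continuous_measurable[OF cont(2)] C'] by auto
  then have "exp (- a * t) * semigroup t (\<lambda>x. min (u x) (v x)) x \<le> exp (- a * t) * semigroup t u x"
    "exp (- a * t) * semigroup t (\<lambda>x. min (u x) (v x)) x \<le> exp (- a * t) * semigroup t v x"
    by simp_all
  moreover have "exp (- a * t) * semigroup t u x \<le> u x" "exp (- a * t) * semigroup t v x \<le> v x"
    using u v t unfolding excessive_def by blast+
  ultimately show "exp (- a * t) * semigroup t (\<lambda>x. min (u x) (v x)) x \<le> min (u x) (v x)"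
    by linarith
qed

text \<open>
  Dini's theorem: for excessive \<open>u\<close> the functions \<open>u - e\<^bsup>-at\<^esup> P\<^sub>t u\<close> decrease to \<open>0\<close> as \<open>t\<close> decreases to \<open>0\<close>.
\<close>

lemma excessive_semigroup_ge:
  assumes u: "excessive a u" and a: "0 \<le> a" and \<epsilon>: "0 < \<epsilon>"
  obtains t\<^sub>0 where "0 < t\<^sub>0" "\<And>t x. 0 \<le> t \<Longrightarrow> t \<le> t\<^sub>0 \<Longrightarrow> u x - \<epsilon> \<le> semigroup t u x"
proof -
  have cont: "continuous_on UNIV u" using u by (simp add: excessive_def)
  obtain C where C: "\<And>x. \<bar>u x\<bar> \<le> C" using continuous_bounded[OF cont] by blast
  note meas = continuous_measurable[OF cont]
  have exc: "exp (- a * t) * semigroup t u x \<le> u x" if "0 \<le> t" for t x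
    using u that unfolding excessive_def by blast
  define d where "d t x = u x - exp (- a * t) * semigroup t u x" for t x
  \<comment> \<open>Excessivity and the semigroup law make the defect monotone in \<open>t\<close>.
    This is what turns smallness at one time into smallness at all earlier times.\<close>
  have d_mono: "d s x \<le> d t x" if "0 \<le> s" "s \<le> t" for s t x
  proof -
    have "exp (- a * t) * semigroup t u x = exp (- a * s) * semigroup s (\<lambda>y. exp (- a * (t - s)) * semigroup (t - s) u y) x"
      using semigroup_semigroup[of s "t - s" u C x] that meas C
      by (simp add: semigroup_cmult mult.assoc[symmetric] exp_add[symmetric] right_diff_distrib)
    also have "\<dots> \<le> exp (- a * s) * semigroup s u x"
    proof (intro mult_left_mono semigroup_mono)
      show "\<bar>exp (- a * (t - s)) * semigroup (t - s) u y\<bar> \<le> exp (- a * (t - s)) * C" for y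
        using semigroup_bound[of "t - s" u C y] that meas C by (simp add: abs_mult)
    qed (use that meas C exc semigroup_measurable[of "t - s" u] in auto)
    finally show ?thesis by (simp add: d_def)
  qed
  have "\<exists>t>0. d t y < \<epsilon>" for y
  proof -
    have "((\<lambda>t. d t y) \<longlongrightarrow> d 0 y) (at_right 0)"
      using semigroup_right_continuous[OF cont order_refl, of y] unfolding d_def continuous_within
      by (intro tendsto_intros) auto
    then have "eventually (\<lambda>t. d t y < \<epsilon>) (at_right 0)"
      using \<epsilon> semigroup_0[OF meas] by (intro order_tendstoD(2)) (auto simp: d_def)
    then have "eventually (\<lambda>t. d t y < \<epsilon> \<and> 0 < t) (at_right 0)"
      using eventually_at_right_less by (rule eventually_conj)
    from eventually_happens[OF this] show ?thesis by auto
  qed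
  then obtain T where T: "\<And>y. 0 < T y" "\<And>y. d (T y) y < \<epsilon>" by metis
  have "open {x. d (T y) x < \<epsilon>}" for y
    unfolding d_def using semigroup_continuous[OF cont, of "T y"] T(1)[of y]
    by (intro open_Collect_less continuous_intros cont) auto
  then obtain Y where Y: "finite Y" "UNIV \<subseteq> (\<Union>y\<in>Y. {x. d (T y) x < \<epsilon>})"
    using compact_neighbourhoods_cover[OF compact_UNIV, of "\<lambda>y. {x. d (T y) x < \<epsilon>}"] T(2) by blast
  then have "Y \<noteq> {}" by auto
  show ?thesis
  proof (rule that[of "Min (T ` Y)"])
    show "0 < Min (T ` Y)" using Y \<open>Y \<noteq> {}\<close> T by simp
    fix t x assume t: "0 \<le> t" "t \<le> Min (T ` Y)"
    obtain y where y: "y \<in> Y" "d (T y) x < \<epsilon>" using Y by blast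
    then have "d t x \<le> d (T y) x"
      using t Y(1) by (intro d_mono) (auto dest: Min_le[OF finite_imageI, rotated] intro: order_trans)
    \<comment> \<open>The discount may be dropped: it is at most 1, and the semigroup preserves
      nonnegativity.\<close>
    moreover have "exp (- a * t) * semigroup t u x \<le> 1 * semigroup t u x"
      using a t u by (intro mult_right_mono)
        (auto simp: semigroup_def excessive_def intro!: Bochner_Integration.integral_nonneg)
    ultimately show "u x - \<epsilon> \<le> semigroup t u x"
      using y(2) by (simp add: d_def)
  qed
qed

section \<open>Separation by excessive functions, and uniform continuity at time 0\<close>

lemma excessive_peak:
  assumes r: "0 < r"
  obtains a f where "0 \<le> a" "excessive a f" "f y = r" "\<And>z. f z \<le> r"
    "\<And>z. r \<le> dist z y \<Longrightarrow> f z \<le> r / 2"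
proof -
  define \<psi> where "\<psi> z = max 0 (r - dist z y)" for z
  have \<psi>_cont: "continuous_on UNIV \<psi>" unfolding \<psi>_def by (intro continuous_intros)
  have \<psi>: "0 \<le> \<psi> z" "\<bar>\<psi> z\<bar> \<le> r" for z using r by (auto simp: \<psi>_def)
  define K where "K = {z. r \<le> dist z y}"
  have "closed K" unfolding K_def by (intro closed_Collect_le continuous_intros)
  then have K: "compact K"
    using compact_Int_closed[OF compact_UNIV, of K] by simp
  have "\<exists>n. smoothed (real (Suc n)) \<psi> z < smoothed (real (Suc n)) \<psi> y - r / 2" if "z \<in> K" for z
  proof -
    have "(\<lambda>n. smoothed (real (Suc n)) \<psi> z - smoothed (real (Suc n)) \<psi> y) \<longlonglongrightarrow> \<psi> z - \<psi> y"
      by (intro tendsto_diff smoothed_tendsto \<psi>_cont)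
    moreover have "\<psi> z - \<psi> y < - r / 2" using that r by (simp add: \<psi>_def K_def)
    ultimately have "eventually (\<lambda>n. smoothed (real (Suc n)) \<psi> z - smoothed (real (Suc n)) \<psi> y < - r / 2) sequentially"
      by (rule order_tendstoD(2))
    from eventually_happens'[OF sequentially_bot this] obtain n
      where "smoothed (real (Suc n)) \<psi> z - smoothed (real (Suc n)) \<psi> y < - r / 2" ..
    then have "smoothed (real (Suc n)) \<psi> z < smoothed (real (Suc n)) \<psi> y - r / 2" by linarith
    then show ?thesis ..
  qed
  then obtain N where N: "\<And>z. z \<in> K \<Longrightarrow> smoothed (real (Suc (N z))) \<psi> z < smoothed (real (Suc (N z))) \<psi> y - r / 2"
    by metis
  define U where "U z = {w. smoothed (real (Suc (N z))) \<psi> w < smoothed (real (Suc (N z))) \<psi> y - r / 2}" for z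
  have "open (U z)" for z
    unfolding U_def by (intro open_Collect_less continuous_intros smoothed_continuous \<psi>_cont) simp
  then obtain Y where Y: "finite Y" "K \<subseteq> (\<Union>z\<in>Y. U z)"
    using compact_neighbourhoods_cover[OF K, of U] N unfolding U_def by blast
  from Y(1) have "\<exists>a f. 0 \<le> a \<and> excessive a f \<and> f y = r \<and> (\<forall>z. f z \<le> r) \<and> (\<forall>z\<in>(\<Union>z\<in>Y. U z). f z \<le> r / 2)"
  proof induction
    case empty
    \<comment> \<open>With no far point to separate from \<open>y\<close>, the constant
      \<open>r\<close> serves.\<close>
    have "excessive 0 (\<lambda>_. r)" using r by (simp add: excessive_def semigroup_const)
    then show ?case by (intro exI[of _ 0] exI[of _ "\<lambda>_. r"]) auto
  next
    case (insert z Y)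
    then obtain a f where f: "0 \<le> a" "excessive a f" "f y = r" "\<And>z. f z \<le> r" "\<And>w. w \<in> (\<Union>z\<in>Y. U z) \<Longrightarrow> f w \<le> r / 2"
      by blast
    \<comment> \<open>Excessivity survives an increase of the rate, so one rate serves both
      functions. The constant \<open>k\<close> lifts the new resolvent to the value \<open>r\<close>
      at \<open>y\<close>; it is nonnegative because resolvents of \<open>\<psi>\<close> do not
      exceed \<open>r\<close>.\<close>
    define b where "b = max a (real (Suc (N z)))"
    define k where "k = r - smoothed (real (Suc (N z))) \<psi> y"
    have "0 \<le> k"
      using smoothed_bound[OF \<psi>_cont \<psi>(2), of "real (Suc (N z))" y] by (simp add: k_def)
    then have exc: "excessive b (\<lambda>w. smoothed (real (Suc (N z))) \<psi> w + k)"
      by (intro excessive_add_const excessive_mono[OF excessive_smoothed[OF \<psi>_cont \<psi>(1)]]) (auto simp: b_def)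
    have "excessive b (\<lambda>w. min (f w) (smoothed (real (Suc (N z))) \<psi> w + k))"
      by (intro excessive_min exc excessive_mono[OF f(2)]) (simp add: b_def)
    moreover have "min (f y) (smoothed (real (Suc (N z))) \<psi> y + k) = r"
      using f(3) by (simp add: k_def)
    moreover have "\<forall>w. min (f w) (smoothed (real (Suc (N z))) \<psi> w + k) \<le> r"
      using f(4) by (blast intro: min.coboundedI1)
    moreover have "\<forall>w\<in>(\<Union>z\<in>insert z Y. U z). min (f w) (smoothed (real (Suc (N z))) \<psi> w + k) \<le> r / 2"
    proof
      fix w assume "w \<in> (\<Union>z\<in>insert z Y. U z)"
      then consider "w \<in> U z" | "w \<in> (\<Union>z\<in>Y. U z)" by auto
      then show "min (f w) (smoothed (real (Suc (N z))) \<psi> w + k) \<le> r / 2"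
      proof cases
        case 1
        then have "smoothed (real (Suc (N z))) \<psi> w + k \<le> r / 2" by (simp add: U_def k_def)
        then show ?thesis by (rule min.coboundedI2)
      qed (rule min.coboundedI1[OF f(5)])
    qed
    moreover have "0 \<le> b" using f(1) by (simp add: b_def)
    ultimately show ?case by blast
  qed
  then show ?thesis
    using that Y(2) unfolding K_def by blast
qed

text \<open>For a start near \<open>y\<close>, a peak \<open>f\<close> at \<open>y\<close> is almost
  maximal, and by \<open>excessive_semigroup_ge\<close> its expectation stays so for a short time.
  At distance \<open>r\<close> from the start, however, \<open>f\<close> is at most half of its
  maximum, so such a move must be improbable. Compactness makes the time independent of the
  start.\<close>

lemma uniform_stochastic_continuity:
  assumes r: "0 < r" and \<epsilon>: "0 < \<epsilon>"
  obtains t\<^sub>0 where "0 < t\<^sub>0"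
    "\<And>t x. 0 \<le> t \<Longrightarrow> t \<le> t\<^sub>0 \<Longrightarrow> measure (P x) {\<omega> \<in> space (P x). r \<le> dist (X t \<omega>) x} \<le> \<epsilon>"
proof -
  have "\<exists>N t\<^sub>0. open N \<and> y \<in> N \<and> 0 < t\<^sub>0 \<and>
      (\<forall>x\<in>N. \<forall>t\<in>{0..t\<^sub>0}. measure (P x) {\<omega> \<in> space (P x). r \<le> dist (X t \<omega>) x} \<le> \<epsilon>)" for y
  proof -
    \<comment> \<open>The peak has radius \<open>r / 2\<close>: the start lies within
      \<open>r / 2\<close> of \<open>y\<close>, so a move by \<open>r\<close> leaves the ball of
      radius \<open>r / 2\<close> around \<open>y\<close>.\<close>
    obtain a f where a: "0 \<le> a" and f: "excessive a f" "f y = r / 2" "\<And>z. f z \<le> r / 2"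
      "\<And>z. r / 2 \<le> dist z y \<Longrightarrow> f z \<le> r / 4"
      using excessive_peak[of "r / 2" y] r by auto
    have cont: "continuous_on UNIV f" and nonneg: "\<And>z. 0 \<le> f z" using f by (simp_all add: excessive_def)
    \<comment> \<open>The expectation of \<open>f\<close> falls below the maximum by at most
      \<open>2 * \<eta>\<close>, one \<eta> for the start and one for the motion, while a move by
      \<open>r\<close> loses at least \<open>r / 4\<close>. Its probability is then at most
      \<open>8 * \<eta> / r\<close>, which is \<epsilon>.\<close>
    define \<eta> where "\<eta> = \<epsilon> * r / 8"
    have \<eta>: "0 < \<eta>" using r \<epsilon> by (simp add: \<eta>_def)
    obtain t\<^sub>0 where t0: "0 < t\<^sub>0" "\<And>t x. 0 \<le> t \<Longrightarrow> t \<le> t\<^sub>0 \<Longrightarrow> f x - \<eta> \<le> semigroup t f x"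
      using excessive_semigroup_ge[OF f(1) a \<eta>] by blast
    let ?N = "{x. r / 2 - \<eta> < f x} \<inter> ball y (r / 2)"
    have "open ?N" by (intro open_Int open_Collect_less continuous_intros cont) auto
    moreover have "y \<in> ?N" using f(2) \<eta> r by simp
    moreover have "measure (P x) {\<omega> \<in> space (P x). r \<le> dist (X t \<omega>) x} \<le> \<epsilon>"
      if x: "x \<in> ?N" and t: "t \<in> {0..t\<^sub>0}" for x t
    proof -
      interpret prob_space "P x" by (rule prob_space_P)
      have Xm [measurable]: "X t \<in> P x \<rightarrow>\<^sub>M borel" using t by (intro X_measurable_P) simp
      have fm [measurable]: "f \<in> borel_measurable borel" by (rule continuous_measurable[OF cont])
      let ?D = "{\<omega> \<in> space (P x). r \<le> dist (X t \<omega>) x}"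
      have D [measurable]: "?D \<in> sets (P x)" by measurable
      have int: "integrable (P x) (\<lambda>\<omega>. f (X t \<omega>))"
        using t nonneg f(3) by (intro integrable_X[where C="r/2"]) auto
      have "(\<integral>\<omega>. r / 4 * indicator ?D \<omega> \<partial>P x) \<le> (\<integral>\<omega>. r / 2 - f (X t \<omega>) \<partial>P x)"
      proof (rule integral_mono)
        show "integrable (P x) (\<lambda>\<omega>. r / 4 * indicator ?D \<omega>)"
          by (intro integrable_mult_right integrable_real_indicator) (auto simp: emeasure_eq_measure infinity_ennreal_def)
        show "integrable (P x) (\<lambda>\<omega>. r / 2 - f (X t \<omega>))" using int by simp
        fix \<omega> assume "\<omega> \<in> space (P x)"
        have "f (X t \<omega>) \<le> r / 4" if "r \<le> dist (X t \<omega>) x"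
        proof -
          have "dist (X t \<omega>) x \<le> dist (X t \<omega>) y + dist y x" by (rule dist_triangle)
          with x that have "r / 2 \<le> dist (X t \<omega>) y" by simp
          then show ?thesis by (rule f(4))
        qed
        then show "r / 4 * indicator ?D \<omega> \<le> r / 2 - f (X t \<omega>)"
          using f(3)[of "X t \<omega>"] by (auto split: split_indicator)
      qed
      also have "(\<integral>\<omega>. r / 2 - f (X t \<omega>) \<partial>P x) = r / 2 - semigroup t f x"
        using int by (simp add: semigroup_def prob_space)
      also have "\<dots> \<le> 2 * \<eta>" using t0(2)[of t x] t x by simp
      finally have "r / 4 * measure (P x) ?D \<le> 2 * \<eta>" by (simp add: measure_def)
      then show ?thesis using r by (simp add: \<eta>_def field_simps)
    qed
    ultimately show ?thesis using t0(1) by blast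
  qed
  then obtain N T where NT: "\<And>y. open (N y)" "\<And>y. y \<in> N y" "\<And>y. (0::real) < T y"
    "\<And>y x t. x \<in> N y \<Longrightarrow> t \<in> {0..T y} \<Longrightarrow> measure (P x) {\<omega> \<in> space (P x). r \<le> dist (X t \<omega>) x} \<le> \<epsilon>"
    by metis
  obtain Y where Y: "finite Y" "UNIV \<subseteq> (\<Union>y\<in>Y. N y)"
    using compact_neighbourhoods_cover[OF compact_UNIV NT(1,2)] .
  then have "Y \<noteq> {}" by auto
  show ?thesis
  proof (rule that[of "Min (T ` Y)"])
    show "0 < Min (T ` Y)" using Y \<open>Y \<noteq> {}\<close> NT by simp
    fix t x assume t: "0 \<le> t" "t \<le> Min (T ` Y)"
    obtain y where y: "y \<in> Y" "x \<in> N y" using Y by blast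
    then have "t \<le> T y" using t Y(1) by (meson Min_le finite_imageI imageI order_trans)
    then show "measure (P x) {\<omega> \<in> space (P x). r \<le> dist (X t \<omega>) x} \<le> \<epsilon>"
      using NT(4)[OF y(2)] t by simp
  qed
qed

text \<open>Moves shorter than \<open>r\<close> change every \<open>f i\<close> by at most
  \<open>\<epsilon> / 2\<close>, and longer moves are rare uniformly in the start. The index serves
  to treat all functions \<open>c \<cdot> \<xi>\<close> at once.\<close>

lemma semigroup_uniform:
  assumes meas: "\<And>i. f i \<in> borel_measurable borel" and C: "\<And>i x. \<bar>f i x\<bar> \<le> C"
    and equi: "\<And>\<epsilon>. 0 < \<epsilon> \<Longrightarrow> \<exists>r>0. \<forall>i x y. dist x y < r \<longrightarrow> \<bar>f i x - f i y\<bar> \<le> \<epsilon>"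
    and \<epsilon>: "0 < \<epsilon>"
  obtains t\<^sub>0 where "0 < t\<^sub>0"
    "\<And>i t x. 0 \<le> t \<Longrightarrow> t \<le> t\<^sub>0 \<Longrightarrow> \<bar>semigroup t (f i) x - f i x\<bar> \<le> \<epsilon>"
proof -
  have C0: "0 \<le> C" using C[of undefined undefined] by linarith
  obtain r where r: "0 < r" "\<And>i x y. dist x y < r \<Longrightarrow> \<bar>f i x - f i y\<bar> \<le> \<epsilon> / 2"
    using equi[of "\<epsilon> / 2"] \<epsilon> by auto
  define \<eta> where "\<eta> = \<epsilon> / (4 * (C + 1))"
  have \<eta>: "0 < \<eta>" "2 * C * \<eta> \<le> \<epsilon> / 2" using C0 \<epsilon> by (auto simp: \<eta>_def field_simps)
  obtain t\<^sub>0 where t0: "0 < t\<^sub>0"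
    "\<And>t x. 0 \<le> t \<Longrightarrow> t \<le> t\<^sub>0 \<Longrightarrow> measure (P x) {\<omega> \<in> space (P x). r \<le> dist (X t \<omega>) x} \<le> \<eta>"
    using uniform_stochastic_continuity[OF r(1) \<eta>(1)] by blast
  show ?thesis
  proof (rule that[OF t0(1)])
    fix i t x assume t: "0 \<le> t" "t \<le> t\<^sub>0"
    interpret prob_space "P x" by (rule prob_space_P)
    have Xm [measurable]: "X t \<in> P x \<rightarrow>\<^sub>M borel" using t by (intro X_measurable_P) simp
    let ?D = "{\<omega> \<in> space (P x). r \<le> dist (X t \<omega>) x}"
    have D [measurable]: "?D \<in> sets (P x)" by measurable
    have int: "integrable (P x) (\<lambda>\<omega>. f i (X t \<omega>))"
      by (rule integrable_X[OF t(1) meas C])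
    have intD: "integrable (P x) (\<lambda>\<omega>. \<epsilon> / 2 + 2 * C * indicator ?D \<omega>)"
      by (intro Bochner_Integration.integrable_add integrable_mult_right integrable_real_indicator)
        (auto simp: emeasure_eq_measure infinity_ennreal_def)
    have "\<bar>semigroup t (f i) x - f i x\<bar> = \<bar>\<integral>\<omega>. f i (X t \<omega>) - f i x \<partial>P x\<bar>"
      using int by (simp add: semigroup_def prob_space)
    also have "\<dots> \<le> (\<integral>\<omega>. \<bar>f i (X t \<omega>) - f i x\<bar> \<partial>P x)"
      by (rule integral_abs_bound)
    also have "\<dots> \<le> (\<integral>\<omega>. \<epsilon> / 2 + 2 * C * indicator ?D \<omega> \<partial>P x)"
    proof (rule integral_mono)
      show "integrable (P x) (\<lambda>\<omega>. \<bar>f i (X t \<omega>) - f i x\<bar>)" using int by simp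
      fix \<omega> assume "\<omega> \<in> space (P x)"
      then show "\<bar>f i (X t \<omega>) - f i x\<bar> \<le> \<epsilon> / 2 + 2 * C * indicator ?D \<omega>"
        using r(2)[of "X t \<omega>" x i] C[of i "X t \<omega>"] C[of i x] \<epsilon>
        by (cases "dist (X t \<omega>) x < r") (auto split: split_indicator)
    qed (fact intD)
    also have "\<dots> = \<epsilon> / 2 + 2 * C * measure (P x) ?D"
      using D by (subst Bochner_Integration.integral_add) (auto simp: prob_space emeasure_eq_measure infinity_ennreal_def)
    also have "\<dots> \<le> \<epsilon> / 2 + 2 * C * \<eta>"
      using t0(2)[OF t] C0 by (intro add_left_mono mult_left_mono) auto
    finally show "\<bar>semigroup t (f i) x - f i x\<bar> \<le> \<epsilon>" using \<eta>(2) by linarith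
  qed
qed

end


section \<open>The Bellman equation on a grid\<close>

locale impulse_costs = compact_feller_process F X P
  for F :: "ennreal \<Rightarrow> 'w measure" and X :: "real \<Rightarrow> 'w \<Rightarrow> 'e::polish_space" and P :: "'e \<Rightarrow> 'w measure" +
  fixes g :: "'e \<Rightarrow> real" and c :: "'e \<Rightarrow> 'e \<Rightarrow> real" and c\<^sub>0 G K :: real
  assumes g_cont: "continuous_on UNIV g" and g_bound: "\<And>x. \<bar>g x\<bar> \<le> G"
    and c_cont: "continuous_on UNIV (\<lambda>(x, \<xi>). c x \<xi>)" and c_bound: "\<And>x \<xi>. c x \<xi> \<le> K"
    and c0_pos: "0 < c\<^sub>0" and c_ge: "\<And>x \<xi>. c\<^sub>0 \<le> c x \<xi>"
    and c_triangle: "\<And>x \<xi> \<eta>. c x \<xi> \<le> c x \<eta> + c \<eta> \<xi>"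
begin

lemma G_nonneg: "0 \<le> G"
  using g_bound[of undefined] by linarith

lemma c_pos: "0 < c x \<xi>"
  using c_ge[of x \<xi>] c0_pos by linarith

lemma K_pos: "0 < K"
  using c_pos[of undefined undefined] c_bound[of undefined undefined] by linarith

lemma abs_c_le: "\<bar>c x \<xi>\<bar> \<le> K"
  using c_pos[of x \<xi>] c_bound[of x \<xi>] by linarith

lemma g_measurable [measurable]: "g \<in> borel_measurable borel"
  by (rule continuous_measurable[OF g_cont])

lemma c_cont1: "continuous_on UNIV (\<lambda>x. c x \<xi>)"
  using continuous_on_compose2[OF c_cont, of UNIV "\<lambda>x. (x, \<xi>)"] by (simp add: continuous_on_Pair)

lemma c_measurable [measurable]: "(\<lambda>(x, \<xi>). c x \<xi>) \<in> borel_measurable (borel \<Otimes>\<^sub>M borel)"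
  unfolding borel_prod by (rule borel_measurable_continuous_onI[OF c_cont])

lemma c_equicontinuous:
  assumes "0 < \<epsilon>"
  shows "\<exists>r>0. \<forall>\<xi> x y. dist x y < r \<longrightarrow> \<bar>c x \<xi> - c y \<xi>\<bar> \<le> \<epsilon>"
proof -
  have "compact (UNIV :: ('e \<times> 'e) set)"
    using compact_Times[OF compact_UNIV compact_UNIV] by simp
  then have "uniformly_continuous_on UNIV (\<lambda>(x, \<xi>). c x \<xi>)"
    by (rule compact_uniformly_continuous[OF c_cont])
  then obtain r where r: "0 < r" "\<And>p q. dist p q < r \<Longrightarrow> dist (case p of (x, \<xi>) \<Rightarrow> c x \<xi>) (case q of (x, \<xi>) \<Rightarrow> c x \<xi>) < \<epsilon>"
    using assms unfolding uniformly_continuous_on_def by (metis UNIV_I)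
  have "\<bar>c x \<xi> - c y \<xi>\<bar> \<le> \<epsilon>" if "dist x y < r" for x y \<xi>
    using r(2)[of "(x, \<xi>)" "(y, \<xi>)"] that by (simp add: dist_Pair_Pair dist_real_def)
  then show ?thesis using r(1) by blast
qed

text \<open>A time scale on which the semigroup barely moves \<open>g\<close> and the functions
  \<open>c \<cdot> \<xi>\<close>, uniformly in the state and in the target of the impulse.\<close>

definition slowly_moving :: "real \<Rightarrow> real \<Rightarrow> bool" where
  "slowly_moving \<epsilon> h \<longleftrightarrow> (\<forall>t x. 0 \<le> t \<longrightarrow> t \<le> h \<longrightarrow> \<bar>semigroup t g x - g x\<bar> \<le> \<epsilon> \<and>
     (\<forall>\<xi>. \<bar>semigroup t (\<lambda>y. c y \<xi>) x - c x \<xi>\<bar> \<le> \<epsilon>))"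

lemma slowly_moving_ex:
  assumes \<epsilon>: "0 < \<epsilon>"
  obtains h\<^sub>0 where "0 < h\<^sub>0" "\<And>h. h \<le> h\<^sub>0 \<Longrightarrow> slowly_moving \<epsilon> h"
proof -
  have "\<exists>r>0. \<forall>i x y. dist x y < r \<longrightarrow> \<bar>(\<lambda>_::unit. g) i x - (\<lambda>_. g) i y\<bar> \<le> e" if "0 < e" for e
  proof -
    have "uniformly_continuous_on UNIV g"
      by (rule compact_uniformly_continuous[OF g_cont compact_UNIV])
    then show ?thesis
      using that unfolding uniformly_continuous_on_def by (metis UNIV_I dist_real_def less_imp_le)
  qed
  then have "\<exists>t1>0. \<forall>t x. 0 \<le> t \<longrightarrow> t \<le> t1 \<longrightarrow> \<bar>semigroup t g x - g x\<bar> \<le> \<epsilon>"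
    by (rule semigroup_uniform[of "\<lambda>_::unit. g" G \<epsilon>, rotated 2]) (use g_bound \<epsilon> in auto)
  then obtain t1 where t1: "0 < t1" "\<And>t x. 0 \<le> t \<Longrightarrow> t \<le> t1 \<Longrightarrow> \<bar>semigroup t g x - g x\<bar> \<le> \<epsilon>"
    by blast
  have "\<exists>t2>0. \<forall>\<xi> t x. 0 \<le> t \<longrightarrow> t \<le> t2 \<longrightarrow> \<bar>semigroup t (\<lambda>y. c y \<xi>) x - c x \<xi>\<bar> \<le> \<epsilon>"
    by (rule semigroup_uniform[of "\<lambda>\<xi> y. c y \<xi>" K \<epsilon>])
      (use continuous_measurable[OF c_cont1] abs_c_le c_equicontinuous \<epsilon> in auto)
  then obtain t2 where t2: "0 < t2"
    "\<And>\<xi> t x. 0 \<le> t \<Longrightarrow> t \<le> t2 \<Longrightarrow> \<bar>semigroup t (\<lambda>y. c y \<xi>) x - c x \<xi>\<bar> \<le> \<epsilon>"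
    by blast
  show ?thesis
    by (rule that[of "min t1 t2"]) (use t1 t2 in \<open>auto simp: slowly_moving_def\<close>)
qed

section \<open>The intervention operator\<close>

definition impulse :: "('e \<Rightarrow> real) \<Rightarrow> 'e \<Rightarrow> real" where
  "impulse q x = (INF \<xi>. c x \<xi> + q \<xi>)"

lemma impulse_le:
  assumes "\<And>x. \<bar>q x\<bar> \<le> C"
  shows "impulse q x \<le> c x \<xi> + q \<xi>"
  unfolding impulse_def
proof (rule cINF_lower)
  have "- C \<le> c x \<xi> + q \<xi>" for \<xi> using assms[of \<xi>] c_pos[of x \<xi>] by linarith
  then show "bdd_below (range (\<lambda>\<xi>. c x \<xi> + q \<xi>))" by (auto intro!: bdd_belowI2)
qed simp

lemma impulse_ge: "(\<And>\<xi>. a \<le> c x \<xi> + q \<xi>) \<Longrightarrow> a \<le> impulse q x"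
  unfolding impulse_def by (rule cINF_greatest) auto

text \<open>For a fixed target \<open>q\<close> contributes only a constant, so the infimum inherits
  the common modulus of continuity of the functions \<open>c \<cdot> \<xi>\<close>. Hence
  \<open>impulse q\<close> is continuous even if \<open>q\<close> is only bounded, and an
  uncountable infimum poses no problem of measurability.\<close>

lemma impulse_equicontinuous:
  assumes q: "\<And>x. \<bar>q x\<bar> \<le> C" and e: "0 < e"
    and r: "\<And>\<xi>. \<bar>c x \<xi> - c y \<xi>\<bar> \<le> e"
  shows "\<bar>impulse q x - impulse q y\<bar> \<le> e"
proof -
  have "impulse q x - e \<le> impulse q y"
    using impulse_le[of q C, OF q, of x] r by (intro impulse_ge) (smt (verit))
  moreover have "impulse q y - e \<le> impulse q x"
    using impulse_le[of q C, OF q, of y] r by (intro impulse_ge) (smt (verit))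
  ultimately show ?thesis by linarith
qed

lemma impulse_measurable:
  assumes q: "\<And>x. \<bar>q x\<bar> \<le> C"
  shows "impulse q \<in> borel_measurable borel"
proof (rule continuous_measurable)
  show "continuous_on UNIV (impulse q)"
    unfolding continuous_on_iff
  proof safe
    fix x and e :: real assume "0 < e"
    then obtain r where "0 < r" "\<And>\<xi> x y. dist x y < r \<Longrightarrow> \<bar>c x \<xi> - c y \<xi>\<bar> \<le> e / 2"
      using c_equicontinuous[of "e / 2"] by auto
    then show "\<exists>d>0. \<forall>x'\<in>UNIV. dist x' x < d \<longrightarrow> dist (impulse q x') (impulse q x) < e"
      using impulse_equicontinuous[of q C "e / 2", OF q] \<open>0 < e\<close>
      by (intro exI[of _ r]) (fastforce simp: dist_real_def)
  qed
qed

text \<open>A selector with countably many values: a target that is nearly optimal at a point of a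
  dense sequence is used on a whole ball around it, and \<open>x\<close> takes the first ball that
  contains it. The allowance \<open>e\<close> is split equally between the choice at the centre,
  moving \<open>c\<close> and moving \<open>impulse q\<close> to \<open>x\<close>.\<close>

lemma impulse_selector:
  assumes q: "\<And>x. \<bar>q x\<bar> \<le> C" and e: "0 < e"
  obtains s where "s \<in> borel \<rightarrow>\<^sub>M borel" "\<And>x. c x (s x) + q (s x) \<le> impulse q x + e"
proof -
  obtain r where r: "0 < r" "\<And>\<xi> x y. dist x y < r \<Longrightarrow> \<bar>c x \<xi> - c y \<xi>\<bar> \<le> e / 3"
    using c_equicontinuous[of "e / 3"] e by auto
  obtain D :: "'e set" where D: "countable D" "\<And>X. open X \<Longrightarrow> X \<noteq> {} \<Longrightarrow> \<exists>d\<in>D. d \<in> X"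
    using countable_dense_setE by blast
  define a where "a = from_nat_into D"
  have "D \<noteq> {}" using D(2)[of UNIV] by auto
  then have ra: "range a = D" unfolding a_def by (rule range_from_nat_into[OF _ D(1)])
  have near: "\<exists>i. dist x (a i) < r" for x
  proof -
    obtain d where "d \<in> D" "d \<in> ball x r" using D(2)[of "ball x r"] r(1) by auto
    then show ?thesis using ra by (auto simp: mem_ball)
  qed
  have "\<exists>\<xi>. c y \<xi> + q \<xi> \<le> impulse q y + e / 3" for y
  proof (rule ccontr)
    assume "\<nexists>\<xi>. c y \<xi> + q \<xi> \<le> impulse q y + e / 3"
    then have "impulse q y + e / 3 \<le> impulse q y" by (intro impulse_ge) (auto simp: not_le intro: less_imp_le)
    then show False using e by simp
  qed
  then obtain \<zeta> where \<zeta>: "\<And>y. c y (\<zeta> y) + q (\<zeta> y) \<le> impulse q y + e / 3" by metis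
  define i where "i x = (LEAST i. dist x (a i) < r)" for x
  have [measurable]: "i \<in> borel \<rightarrow>\<^sub>M count_space UNIV" unfolding i_def by measurable
  show ?thesis
  proof (rule that[of "\<lambda>x. \<zeta> (a (i x))"])
    show "(\<lambda>x. \<zeta> (a (i x))) \<in> borel \<rightarrow>\<^sub>M borel" by measurable
    fix x
    have "dist x (a (i x)) < r" unfolding i_def using near by (rule LeastI_ex)
    then have *: "\<bar>c x \<xi> - c (a (i x)) \<xi>\<bar> \<le> e / 3" for \<xi> by (rule r(2))
    have "\<bar>impulse q x - impulse q (a (i x))\<bar> \<le> e / 3"
      using * e by (intro impulse_equicontinuous[of q C, OF q]) auto
    then show "c x (\<zeta> (a (i x))) + q (\<zeta> (a (i x))) \<le> impulse q x + e"
      using \<zeta>[of "a (i x)"] *[of "\<zeta> (a (i x))"] by linarith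
  qed
qed

section \<open>The discounted Bellman operator and its approximate fixed points\<close>

definition discounted_wait :: "real \<Rightarrow> real \<Rightarrow> ('e \<Rightarrow> real) \<Rightarrow> 'e \<Rightarrow> real" where
  "discounted_wait h \<gamma> v x = h * g x + \<gamma> * semigroup h v x"

text \<open>An impulse is followed by a full waiting step, so there is at most one impulse per grid
  time; by the triangle inequality for \<open>c\<close> a second one at the same time would bring
  nothing.\<close>

definition bellman :: "real \<Rightarrow> real \<Rightarrow> ('e \<Rightarrow> real) \<Rightarrow> 'e \<Rightarrow> real" where
  "bellman h \<gamma> v x = min (discounted_wait h \<gamma> v x) (impulse (discounted_wait h \<gamma> v) x)"

context
  fixes h \<gamma> D :: real
  assumes h: "0 < h" and \<gamma>: "0 < \<gamma>" "\<gamma> < 1" and D: "D = h * G / (1 - \<gamma>)"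
begin

text \<open>\<open>D\<close> is the geometric sum of the discounted running costs, so
  \<open>h * G + \<gamma> * D = D\<close> and the bound reproduces itself.\<close>

lemma discounted_wait_bound:
  assumes "v \<in> borel_measurable borel" "\<And>x. \<bar>v x\<bar> \<le> D"
  shows "\<bar>discounted_wait h \<gamma> v x\<bar> \<le> D"
proof -
  have "\<bar>discounted_wait h \<gamma> v x\<bar> \<le> \<bar>h * g x\<bar> + \<bar>\<gamma> * semigroup h v x\<bar>"
    unfolding discounted_wait_def by (rule abs_triangle_ineq)
  also have "\<dots> \<le> h * G + \<gamma> * D"
    using h \<gamma> g_bound[of x] semigroup_bound[of h v D x] assms by (simp add: abs_mult add_mono)
  also have "\<dots> = D" using \<gamma> by (simp add: D field_simps)
  finally show ?thesis .
qed

lemma discounted_wait_measurable: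
  assumes "v \<in> borel_measurable borel"
  shows "discounted_wait h \<gamma> v \<in> borel_measurable borel"
proof -
  have [measurable]: "semigroup h v \<in> borel_measurable borel"
    using h assms by (intro semigroup_measurable) auto
  show ?thesis unfolding discounted_wait_def by measurable
qed

lemma bellman_bound:
  assumes v: "v \<in> borel_measurable borel" "\<And>x. \<bar>v x\<bar> \<le> D"
  shows "\<bar>bellman h \<gamma> v x\<bar> \<le> D"
proof -
  have b: "\<bar>discounted_wait h \<gamma> v y\<bar> \<le> D" for y by (rule discounted_wait_bound[OF v])
  have "- D \<le> c x \<xi> + discounted_wait h \<gamma> v \<xi>" for \<xi>
    using b[of \<xi>] c_pos[of x \<xi>] by linarith
  then have "- D \<le> impulse (discounted_wait h \<gamma> v) x" by (rule impulse_ge)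
  then show ?thesis using b[of x] unfolding bellman_def by linarith
qed

lemma bellman_measurable:
  assumes v: "v \<in> borel_measurable borel" "\<And>x. \<bar>v x\<bar> \<le> D"
  shows "bellman h \<gamma> v \<in> borel_measurable borel"
proof -
  have [measurable]: "impulse (discounted_wait h \<gamma> v) \<in> borel_measurable borel"
    by (rule impulse_measurable[of "discounted_wait h \<gamma> v", OF discounted_wait_bound[OF v]])
  have [measurable]: "discounted_wait h \<gamma> v \<in> borel_measurable borel"
    by (rule discounted_wait_measurable[OF v(1)])
  show ?thesis unfolding bellman_def[abs_def] by measurable
qed

lemma bellman_contraction:
  assumes v: "v \<in> borel_measurable borel" "\<And>x. \<bar>v x\<bar> \<le> D"
    and u: "u \<in> borel_measurable borel" "\<And>x. \<bar>u x\<bar> \<le> D"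
    and d: "\<And>x. \<bar>v x - u x\<bar> \<le> d"
  shows "\<bar>bellman h \<gamma> v x - bellman h \<gamma> u x\<bar> \<le> \<gamma> * d"
proof -
  have w: "\<bar>discounted_wait h \<gamma> v y - discounted_wait h \<gamma> u y\<bar> \<le> \<gamma> * d" for y
  proof -
    have "discounted_wait h \<gamma> v y - discounted_wait h \<gamma> u y = \<gamma> * semigroup h (\<lambda>y. v y - u y) y"
      using semigroup_diff[of h v D u D y] h v u by (simp add: discounted_wait_def right_diff_distrib)
    then show ?thesis
      using semigroup_bound[of h "\<lambda>y. v y - u y" d y] h v u d \<gamma> by (simp add: abs_mult)
  qed
  have "impulse (discounted_wait h \<gamma> v) x - \<gamma> * d \<le> impulse (discounted_wait h \<gamma> u) x"
    using impulse_le[of "discounted_wait h \<gamma> v", OF discounted_wait_bound[OF v], of x] w by (intro impulse_ge) (smt (verit))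
  moreover have "impulse (discounted_wait h \<gamma> u) x - \<gamma> * d \<le> impulse (discounted_wait h \<gamma> v) x"
    using impulse_le[of "discounted_wait h \<gamma> u", OF discounted_wait_bound[OF u], of x] w by (intro impulse_ge) (smt (verit))
  ultimately show ?thesis using w[of x] unfolding bellman_def by linarith
qed

text \<open>Consecutive iterates from 0 differ by at most \<open>\<gamma> ^ n * D\<close>. An
  approximate fixed point is enough for the later estimates, so no limit of iterates is
  formed.\<close>

lemma bellman_iterate:
  assumes \<eta>: "0 < \<eta>"
  obtains u where "u \<in> borel_measurable borel" "\<And>x. \<bar>u x\<bar> \<le> D" "\<And>x. \<bar>bellman h \<gamma> u x - u x\<bar> \<le> \<eta>"
proof -
  have D_nonneg: "0 \<le> D" using h \<gamma> G_nonneg by (simp add: D)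
  define v where "v n = (bellman h \<gamma> ^^ n) (\<lambda>_. 0)" for n
  have v_Suc: "v (Suc n) = bellman h \<gamma> (v n)" for n by (simp add: v_def)
  have v: "v n \<in> borel_measurable borel \<and> (\<forall>x. \<bar>v n x\<bar> \<le> D)" for n
  proof (induction n)
    case 0
    then show ?case using D_nonneg by (simp add: v_def)
  next
    case (Suc n)
    then show ?case using bellman_measurable[of "v n"] bellman_bound[of "v n"] by (simp add: v_Suc)
  qed
  have "\<bar>v (Suc n) x - v n x\<bar> \<le> \<gamma> ^ n * D" for n x
  proof (induction n arbitrary: x)
    case 0
    have "v 0 x = 0" by (simp add: v_def)
    then show ?case using v[of "Suc 0"] by simp
  next
    case (Suc n)
    have "\<bar>bellman h \<gamma> (v (Suc n)) x - bellman h \<gamma> (v n) x\<bar> \<le> \<gamma> * (\<gamma> ^ n * D)"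
      by (rule bellman_contraction) (use v Suc in auto)
    then show ?case by (simp add: v_Suc mult.assoc)
  qed
  moreover have "(\<lambda>n. \<gamma> ^ n * D) \<longlonglongrightarrow> 0 * D"
    using \<gamma> by (intro tendsto_mult LIMSEQ_realpow_zero) auto
  then have "eventually (\<lambda>n. \<gamma> ^ n * D < \<eta>) sequentially"
    using \<eta> by (intro order_tendstoD(2)) auto
  then obtain n where "\<gamma> ^ n * D < \<eta>"
    using eventually_happens'[OF sequentially_bot] by blast
  ultimately show ?thesis
    using that[of "v n"] v[of n] v_Suc[of n] by (metis less_imp_le order_trans)
qed

end

text \<open>
  \<open>w\<close> is the value function of a slightly discounted problem up to an additive constant; its
  oscillation is at most \<open>K\<close>, since one may shift to any state at that cost.
\<close>

lemma average_cost_bellman: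
  assumes \<epsilon>: "0 < \<epsilon>" and h: "0 < h" "h * (\<epsilon> / (2 * K)) < 1"
  obtains \<mu> w q C s I where "\<bar>\<mu>\<bar> \<le> G" "w \<in> borel_measurable borel" "q \<in> borel_measurable borel"
    "\<And>x. 0 \<le> w x" "\<And>x. w x \<le> K" "\<And>x. \<bar>q x\<bar> \<le> C"
    "\<And>x \<xi>. w x \<le> c x \<xi> + w \<xi>"
    "\<And>x. w x \<le> semigroup h w x + h * (g x - (\<mu> - \<epsilon>))"
    "\<And>x. semigroup h w x + h * (g x - (\<mu> + \<epsilon>)) \<le> q x"
    "I \<in> sets borel" "s \<in> borel \<rightarrow>\<^sub>M borel"
    "\<And>x. x \<notin> I \<Longrightarrow> q x \<le> w x" "\<And>x. x \<in> I \<Longrightarrow> c x (s x) + q (s x) \<le> w x + h * \<epsilon>"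
proof -
  \<comment> \<open>The discount is so weak that, on a function of oscillation \<open>K\<close>, it
    blurs one step by \<open>h * \<epsilon> / 2\<close> only.\<close>
  define \<gamma> where "\<gamma> = 1 - h * (\<epsilon> / (2 * K))"
  have \<gamma>: "0 < \<gamma>" "\<gamma> < 1" using h \<epsilon> K_pos by (auto simp: \<gamma>_def)
  have \<gamma>K: "(1 - \<gamma>) * K = h * \<epsilon> / 2" using K_pos by (simp add: \<gamma>_def)
  define D where "D = h * G / (1 - \<gamma>)"
  note ctx = h(1) \<gamma> D_def
  obtain u where u: "u \<in> borel_measurable borel" "\<And>x. \<bar>u x\<bar> \<le> D" "\<And>x. \<bar>bellman h \<gamma> u x - u x\<bar> \<le> h * \<epsilon> / 2"
    using bellman_iterate[OF ctx, of "h * \<epsilon> / 2"] h \<epsilon> by auto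
  define q\<^sub>0 where "q\<^sub>0 = discounted_wait h \<gamma> u"
  \<comment> \<open>\<open>v\<close> is the image of \<open>u\<close> and not \<open>u\<close>
    itself: it is then exactly a minimum of waiting and impulse, so that \<open>v_c\<close> holds
    without error, and the defect of the fixed point enters only through the waiting term.\<close>
  define v where "v = bellman h \<gamma> u"
  have q0: "q\<^sub>0 \<in> borel_measurable borel" "\<And>x. \<bar>q\<^sub>0 x\<bar> \<le> D"
    unfolding q\<^sub>0_def by (rule discounted_wait_measurable[OF ctx u(1)], rule discounted_wait_bound[OF ctx u(1,2)])
  have v: "v \<in> borel_measurable borel" "\<And>x. \<bar>v x\<bar> \<le> D"
    unfolding v_def by (rule bellman_measurable[OF ctx u(1,2)], rule bellman_bound[OF ctx u(1,2)])
  have imp: "impulse q\<^sub>0 x \<le> c x \<xi> + q\<^sub>0 \<xi>" for x \<xi> by (rule impulse_le[of q\<^sub>0 D, OF q0(2)])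
  have v_min: "v x = min (q\<^sub>0 x) (impulse q\<^sub>0 x)" for x by (simp add: v_def bellman_def q\<^sub>0_def)
  \<comment> \<open>An impulse to \<open>\<xi>\<close> followed by one to \<open>\<eta>\<close> is
    no cheaper than the direct impulse to \<open>\<eta>\<close>.\<close>
  have v_c: "v x \<le> c x \<xi> + v \<xi>" for x \<xi>
  proof -
    have "v x - c x \<xi> \<le> c \<xi> \<eta> + q\<^sub>0 \<eta>" for \<eta>
      using v_min[of x] imp[of x \<eta>] c_triangle[of x \<eta> \<xi>] by linarith
    then have "v x - c x \<xi> \<le> impulse q\<^sub>0 \<xi>" by (rule impulse_ge)
    then show ?thesis using v_min[of x] v_min[of \<xi>] imp[of x \<xi>] by linarith
  qed
  define m where "m = (INF x. v x)"
  have bdd: "bdd_below (range v)"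
    by (rule bdd_belowI2[of _ "- D"]) (use v(2) in \<open>auto simp: abs_le_iff minus_le_iff\<close>)
  have m_le: "m \<le> v x" for x unfolding m_def by (rule cINF_lower[OF bdd]) simp
  have v_le: "v x \<le> m + K" for x
  proof -
    have "v x - K \<le> v \<xi>" for \<xi> using v_c[of x \<xi>] c_bound[of x \<xi>] by linarith
    then have "v x - K \<le> m" unfolding m_def by (intro cINF_greatest) auto
    then show ?thesis by simp
  qed
  have m_abs: "\<bar>m\<bar> \<le> D"
  proof -
    have "- D \<le> v \<xi>" for \<xi> using v(2)[of \<xi>] by linarith
    then have "- D \<le> m" unfolding m_def by (intro cINF_greatest) auto
    then show ?thesis using m_le[of undefined] v(2)[of undefined] by linarith
  qed
  \<comment> \<open>A discounted value \<open>m\<close> corresponds to a cost of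
    \<open>(1 - \<gamma>) * m\<close> per step, which is \<open>\<mu>\<close> per unit of time;
    \<open>\<bar>m\<bar> \<le> D\<close> bounds it by \<open>G\<close>.\<close>
  define \<mu> where "\<mu> = (1 - \<gamma>) * m / h"
  define w where "w x = v x - m" for x
  define q where "q x = q\<^sub>0 x - m" for x
  have [measurable]: "w \<in> borel_measurable borel" "q \<in> borel_measurable borel"
    using v q0 unfolding w_def[abs_def] q_def[abs_def] by measurable
  have w_bounds: "0 \<le> w x" "w x \<le> K" for x using m_le[of x] v_le[of x] by (simp_all add: w_def)
  have P_w: "semigroup h w x = semigroup h v x - m" for x
    unfolding w_def[abs_def] using semigroup_diff[of h v D "\<lambda>_. m" "\<bar>m\<bar>" x] h v by (simp add: semigroup_const)
  have P_v: "m \<le> semigroup h v x" "semigroup h v x \<le> m + K" for x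
    using semigroup_ge[of h v D m x] semigroup_le[of h v D "m + K" x] h v m_le v_le by auto
  have P_u: "\<bar>semigroup h v x - semigroup h u x\<bar> \<le> h * \<epsilon> / 2" for x
    using semigroup_diff[of h v D u D x] semigroup_bound[of h "\<lambda>y. v y - u y" "h * \<epsilon> / 2" x] h v u
    by (simp add: v_def)
  have q0_eq: "q\<^sub>0 x = h * g x + \<gamma> * semigroup h u x" for x by (simp add: q\<^sub>0_def discounted_wait_def)
  have g_u: "\<bar>\<gamma> * semigroup h v x - \<gamma> * semigroup h u x\<bar> \<le> h * \<epsilon> / 2" for x
  proof -
    have "\<bar>\<gamma> * semigroup h v x - \<gamma> * semigroup h u x\<bar> = \<gamma> * \<bar>semigroup h v x - semigroup h u x\<bar>"
      using \<gamma> by (simp add: abs_mult right_diff_distrib[symmetric])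
    also have "\<dots> \<le> 1 * (h * \<epsilon> / 2)" using \<gamma> P_u[of x] by (intro mult_mono) auto
    finally show ?thesis by simp
  qed
  have disc: "\<gamma> * semigroup h v x = semigroup h v x - (1 - \<gamma>) * semigroup h v x" for x by (simp add: algebra_simps)
  \<comment> \<open>As \<open>v\<close> lies between \<open>m\<close> and \<open>m + K\<close>,
    discounting takes away \<open>h * \<mu>\<close> up to \<open>h * \<epsilon> / 2\<close>.
    Together with the other half in \<open>g_u\<close> the error is at most
    \<open>h * \<epsilon>\<close>.\<close>
  have disc_bounds: "(1 - \<gamma>) * m \<le> (1 - \<gamma>) * semigroup h v x"
      "(1 - \<gamma>) * semigroup h v x \<le> (1 - \<gamma>) * m + h * \<epsilon> / 2" for x
    using mult_left_mono[OF P_v(1)[of x], of "1 - \<gamma>"] mult_left_mono[OF P_v(2)[of x], of "1 - \<gamma>"] \<gamma> \<gamma>K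
    by (simp_all add: distrib_left)
  have h\<mu>: "h * \<mu> = (1 - \<gamma>) * m" using h by (simp add: \<mu>_def)
  have he: "0 < h * \<epsilon>" using h \<epsilon> by simp
  have g_w: "h * (g x - (\<mu> - \<epsilon>)) = h * g x - h * \<mu> + h * \<epsilon>" for x by (simp add: algebra_simps)
  have g_q: "h * (g x - (\<mu> + \<epsilon>)) = h * g x - h * \<mu> - h * \<epsilon>" for x by (simp add: algebra_simps)
  obtain s where s: "s \<in> borel \<rightarrow>\<^sub>M borel" "\<And>x. c x (s x) + q\<^sub>0 (s x) \<le> impulse q\<^sub>0 x + h * \<epsilon>"
    using impulse_selector[of q\<^sub>0 D, OF q0(2) he] by blast
  have [measurable]: "impulse q\<^sub>0 \<in> borel_measurable borel" "q\<^sub>0 \<in> borel_measurable borel"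
    using impulse_measurable[of q\<^sub>0 D, OF q0(2)] q0(1) by auto
  show ?thesis
  proof (rule that[of \<mu> w q "2 * D" "{x. impulse q\<^sub>0 x < q\<^sub>0 x}" s])
    have "\<bar>h * \<mu>\<bar> \<le> (1 - \<gamma>) * D" unfolding h\<mu> using \<gamma> m_abs by (simp add: abs_mult)
    also have "\<dots> = h * G" using \<gamma> by (simp add: D_def)
    finally show "\<bar>\<mu>\<bar> \<le> G" using h by (simp add: abs_mult)
    show "\<bar>q x\<bar> \<le> 2 * D" for x using q0(2)[of x] m_abs by (simp add: q_def)
    show "w x \<le> c x \<xi> + w \<xi>" for x \<xi> using v_c[of x \<xi>] by (simp add: w_def)
    show "w x \<le> semigroup h w x + h * (g x - (\<mu> - \<epsilon>))" for x
      using v_min[of x] q0_eq[of x] g_u[of x] disc[of x] disc_bounds(1)[of x] h\<mu> P_w[of x] he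
        w_def[of x] g_w[of x] by linarith
    show "semigroup h w x + h * (g x - (\<mu> + \<epsilon>)) \<le> q x" for x
      using q0_eq[of x] g_u[of x] disc[of x] disc_bounds(2)[of x] h\<mu> P_w[of x]
        q_def[of x] g_q[of x] by linarith
    show "q x \<le> w x" if "x \<notin> {x. impulse q\<^sub>0 x < q\<^sub>0 x}" for x
      using that v_min[of x] by (simp add: q_def w_def)
    show "c x (s x) + q (s x) \<le> w x + h * \<epsilon>" if "x \<in> {x. impulse q\<^sub>0 x < q\<^sub>0 x}" for x
      using that v_min[of x] s(2)[of x] by (simp add: q_def w_def)
  qed (use w_bounds s in auto)
qed

section \<open>Refining the grid below \<open>h\<close>\<close>

text \<open>
  With \<open>D f = P\<^sub>\<delta> f + \<delta> (g - \<nu>)\<close> and \<open>h = N \<delta>\<close>, the approximate solution \<open>w\<close> satisfies \<open>w \<le> D\<^sup>N w\<close>,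
  so \<open>u\<close>, the maximum of the functions \<open>D\<^sup>j w\<close> with \<open>j < N\<close>, satisfies \<open>u \<le> D u\<close>.
\<close>

lemma refined_subsolution:
  assumes w: "w \<in> borel_measurable borel" "\<And>x. 0 \<le> w x" "\<And>x. w x \<le> K"
    and w_c: "\<And>x \<xi>. w x \<le> c x \<xi> + w \<xi>"
    and w_h: "\<And>x. w x \<le> semigroup h w x + h * (g x - (\<nu> + \<epsilon>))"
    and h: "0 < h" and slow: "slowly_moving \<epsilon> h" and N: "0 < N" and \<delta>: "\<delta> = h / real N"
  obtains u where "u \<in> borel_measurable borel" "\<And>x. \<bar>u x\<bar> \<le> K + h * (G + \<bar>\<nu>\<bar>)"
    "\<And>x. u x \<le> semigroup \<delta> u x + \<delta> * (g x - \<nu>)"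
    "\<And>x \<xi>. u x \<le> c x \<xi> + u \<xi> + (\<epsilon> + h * (G + \<bar>\<nu>\<bar>))"
proof -
  have \<delta>0: "0 < \<delta>" and N\<delta>: "real N * \<delta> = h" using h N by (simp_all add: \<delta>)
  have w_abs: "\<bar>w x\<bar> \<le> K" for x using w(2,3)[of x] by simp
  \<comment> \<open>The iterates of \<open>D\<close> on \<open>w\<close> in closed form, where the
    running cost is separated from the term that is to be compared with \<open>c\<close>;
    \<open>\<phi>_Suc\<close> is the recursion.\<close>
  define \<phi> where "\<phi> j x = semigroup (real j * \<delta>) w x + \<delta> * (\<Sum>i<j. semigroup (real i * \<delta>) g x - \<nu>)" for j x
  have time: "0 \<le> real j * \<delta>" for j using \<delta>0 by simp
  have meas: "\<phi> j \<in> borel_measurable borel" for j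
  proof -
    have [measurable]: "semigroup (real j * \<delta>) w \<in> borel_measurable borel" "semigroup (real i * \<delta>) g \<in> borel_measurable borel" for i
      using time w(1) by (auto intro!: semigroup_measurable)
    show ?thesis unfolding \<phi>_def by measurable
  qed
  have sum_bound: "\<bar>\<delta> * (\<Sum>i<j. semigroup (real i * \<delta>) g x - \<nu>)\<bar> \<le> h * (G + \<bar>\<nu>\<bar>)" if "j \<le> N" for j x
  proof -
    have "\<bar>\<Sum>i<j. semigroup (real i * \<delta>) g x - \<nu>\<bar> \<le> (\<Sum>i<j. \<bar>semigroup (real i * \<delta>) g x - \<nu>\<bar>)"
      by (rule sum_abs)
    also have "\<dots> \<le> (\<Sum>i<j. G + \<bar>\<nu>\<bar>)"
    proof (rule sum_mono)
      fix i
      show "\<bar>semigroup (real i * \<delta>) g x - \<nu>\<bar> \<le> G + \<bar>\<nu>\<bar>"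
        using semigroup_bound[OF time g_measurable g_bound, of i x] by linarith
    qed
    also have "\<dots> \<le> real N * (G + \<bar>\<nu>\<bar>)" using that G_nonneg by (simp add: mult_right_mono)
    finally have "\<delta> * \<bar>\<Sum>i<j. semigroup (real i * \<delta>) g x - \<nu>\<bar> \<le> \<delta> * (real N * (G + \<bar>\<nu>\<bar>))"
      using \<delta>0 by (intro mult_left_mono) auto
    then show ?thesis using \<delta>0 by (simp add: abs_mult N\<delta>[symmetric] ac_simps)
  qed
  have \<phi>_bound: "\<bar>\<phi> j x\<bar> \<le> K + h * (G + \<bar>\<nu>\<bar>)" if "j \<le> N" for j x
    using sum_bound[OF that, of x] semigroup_bound[OF time w(1) w_abs, of j x] unfolding \<phi>_def by linarith
  have \<phi>0: "\<phi> 0 x = w x" for x by (simp add: \<phi>_def semigroup_0[OF w(1)])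
  have \<phi>_Suc: "semigroup \<delta> (\<phi> j) x + \<delta> * (g x - \<nu>) = \<phi> (Suc j) x" for j x
  proof -
    have add1: "\<delta> + real j * \<delta> = real (Suc j) * \<delta>" for j by (simp add: algebra_simps)
    have Pw: "semigroup \<delta> (semigroup (real j * \<delta>) w) x = semigroup (real (Suc j) * \<delta>) w x"
      using semigroup_semigroup[OF _ time w(1) w_abs, of \<delta>] \<delta>0 by (simp only: add1)
    have Pg: "semigroup \<delta> (semigroup (real i * \<delta>) g) x = semigroup (real (Suc i) * \<delta>) g x" for i
      using semigroup_semigroup[OF _ time g_measurable g_bound, of \<delta>] \<delta>0 by (simp only: add1)
    have int: "integrable (P x) (\<lambda>\<omega>. semigroup (real i * \<delta>) g (X \<delta> \<omega>))" for i
      using \<delta>0 semigroup_bound[OF time g_measurable g_bound]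
      by (intro integrable_X[where C=G] semigroup_measurable time g_measurable) auto
    have int': "integrable (P x) (\<lambda>\<omega>. semigroup (real j * \<delta>) w (X \<delta> \<omega>))"
      using \<delta>0 semigroup_bound[OF time w(1) w_abs]
      by (intro integrable_X[where C=K] semigroup_measurable time w) auto
    interpret prob_space "P x" by (rule prob_space_P)
    have "semigroup \<delta> (\<phi> j) x = semigroup \<delta> (semigroup (real j * \<delta>) w) x
        + \<delta> * (\<Sum>i<j. semigroup \<delta> (semigroup (real i * \<delta>) g) x - \<nu>)"
      unfolding \<phi>_def semigroup_def[of \<delta>] using int int' prob_space
      by (simp add: Bochner_Integration.integral_sum)
    also have "\<dots> = semigroup (real (Suc j) * \<delta>) w x + \<delta> * (\<Sum>i<j. semigroup (real (Suc i) * \<delta>) g x - \<nu>)"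
      by (simp only: Pw Pg)
    finally show ?thesis
      unfolding \<phi>_def sum.lessThan_Suc_shift by (simp add: semigroup_0[OF g_measurable] distrib_left del: of_nat_Suc)
  qed
  \<comment> \<open>Within total time \<open>h\<close> the running cost barely moves. Replacing its
    expectation at later times by \<open>g x\<close> uses up the \<epsilon> in \<open>w_h\<close>
    and leaves \<open>\<nu>\<close>.\<close>
  have \<phi>N: "w x \<le> \<phi> N x" for x
  proof -
    have "\<delta> * (\<Sum>i<N. semigroup (real i * \<delta>) g x - \<nu>) \<ge> \<delta> * (\<Sum>i<N. g x - (\<nu> + \<epsilon>))"
    proof (intro mult_left_mono sum_mono)
      fix i assume "i \<in> {..<N}"
      then have "real i * \<delta> \<le> real N * \<delta>" using \<delta>0 by (intro mult_right_mono) auto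
      then have "\<bar>semigroup (real i * \<delta>) g x - g x\<bar> \<le> \<epsilon>"
        using slow time[of i] N\<delta> by (simp add: slowly_moving_def)
      then show "g x - (\<nu> + \<epsilon>) \<le> semigroup (real i * \<delta>) g x - \<nu>" by linarith
    qed (use \<delta>0 in simp)
    also have "\<delta> * (\<Sum>i<N. g x - (\<nu> + \<epsilon>)) = h * (g x - (\<nu> + \<epsilon>))"
      by (simp add: N\<delta>[symmetric] ac_simps)
    finally show ?thesis using w_h[of x] N\<delta> by (simp add: \<phi>_def)
  qed
  define u where "u x = Max ((\<lambda>j. \<phi> j x) ` {..<N})" for x
  have ne: "(\<lambda>j. \<phi> j x) ` {..<N} \<noteq> {}" for x using N by auto
  have \<phi>_le_u: "\<phi> j x \<le> u x" if "j < N" for j x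
    unfolding u_def using that by (intro Max_ge) auto
  have u_le: "u x \<le> a" if "\<And>j. j < N \<Longrightarrow> \<phi> j x \<le> a" for x a
    unfolding u_def using that ne by (intro Max.boundedI) auto
  have u_meas: "u \<in> borel_measurable borel"
    unfolding u_def[abs_def] using meas by (intro borel_measurable_Max) auto
  have u_bound: "\<bar>u x\<bar> \<le> K + h * (G + \<bar>\<nu>\<bar>)" for x
  proof -
    have "u x \<le> K + h * (G + \<bar>\<nu>\<bar>)"
    proof (rule u_le)
      fix j assume "j < N"
      then show "\<phi> j x \<le> K + h * (G + \<bar>\<nu>\<bar>)" using \<phi>_bound[of j x] by simp
    qed
    moreover have "0 \<le> u x" using \<phi>_le_u[of 0 x] \<phi>0[of x] w(2)[of x] N by simp
    ultimately show ?thesis by simp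
  qed
  show ?thesis
  proof (rule that[OF u_meas u_bound])
    fix x
    have P_mono: "\<phi> (Suc j) x \<le> semigroup \<delta> u x + \<delta> * (g x - \<nu>)" if "j < N" for j
    proof -
      have "semigroup \<delta> (\<phi> j) x \<le> semigroup \<delta> u x"
        using \<delta>0 meas \<phi>_bound u_meas u_bound \<phi>_le_u that
        by (intro semigroup_mono[where C="K + h * (G + \<bar>\<nu>\<bar>)" and C'="K + h * (G + \<bar>\<nu>\<bar>)"]) auto
      then show ?thesis using \<phi>_Suc[of j x] by simp
    qed
    show "u x \<le> semigroup \<delta> u x + \<delta> * (g x - \<nu>)"
    proof (rule u_le)
      fix j assume j: "j < N"
      show "\<phi> j x \<le> semigroup \<delta> u x + \<delta> * (g x - \<nu>)"
      \<comment> \<open>\<open>D\<close> takes \<open>\<phi> j\<close> to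
        \<open>\<phi> (Suc j)\<close>, and the cycle closes because \<open>\<phi> 0\<close>, which
        is \<open>w\<close>, lies below \<open>\<phi> N\<close>.\<close>
      proof (cases j)
        case 0
        then show ?thesis using P_mono[of "N - 1"] \<phi>N[of x] \<phi>0[of x] N by simp
      next
        case (Suc i)
        then show ?thesis using P_mono[of i] j by simp
      qed
    qed
  next
    fix x \<xi>
    \<comment> \<open>In \<open>\<phi> j\<close> the inequality for \<open>w\<close> is applied
      after time \<open>j * \<delta>\<close>. Bringing this impulse forward to the present changes
      the expected \<open>c\<close> by at most \<epsilon>, and the running cost collected meanwhile
      is at most \<open>h * (G + \<bar>\<nu>\<bar>)\<close>. After the impulse the value is
      \<open>w \<xi>\<close>, which is \<open>\<phi> 0 \<xi>\<close>.\<close>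
    show "u x \<le> c x \<xi> + u \<xi> + (\<epsilon> + h * (G + \<bar>\<nu>\<bar>))"
    proof (rule u_le)
      fix j assume j: "j < N"
      then have "real j * \<delta> \<le> real N * \<delta>" using \<delta>0 by (intro mult_right_mono) auto
      then have "\<bar>semigroup (real j * \<delta>) (\<lambda>y. c y \<xi>) x - c x \<xi>\<bar> \<le> \<epsilon>"
        using slow time[of j] N\<delta> by (simp add: slowly_moving_def)
      moreover have "semigroup (real j * \<delta>) w x \<le> semigroup (real j * \<delta>) (\<lambda>y. c y \<xi> + w \<xi>) x"
      proof (rule semigroup_mono[OF time w(1) w_abs])
        show "\<bar>c y \<xi> + w \<xi>\<bar> \<le> 2 * K" for y
          using abs_c_le[of y \<xi>] w_abs[of \<xi>] by linarith
        show "(\<lambda>y. c y \<xi> + w \<xi>) \<in> borel_measurable borel"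
          using continuous_measurable[OF c_cont1, of \<xi>] by measurable
      qed (rule w_c)
      moreover have "semigroup (real j * \<delta>) (\<lambda>y. c y \<xi> + w \<xi>) x = semigroup (real j * \<delta>) (\<lambda>y. c y \<xi>) x + w \<xi>"
        using semigroup_add[OF time continuous_measurable[OF c_cont1] abs_c_le, of "\<lambda>_. w \<xi>" "\<bar>w \<xi>\<bar>" j \<xi> x]
        by (simp add: semigroup_const)
      moreover have "w \<xi> \<le> u \<xi>" using \<phi>_le_u[of 0 \<xi>] \<phi>0[of \<xi>] N by simp
      ultimately show "\<phi> j x \<le> c x \<xi> + u \<xi> + (\<epsilon> + h * (G + \<bar>\<nu>\<bar>))"
        using sum_bound[of j x] j unfolding \<phi>_def by linarith
    qed
  qed
qed

end


section \<open>The controlled system\<close>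

context standard_process
begin

lemma measurable_coarser:
  assumes "f \<in> N \<rightarrow>\<^sub>M F t" "s \<le> t"
  shows "f \<in> N \<rightarrow>\<^sub>M F s"
proof (rule measurableI)
  fix \<omega> assume "\<omega> \<in> space N"
  then show "f \<omega> \<in> space (F s)"
    using measurable_space[OF assms(1)] by (simp add: space_F[of s] space_F[of t])
next
  fix A assume "A \<in> sets (F s)"
  then show "f -` A \<inter> space N \<in> sets N"
    using measurable_sets[OF assms(1)] sets_F_mono[OF assms(2)] by blast
qed

lemma component_copies [measurable]: "(\<lambda>\<omega>. \<omega> k) \<in> copies F \<rightarrow>\<^sub>M F \<infinity>"
  unfolding copies_def by (rule measurable_component_singleton) simp

lemma space_copies_filtration [simp]: "space (copies_filtration F n t) = space (copies F)"
  by (simp add: copies_filtration_def)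

lemma component_copies_filtration:
  assumes "k < n"
  shows "(\<lambda>\<omega>. \<omega> k) \<in> copies_filtration F n t \<rightarrow>\<^sub>M F t"
proof -
  have "(\<lambda>\<omega>. restrict \<omega> {..<n}) \<in> space (copies F) \<rightarrow> space (\<Pi>\<^sub>M k\<in>{..<n}. F t)"
    using measurable_space[OF component_copies] by (auto simp: space_PiM space_F[of t])
  then have "(\<lambda>\<omega>. restrict \<omega> {..<n}) \<in> copies_filtration F n t \<rightarrow>\<^sub>M (\<Pi>\<^sub>M k\<in>{..<n}. F t)"
    unfolding copies_filtration_def by (rule measurable_vimage_algebra1)
  from measurable_compose[OF this measurable_component_singleton[of k]] assms show ?thesis
    by simp
qed

text \<open>\<open>copies_filtration\<close> is the smallest sigma-field for which the first
  \<open>n\<close> coordinates are measurable at time \<open>t\<close>; monotonicity in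
  \<open>n\<close> and \<open>t\<close> is read off from this.\<close>

lemma sets_copies_filtration_subset:
  assumes "space N = space (copies F)" "\<And>k. k < n \<Longrightarrow> (\<lambda>\<omega>. \<omega> k) \<in> N \<rightarrow>\<^sub>M F t"
  shows "sets (copies_filtration F n t) \<subseteq> sets N"
  unfolding copies_filtration_def
  by (rule sets_image_in_sets[OF assms(1)], rule measurable_restrict) (use assms(2) in simp)

lemma sets_copies_filtration_mono:
  assumes "n \<le> m" "s \<le> t"
  shows "sets (copies_filtration F n s) \<subseteq> sets (copies_filtration F m t)"
  by (rule sets_copies_filtration_subset)
    (use assms in \<open>auto intro: measurable_coarser[OF component_copies_filtration]\<close>)

lemma sets_copies_filtration_le: "sets (copies_filtration F n t) \<subseteq> sets (copies F)"
  by (rule sets_copies_filtration_subset)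
    (auto intro!: measurable_coarser[OF component_copies] simp: infinity_ennreal_def)

lemma filtration_copies: "filtration (space (copies F)) (copies_filtration F n)"
  by unfold_locales (auto dest: sets_copies_filtration_mono[OF order_refl, THEN subsetD])

lemma stopping_time_copies_mono:
  assumes "stopping_time (copies_filtration F n) T" "n \<le> m"
  shows "stopping_time (copies_filtration F m) T"
  using stopping_timeD[OF assms(1)] sets_copies_filtration_mono[OF assms(2) order_refl]
  unfolding stopping_time_def pred_def by auto

end

section \<open>Integrals over half-open intervals, which fit together without overlap\<close>

lemma interval_set_integrable:
  fixes y :: "real \<Rightarrow> real"
  assumes "y \<in> borel_measurable borel" "\<And>t. \<bar>y t\<bar> \<le> C"
  shows "set_integrable lborel {a..<b} y"
  unfolding set_integrable_def
  by (cases "a \<le> b"; rule integrableI_bounded_set_indicator[where B=C])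
    (use assms in \<open>auto simp: infinity_ennreal_def\<close>)

lemma interval_integral_bound:
  fixes y :: "real \<Rightarrow> real"
  assumes "y \<in> borel_measurable borel" "\<And>t. \<bar>y t\<bar> \<le> C" "a \<le> b"
  shows "\<bar>LBINT t:{a..<b}. y t\<bar> \<le> C * (b - a)"
proof -
  have "norm (LBINT t:{a..<b}. y t) \<le> (LBINT t:{a..<b}. norm (y t))"
    by (rule set_integral_norm_bound[OF interval_set_integrable[OF assms(1,2)]])
  also have "\<dots> \<le> (LBINT t:{a..<b}. C)"
    by (intro set_integral_mono interval_set_integrable[where C=C]) (use assms order_trans[OF abs_ge_zero assms(2)] in auto)
  also have "\<dots> = C * (b - a)"
    using assms(3) by (simp add: set_lebesgue_integral_def)
  finally show ?thesis by simp
qed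

lemma interval_integral_split:
  fixes y :: "real \<Rightarrow> real"
  assumes "y \<in> borel_measurable borel" "\<And>t. \<bar>y t\<bar> \<le> C" "a \<le> b" "b \<le> d"
  shows "(LBINT t:{a..<d}. y t) = (LBINT t:{a..<b}. y t) + (LBINT t:{b..<d}. y t)"
proof -
  have "{a..<d} = {a..<b} \<union> {b..<d}" using assms(3,4) by auto
  then show ?thesis
    using set_integral_Un[OF _ interval_set_integrable[OF assms(1,2)] interval_set_integrable[OF assms(1,2)], of a b b d]
    by simp
qed

lemma interval_integral_sum:
  fixes y :: "real \<Rightarrow> real"
  assumes y: "y \<in> borel_measurable borel" "\<And>t. \<bar>y t\<bar> \<le> C" and \<delta>: "0 \<le> \<delta>"
  shows "(\<Sum>j<n. LBINT t:{a + real j * \<delta>..<a + real j * \<delta> + \<delta>}. y t) = (LBINT t:{a..<a + real n * \<delta>}. y t)"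
proof (induction n)
  case (Suc n)
  then show ?case
    using interval_integral_split[OF y, of a "a + real n * \<delta>" "a + real n * \<delta> + \<delta>"] \<delta>
    by (simp add: algebra_simps)
qed (simp add: set_lebesgue_integral_def)

section \<open>A strategy together with a law of the controlled system\<close>

locale controlled_system = impulse_costs F X P g c c\<^sub>0 G K
  for F :: "ennreal \<Rightarrow> 'w measure" and X :: "real \<Rightarrow> 'w \<Rightarrow> 'e::polish_space" and P :: "'e \<Rightarrow> 'w measure"
    and g :: "'e \<Rightarrow> real" and c :: "'e \<Rightarrow> 'e \<Rightarrow> real" and c\<^sub>0 G K :: real +
  fixes x :: 'e and V :: "('w, 'e) strategy" and Q :: "(nat \<Rightarrow> 'w) measure"
  assumes strategy: "V \<in> strategies F" and law: "controlled_law F X P x V Q"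
begin

abbreviation S :: "nat \<Rightarrow> (nat \<Rightarrow> 'w) \<Rightarrow> ennreal" where
  "S \<equiv> switch_time V"

abbreviation past :: "nat \<Rightarrow> ennreal \<Rightarrow> (nat \<Rightarrow> 'w) measure" where
  "past k \<equiv> copies_filtration F (Suc k)"

lemma prob_space_Q: "prob_space Q" and sets_Q: "sets Q = sets (copies F)"
  using law by (simp_all add: controlled_law_def)

lemma space_Q: "space Q = space (copies F)"
  by (rule sets_eq_imp_space_eq[OF sets_Q])

sublocale Q: prob_space Q
  by (rule prob_space_Q)

lemma component_Q [measurable]: "(\<lambda>\<omega>. \<omega> k) \<in> Q \<rightarrow>\<^sub>M F \<infinity>"
  using component_copies by (simp add: measurable_cong_sets[OF sets_Q refl])

lemma component_space: "\<omega> \<in> space Q \<Longrightarrow> \<omega> k \<in> space (F \<infinity>)"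
  by (rule measurable_space[OF component_Q])

lemma S_0 [simp]: "S 0 \<omega> = 0"
  by (cases V) simp

lemma S_stopping_Suc: "stopping_time (past k) (S (Suc k))"
  using strategy by (cases V) (auto simp: strategies_def cong: stopping_time_cong)

text \<open>The end of copy \<open>i\<close> is decided by the copies up to \<open>i\<close>. As the
  start of copy \<open>Suc i\<close> it is used relative to a history with one more copy.\<close>

lemma S_stopping: "stopping_time (past k) (S k)"
proof (cases k)
  case 0
  have "S 0 = (\<lambda>_. 0)" by auto
  then show ?thesis using 0 by (simp add: stopping_time_const)
next
  case (Suc i)
  then show ?thesis
    using stopping_time_copies_mono[OF S_stopping_Suc[of i], of "Suc (Suc i)"] by simp
qed

lemma S_Suc_mono: "\<omega> \<in> space Q \<Longrightarrow> S k \<omega> \<le> S (Suc k) \<omega>"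
  using strategy by (cases V; cases k) (auto simp: strategies_def space_Q)

lemma S_mono: "\<omega> \<in> space Q \<Longrightarrow> i \<le> k \<Longrightarrow> S i \<omega> \<le> S k \<omega>"
  by (rule lift_Suc_mono_le[of "\<lambda>k. S k \<omega>"]) (rule S_Suc_mono)

lemma past_le: "sets (past k t) \<subseteq> sets Q"
  using sets_copies_filtration_le by (simp add: sets_Q)

lemma S_measurable [measurable]: "S k \<in> borel_measurable Q"
  by (rule measurable_stopping_time[OF S_stopping past_le]) (simp add: space_Q)

lemma S_add_stopping: "stopping_time (past k) (\<lambda>\<omega>. S k \<omega> + ennreal s)"
proof (rule stopping_timeI)
  fix t :: ennreal
  have eq: "S k \<omega> + ennreal s \<le> t \<longleftrightarrow> ennreal s \<le> t \<and> S k \<omega> \<le> t - ennreal s" for \<omega>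
    by (metis add.commute add_right_mono diff_add_self_ennreal ennreal_add_diff_cancel_right ennreal_minus_mono
        ennreal_neq_top le_add2 le_iff_add order_refl order_trans)
  show "Measurable.pred (past k t) (\<lambda>\<omega>. S k \<omega> + ennreal s \<le> t)"
  proof (cases "ennreal s \<le> t")
    case True
    have "Measurable.pred (past k (t - ennreal s)) (\<lambda>\<omega>. S k \<omega> \<le> t - ennreal s)"
      by (rule stopping_timeD[OF S_stopping])
    then have "Measurable.pred (past k t) (\<lambda>\<omega>. S k \<omega> \<le> t - ennreal s)"
      using sets_copies_filtration_mono[OF order_refl diff_le_self_ennreal]
      unfolding pred_def by auto
    then show ?thesis using True by (simp add: eq)
  next
    case False
    then show ?thesis by (simp add: eq)
  qed
qed

section \<open>Copies on their own clock and on the common clock\<close>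

text \<open>Copy \<open>k\<close> on the clock that starts at its switch time, which is where the
  law describes it. If \<open>S k\<close> is infinite, \<open>enn2real\<close> reads it as 0 and the
  value carries no meaning.\<close>

definition Z :: "nat \<Rightarrow> real \<Rightarrow> (nat \<Rightarrow> 'w) \<Rightarrow> 'e" where
  "Z k s \<omega> = X (enn2real (S k \<omega>) + s) (\<omega> k)"

lemma X_copy_measurable:
  assumes "\<And>\<omega>. 0 \<le> T \<omega>" "T \<in> borel_measurable M" "(\<lambda>\<omega>. f \<omega> k) \<in> M \<rightarrow>\<^sub>M F \<infinity>"
  shows "(\<lambda>\<omega>. X (T \<omega>) (f \<omega> k)) \<in> M \<rightarrow>\<^sub>M borel"
proof -
  have "(\<lambda>\<omega>. (T \<omega>, f \<omega> k)) \<in> M \<rightarrow>\<^sub>M borel \<Otimes>\<^sub>M F \<infinity>" using assms(2,3) by measurable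
  from measurable_compose[OF this X_joint] show ?thesis using assms(1) by simp
qed

lemma Z_measurable [measurable]: "0 \<le> s \<Longrightarrow> Z k s \<in> Q \<rightarrow>\<^sub>M borel"
  unfolding Z_def by (rule X_copy_measurable) auto

lemma Z_start: "AE \<omega> in Q. S k \<omega> < \<infinity> \<longrightarrow> Z k 0 \<omega> = switch_state x V k \<omega>"
  using law unfolding controlled_law_def Z_def by simp

text \<open>The Markov property restarted at \<open>S k + s\<close>. On \<open>B\<close> the switch
  time is finite, so \<open>enn2real\<close> is additive there and the statement can be rephrased
  for \<open>Z k\<close>.\<close>

lemma markov_step:
  assumes s: "0 \<le> s" and t: "0 \<le> t"
    and B: "B \<in> sets (filtration.pre_sigma (space Q) (past k) (\<lambda>\<omega>. S k \<omega> + ennreal s))"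
      "\<And>\<omega>. \<omega> \<in> B \<Longrightarrow> S k \<omega> < \<infinity>"
    and f: "f \<in> borel_measurable borel" "\<And>y. \<bar>f y\<bar> \<le> C"
  shows "(\<integral>\<omega>. indicator B \<omega> * f (Z k (s + t) \<omega>) \<partial>Q) = (\<integral>\<omega>. indicator B \<omega> * semigroup t f (Z k s \<omega>) \<partial>Q)"
proof -
  let ?T = "\<lambda>\<omega>. S k \<omega> + ennreal s"
  have T: "enn2real (?T \<omega>) = enn2real (S k \<omega>) + s" if "\<omega> \<in> B" for \<omega>
    using B(2)[OF that] s by (subst enn2real_plus) (auto simp: infinity_ennreal_def)
  have fin: "?T \<omega> < \<infinity>" if "\<omega> \<in> B" for \<omega>
    using B(2)[OF that] by (simp add: infinity_ennreal_def)
  have "markov_at Q (past k) (\<lambda>t \<omega>. X t (\<omega> k)) (transition P X) ?T"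
    using law s by (simp add: controlled_law_def)
  from markov_integral[OF prob_space_Q _ past_le S_add_stopping this t _ _ B(1) fin f]
  have "(\<integral>\<omega>. indicator B \<omega> * f (X (enn2real (?T \<omega>) + t) (\<omega> k)) \<partial>Q)
      = (\<integral>\<omega>. indicator B \<omega> * semigroup t f (X (enn2real (?T \<omega>)) (\<omega> k)) \<partial>Q)"
    using t filtration_copies by (simp add: space_Q X_copy_measurable[where f="\<lambda>\<omega>. \<omega>"])
  moreover have "(\<integral>\<omega>. indicator B \<omega> * f (X (enn2real (?T \<omega>) + t) (\<omega> k)) \<partial>Q)
      = (\<integral>\<omega>. indicator B \<omega> * f (Z k (s + t) \<omega>) \<partial>Q)"
    by (rule Bochner_Integration.integral_cong) (auto simp: T Z_def add.assoc split: split_indicator)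
  moreover have "(\<integral>\<omega>. indicator B \<omega> * semigroup t f (X (enn2real (?T \<omega>)) (\<omega> k)) \<partial>Q)
      = (\<integral>\<omega>. indicator B \<omega> * semigroup t f (Z k s \<omega>) \<partial>Q)"
    by (rule Bochner_Integration.integral_cong) (auto simp: T Z_def split: split_indicator)
  ultimately show ?thesis by simp
qed

lemma integrable_Z:
  fixes f :: "'e \<Rightarrow> real"
  assumes "0 \<le> s" "B \<in> sets Q" "f \<in> borel_measurable borel" "\<And>y. \<bar>f y\<bar> \<le> C"
  shows "integrable Q (\<lambda>\<omega>. indicator B \<omega> * f (Z k s \<omega>))"
proof (rule Q.integrable_const_bound[of _ "\<bar>C\<bar>"])
  show "AE \<omega> in Q. norm (indicator B \<omega> * f (Z k s \<omega>)) \<le> \<bar>C\<bar>"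
    using order_trans[OF assms(4) abs_ge_self] by (intro AE_I2) (simp split: split_indicator)
qed (use assms in measurable)

lemma pre_sigma_le: "sets (filtration.pre_sigma (space Q) (past k) (\<lambda>\<omega>. S k \<omega> + ennreal s)) \<subseteq> sets Q"
proof
  interpret past: filtration "space Q" "past k" using filtration_copies by (simp add: space_Q)
  fix B assume "B \<in> sets (past.pre_sigma (\<lambda>\<omega>. S k \<omega> + ennreal s))"
  from past.sets_pre_sigmaD[OF S_add_stopping this, of top] show "B \<in> sets Q"
    using past_le[of k top] by auto
qed

lemma running_cost_measurable:
  fixes r :: "'e \<Rightarrow> real"
  assumes s: "0 \<le> s" and [measurable]: "r \<in> borel_measurable borel"
  shows "(\<lambda>\<omega>. LBINT t:{0..<\<delta>}. r (Z k (s + t) \<omega>)) \<in> borel_measurable Q"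
    and "(\<lambda>(t, \<omega>). indicator {0..<\<delta>} t * r (Z k (s + t) \<omega>)) \<in> borel_measurable (lborel \<Otimes>\<^sub>M Q)"
proof -
  have eq: "borel_measurable (lborel \<Otimes>\<^sub>M Q) = borel_measurable (borel \<Otimes>\<^sub>M Q)"
    by (intro measurable_cong_sets sets_pair_measure_cong) auto
  have *: "(\<lambda>p. X (max 0 (enn2real (S k (snd p)) + s + fst p)) (snd p k)) \<in> borel \<Otimes>\<^sub>M Q \<rightarrow>\<^sub>M borel"
    by (rule X_copy_measurable) measurable
  have [measurable]: "(\<lambda>p. r (X (max 0 (enn2real (S k (snd p)) + s + fst p)) (snd p k))) \<in> borel_measurable (borel \<Otimes>\<^sub>M Q)"
    by (rule measurable_compose[OF *]) fact
  have [measurable]: "(\<lambda>p::real \<times> _. indicator {0..<\<delta>} (fst p) :: real) \<in> borel_measurable (borel \<Otimes>\<^sub>M Q)"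
    by (rule measurable_compose[OF measurable_fst]) simp
  have "(\<lambda>p. indicator {0..<\<delta>} (fst p) * r (X (max 0 (enn2real (S k (snd p)) + s + fst p)) (snd p k))) \<in> borel_measurable (lborel \<Otimes>\<^sub>M Q)"
    unfolding eq by (rule borel_measurable_times) fact+
  also have "(\<lambda>p. indicator {0..<\<delta>} (fst p) * r (X (max 0 (enn2real (S k (snd p)) + s + fst p)) (snd p k)))
      = (\<lambda>(t, \<omega>). indicator {0..<\<delta>} t * r (Z k (s + t) \<omega>))"
    using s by (auto simp: fun_eq_iff Z_def add.assoc split: split_indicator)
  finally show meas: "(\<lambda>(t, \<omega>). indicator {0..<\<delta>} t * r (Z k (s + t) \<omega>)) \<in> borel_measurable (lborel \<Otimes>\<^sub>M Q)" .
  have "(\<lambda>(\<omega>, t). indicator {0..<\<delta>} t * r (Z k (s + t) \<omega>)) \<in> borel_measurable (Q \<Otimes>\<^sub>M lborel)"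
    using measurable_compose[OF measurable_pair_swap' meas] by (simp add: split_beta')
  then show "(\<lambda>\<omega>. LBINT t:{0..<\<delta>}. r (Z k (s + t) \<omega>)) \<in> borel_measurable Q"
    unfolding set_lebesgue_integral_def real_scaleR_def by (rule lborel.borel_measurable_lebesgue_integral)
qed

text \<open>Copy \<open>k\<close> on the common clock; negative times are cut off so that the paths
  are measurable on the whole real line.\<close>

definition Y :: "nat \<Rightarrow> real \<Rightarrow> (nat \<Rightarrow> 'w) \<Rightarrow> 'e" where
  "Y k t \<omega> = X (max 0 t) (\<omega> k)"

lemma Z_eq_Y: "0 \<le> s \<Longrightarrow> Z k s \<omega> = Y k (enn2real (S k \<omega>) + s) \<omega>"
  by (simp add: Z_def Y_def)

lemma Y_path_measurable:
  assumes "\<omega> \<in> space Q"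
  shows "(\<lambda>t. Y k t \<omega>) \<in> borel \<rightarrow>\<^sub>M borel"
proof -
  have "(\<lambda>t. (t, \<omega> k)) \<in> borel \<rightarrow>\<^sub>M borel \<Otimes>\<^sub>M F \<infinity>"
    using component_space[OF assms] by measurable
  from measurable_compose[OF this X_joint] show ?thesis by (simp add: Y_def[abs_def])
qed

lemma running_cost_shift:
  fixes r :: "'e \<Rightarrow> real"
  assumes s: "0 \<le> s"
  shows "(LBINT t:{0..<\<delta>}. r (Z k (s + t) \<omega>))
    = (LBINT t:{enn2real (S k \<omega>) + s..<enn2real (S k \<omega>) + s + \<delta>}. r (Y k t \<omega>))"
proof -
  let ?a = "enn2real (S k \<omega>) + s"
  have "(LBINT t:{?a..<?a + \<delta>}. r (Y k t \<omega>))
      = (\<integral>t. indicator {?a..<?a + \<delta>} (?a + 1 * t) * r (Y k (?a + 1 * t) \<omega>) \<partial>lborel)"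
    unfolding set_lebesgue_integral_def
    by (subst lborel_integral_real_affine[where c=1 and t="?a"]) auto
  also have "\<dots> = (LBINT t:{0..<\<delta>}. r (Z k (s + t) \<omega>))"
    unfolding set_lebesgue_integral_def using s
    by (intro Bochner_Integration.integral_cong) (auto simp: Z_eq_Y add.assoc split: split_indicator)
  finally show ?thesis by simp
qed

lemma running_cost_bound:
  fixes r :: "'e \<Rightarrow> real"
  assumes "\<omega> \<in> space Q" "0 \<le> s" "0 \<le> \<delta>" "r \<in> borel_measurable borel" "\<And>y. \<bar>r y\<bar> \<le> R"
  shows "\<bar>LBINT t:{0..<\<delta>}. r (Z k (s + t) \<omega>)\<bar> \<le> R * \<delta>"
  unfolding running_cost_shift[OF assms(2)]
  using interval_integral_bound[OF measurable_compose[OF Y_path_measurable[OF assms(1)] assms(4)] assms(5),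
      of "enn2real (S k \<omega>) + s" "enn2real (S k \<omega>) + s + \<delta>"] assms(3) by simp

section \<open>One step of a grid attached to a switch time\<close>

text \<open>After Fubini, the Markov property replaces \<open>r\<close> at time \<open>s + t\<close>
  by \<open>semigroup t r\<close> at time \<open>s\<close>, which is at least
  \<open>r - \<epsilon>\<close>. For \<open>r = - g\<close> this becomes an upper bound on the
  cost.\<close>

lemma expected_running_cost:
  assumes s: "0 \<le> s" and \<delta>: "0 \<le> \<delta>"
    and B: "B \<in> sets (filtration.pre_sigma (space Q) (past k) (\<lambda>\<omega>. S k \<omega> + ennreal s))"
      "\<And>\<omega>. \<omega> \<in> B \<Longrightarrow> S k \<omega> < \<infinity>"
    and r: "r \<in> borel_measurable borel" "\<And>y. \<bar>r y\<bar> \<le> R"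
    and slow: "\<And>t y. 0 \<le> t \<Longrightarrow> t \<le> \<delta> \<Longrightarrow> \<bar>semigroup t r y - r y\<bar> \<le> \<epsilon>"
  shows "\<delta> * (\<integral>\<omega>. indicator B \<omega> * (r (Z k s \<omega>) - \<epsilon>) \<partial>Q)
    \<le> (\<integral>\<omega>. indicator B \<omega> * (LBINT t:{0..<\<delta>}. r (Z k (s + t) \<omega>)) \<partial>Q)"
proof -
  have BQ [measurable]: "B \<in> sets Q" using B(1) pre_sigma_le by blast
  note [measurable] = r(1)
  have R: "0 \<le> R" using r(2)[of undefined] by linarith
  interpret pair_sigma_finite lborel Q ..
  let ?E = "\<integral>\<omega>. indicator B \<omega> * (r (Z k s \<omega>) - \<epsilon>) \<partial>Q"
  have int: "integrable (lborel \<Otimes>\<^sub>M Q) (\<lambda>(t, \<omega>). indicator {0..<\<delta>} t * (indicator B \<omega> * r (Z k (s + t) \<omega>)))"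
  proof (rule integrableI_bounded_set[where A="{0..<\<delta>} \<times> space Q" and B=R])
    have [measurable]: "(\<lambda>p. indicator {0..<\<delta>} (fst p) * r (Z k (s + fst p) (snd p))) \<in> borel_measurable (lborel \<Otimes>\<^sub>M Q)"
      using running_cost_measurable(2)[OF s r(1), of \<delta> k] by (simp add: split_beta')
    have "(\<lambda>p. indicator B (snd p) * (indicator {0..<\<delta>} (fst p) * r (Z k (s + fst p) (snd p)))) \<in> borel_measurable (lborel \<Otimes>\<^sub>M Q)"
      by measurable
    then show "(\<lambda>(t, \<omega>). indicator {0..<\<delta>} t * (indicator B \<omega> * r (Z k (s + t) \<omega>))) \<in> borel_measurable (lborel \<Otimes>\<^sub>M Q)"
      by (simp add: split_beta' mult.left_commute)
    show "emeasure (lborel \<Otimes>\<^sub>M Q) ({0..<\<delta>} \<times> space Q) < \<infinity>"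
      using \<delta> by (subst Q.emeasure_pair_measure_Times) (auto simp: Q.emeasure_space_1 infinity_ennreal_def)
    show "AE p in lborel \<Otimes>\<^sub>M Q. p \<in> {0..<\<delta>} \<times> space Q \<longrightarrow>
        norm (case p of (t, \<omega>) \<Rightarrow> indicator {0..<\<delta>} t * (indicator B \<omega> * r (Z k (s + t) \<omega>))) \<le> R"
      using r(2) R by (intro AE_I2) (auto split: split_indicator)
    show "AE p in lborel \<Otimes>\<^sub>M Q. p \<notin> {0..<\<delta>} \<times> space Q \<longrightarrow>
        (case p of (t, \<omega>) \<Rightarrow> indicator {0..<\<delta>} t * (indicator B \<omega> * r (Z k (s + t) \<omega>))) = 0"
      by (intro AE_I2) (auto simp: space_pair_measure indicator_def)
  qed measurable
  have "(\<integral>\<omega>. indicator B \<omega> * (LBINT t:{0..<\<delta>}. r (Z k (s + t) \<omega>)) \<partial>Q)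
      = (\<integral>\<omega>. (\<integral>t. indicator {0..<\<delta>} t * (indicator B \<omega> * r (Z k (s + t) \<omega>)) \<partial>lborel) \<partial>Q)"
    unfolding set_lebesgue_integral_def real_scaleR_def integral_mult_right_zero[symmetric]
    by (simp add: mult.left_commute)
  also have "\<dots> = (\<integral>t. (\<integral>\<omega>. indicator {0..<\<delta>} t * (indicator B \<omega> * r (Z k (s + t) \<omega>)) \<partial>Q) \<partial>lborel)"
    by (rule Fubini_integral[OF int])
  also have "\<dots> = (\<integral>t. indicator {0..<\<delta>} t * (\<integral>\<omega>. indicator B \<omega> * r (Z k (s + t) \<omega>) \<partial>Q) \<partial>lborel)"
    by simp
  also have "\<dots> \<ge> (\<integral>t. indicator {0..<\<delta>} t * ?E \<partial>lborel)"
  proof (rule integral_mono)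
    show "integrable lborel (\<lambda>t. indicator {0..<\<delta>} t * ?E)"
      using \<delta> by (intro integrable_mult_left integrable_real_indicator) (auto simp: infinity_ennreal_def)
    show "integrable lborel (\<lambda>t. indicator {0..<\<delta>} t * (\<integral>\<omega>. indicator B \<omega> * r (Z k (s + t) \<omega>) \<partial>Q))"
      using integrable_fst'[OF int] by simp
    fix t
    show "indicator {0..<\<delta>} t * ?E \<le> indicator {0..<\<delta>} t * (\<integral>\<omega>. indicator B \<omega> * r (Z k (s + t) \<omega>) \<partial>Q)"
    proof (cases "t \<in> {0..<\<delta>}")
      case True
      then have t: "0 \<le> t" "t \<le> \<delta>" by auto
      have "?E \<le> (\<integral>\<omega>. indicator B \<omega> * semigroup t r (Z k s \<omega>) \<partial>Q)"
      proof (rule integral_mono)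
        show "integrable Q (\<lambda>\<omega>. indicator B \<omega> * (r (Z k s \<omega>) - \<epsilon>))"
        proof (rule integrable_Z[of s B "\<lambda>y. r y - \<epsilon>" "R + \<bar>\<epsilon>\<bar>"])
          show "\<bar>r y - \<epsilon>\<bar> \<le> R + \<bar>\<epsilon>\<bar>" for y using r(2)[of y] by linarith
        qed (use s in measurable)
        show "integrable Q (\<lambda>\<omega>. indicator B \<omega> * semigroup t r (Z k s \<omega>))"
          by (rule integrable_Z[OF s BQ semigroup_measurable[OF t(1) r(1)] semigroup_bound[OF t(1) r]])
        fix \<omega>
        show "indicator B \<omega> * (r (Z k s \<omega>) - \<epsilon>) \<le> indicator B \<omega> * semigroup t r (Z k s \<omega>)"
          using slow[OF t, of "Z k s \<omega>"] by (auto split: split_indicator)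
      qed
      then show ?thesis using True markov_step[OF s t(1) B r] by simp
    qed simp
  qed
  also have "(\<integral>t. indicator {0..<\<delta>} t * ?E \<partial>lborel) = \<delta> * ?E"
    using \<delta> by simp
  finally show ?thesis .
qed

text \<open>There are two functions because the two halves of the proof differ: \<open>u\<close>
  plays both roles for the lower bound, \<open>- q\<close> and \<open>- w\<close> are used for
  threshold strategies. The \<epsilon> in \<open>le\<close> pays for the variation of
  \<open>r\<close> within the step.\<close>

lemma step_inequality:
  assumes s: "0 \<le> s" and \<delta>: "0 < \<delta>"
    and B: "B \<in> sets (filtration.pre_sigma (space Q) (past k) (\<lambda>\<omega>. S k \<omega> + ennreal s))"
      "\<And>\<omega>. \<omega> \<in> B \<Longrightarrow> S k \<omega> < \<infinity>"
    and r: "r \<in> borel_measurable borel" "\<And>y. \<bar>r y\<bar> \<le> R"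
    and slow: "\<And>t y. 0 \<le> t \<Longrightarrow> t \<le> \<delta> \<Longrightarrow> \<bar>semigroup t r y - r y\<bar> \<le> \<epsilon>"
    and f1: "f1 \<in> borel_measurable borel" "\<And>y. \<bar>f1 y\<bar> \<le> C"
    and f2: "f2 \<in> borel_measurable borel" "\<And>y. \<bar>f2 y\<bar> \<le> C"
    and le: "\<And>y. f1 y \<le> semigroup \<delta> f2 y + \<delta> * (r y - (\<nu> + \<epsilon>))"
  shows "(\<integral>\<omega>. indicator B \<omega> * (f1 (Z k s \<omega>) - f2 (Z k (s + \<delta>) \<omega>)) \<partial>Q)
    \<le> (\<integral>\<omega>. indicator B \<omega> * (LBINT t:{0..<\<delta>}. r (Z k (s + t) \<omega>) - \<nu>) \<partial>Q)"
proof -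
  have BQ [measurable]: "B \<in> sets Q" using B(1) pre_sigma_le by blast
  have \<delta>0: "0 \<le> \<delta>" and s\<delta>: "0 \<le> s + \<delta>" using s \<delta> by simp_all
  note [measurable] = r(1) running_cost_measurable(1)[OF s r(1)]
  have int_r: "integrable Q (\<lambda>\<omega>. indicator B \<omega> * (r (Z k s \<omega>) - \<epsilon>))"
  proof (rule integrable_Z[of s B "\<lambda>y. r y - \<epsilon>" "R + \<bar>\<epsilon>\<bar>"])
    show "\<bar>r y - \<epsilon>\<bar> \<le> R + \<bar>\<epsilon>\<bar>" for y using r(2)[of y] by linarith
  qed (use s in measurable)
  have int_ind: "integrable Q (\<lambda>\<omega>. indicator B \<omega> * \<nu>)"
    by (intro integrable_mult_left integrable_real_indicator) (auto simp: Q.emeasure_eq_measure infinity_ennreal_def)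
  have int_P: "integrable Q (\<lambda>\<omega>. indicator B \<omega> * semigroup \<delta> f2 (Z k s \<omega>))"
    by (rule integrable_Z[OF s BQ semigroup_measurable[OF \<delta>0 f2(1)] semigroup_bound[OF \<delta>0 f2]])
  have int_1: "integrable Q (\<lambda>\<omega>. indicator B \<omega> * f1 (Z k s \<omega>))"
    by (rule integrable_Z[OF s BQ f1])
  have int_2: "integrable Q (\<lambda>\<omega>. indicator B \<omega> * f2 (Z k (s + \<delta>) \<omega>))"
    by (rule integrable_Z[OF s\<delta> BQ f2])
  have int_L: "integrable Q (\<lambda>\<omega>. indicator B \<omega> * (LBINT t:{0..<\<delta>}. r (Z k (s + t) \<omega>)))"
  proof (rule Q.integrable_const_bound[of _ "R * \<delta>"])
    have "0 \<le> R * \<delta>" using r(2)[of undefined] \<delta> by (intro mult_nonneg_nonneg) linarith+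
    then show "AE \<omega> in Q. norm (indicator B \<omega> * (LBINT t:{0..<\<delta>}. r (Z k (s + t) \<omega>))) \<le> R * \<delta>"
      using running_cost_bound[OF _ s \<delta>0 r] by (intro AE_I2) (auto split: split_indicator)
  qed measurable
  have L: "(LBINT t:{0..<\<delta>}. r (Z k (s + t) \<omega>) - \<nu>) = (LBINT t:{0..<\<delta>}. r (Z k (s + t) \<omega>)) - \<delta> * \<nu>"
    if "\<omega> \<in> space Q" for \<omega>
  proof -
    have "(\<lambda>t. r (Y k (t + (enn2real (S k \<omega>) + s)) \<omega>)) \<in> borel_measurable borel"
      using measurable_compose[OF _ measurable_compose[OF Y_path_measurable[OF that] r(1)], of "\<lambda>t. t + (enn2real (S k \<omega>) + s)" borel k]
      by simp
    then have "set_integrable lborel {0..<\<delta>} (\<lambda>t. r (Y k (t + (enn2real (S k \<omega>) + s)) \<omega>))"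
      by (rule interval_set_integrable) (rule r(2))
    also have "set_integrable lborel {0..<\<delta>} (\<lambda>t. r (Y k (t + (enn2real (S k \<omega>) + s)) \<omega>))
        = set_integrable lborel {0..<\<delta>} (\<lambda>t. r (Z k (s + t) \<omega>))"
      using s by (intro set_integrable_cong) (auto simp: Z_eq_Y ac_simps)
    finally have "set_integrable lborel {0..<\<delta>} (\<lambda>t. r (Z k (s + t) \<omega>))" .
    moreover have "set_integrable lborel {0..<\<delta>} (\<lambda>_. \<nu>)"
      by (rule interval_set_integrable[where C="\<bar>\<nu>\<bar>"]) auto
    ultimately show ?thesis
      using \<delta> by (subst set_integral_diff(2)) (auto simp: set_lebesgue_integral_def)
  qed
  have "(\<integral>\<omega>. indicator B \<omega> * f1 (Z k s \<omega>) \<partial>Q)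
      \<le> (\<integral>\<omega>. indicator B \<omega> * semigroup \<delta> f2 (Z k s \<omega>) + \<delta> * (indicator B \<omega> * (r (Z k s \<omega>) - \<epsilon>)) - \<delta> * (indicator B \<omega> * \<nu>) \<partial>Q)"
  proof (rule integral_mono[OF int_1])
    show "integrable Q (\<lambda>\<omega>. indicator B \<omega> * semigroup \<delta> f2 (Z k s \<omega>) + \<delta> * (indicator B \<omega> * (r (Z k s \<omega>) - \<epsilon>)) - \<delta> * (indicator B \<omega> * \<nu>))"
      by (intro Bochner_Integration.integrable_diff Bochner_Integration.integrable_add integrable_mult_right int_P int_r int_ind)
    fix \<omega>
    show "indicator B \<omega> * f1 (Z k s \<omega>)
        \<le> indicator B \<omega> * semigroup \<delta> f2 (Z k s \<omega>) + \<delta> * (indicator B \<omega> * (r (Z k s \<omega>) - \<epsilon>)) - \<delta> * (indicator B \<omega> * \<nu>)"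
      using le[of "Z k s \<omega>"] by (auto simp: algebra_simps split: split_indicator)
  qed
  also have "\<dots> = (\<integral>\<omega>. indicator B \<omega> * semigroup \<delta> f2 (Z k s \<omega>) \<partial>Q)
      + \<delta> * (\<integral>\<omega>. indicator B \<omega> * (r (Z k s \<omega>) - \<epsilon>) \<partial>Q) - \<delta> * (\<integral>\<omega>. indicator B \<omega> * \<nu> \<partial>Q)"
    using int_P int_r int_ind by (simp only: Bochner_Integration.integral_diff Bochner_Integration.integral_add
        Bochner_Integration.integrable_add integrable_mult_right integral_mult_right_zero)
  also have "\<dots> \<le> (\<integral>\<omega>. indicator B \<omega> * f2 (Z k (s + \<delta>) \<omega>) \<partial>Q)
      + (\<integral>\<omega>. indicator B \<omega> * (LBINT t:{0..<\<delta>}. r (Z k (s + t) \<omega>)) \<partial>Q) - \<delta> * (\<integral>\<omega>. indicator B \<omega> * \<nu> \<partial>Q)"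
    using markov_step[OF s \<delta>0 B f2] expected_running_cost[OF s \<delta>0 B r slow] by linarith
  also have "\<dots> = (\<integral>\<omega>. indicator B \<omega> * f2 (Z k (s + \<delta>) \<omega>) \<partial>Q)
      + (\<integral>\<omega>. indicator B \<omega> * (LBINT t:{0..<\<delta>}. r (Z k (s + t) \<omega>)) - \<delta> * (indicator B \<omega> * \<nu>) \<partial>Q)"
    using int_L int_ind by (simp only: Bochner_Integration.integral_diff integrable_mult_right integral_mult_right_zero)
  also have "(\<integral>\<omega>. indicator B \<omega> * (LBINT t:{0..<\<delta>}. r (Z k (s + t) \<omega>)) - \<delta> * (indicator B \<omega> * \<nu>) \<partial>Q)
      = (\<integral>\<omega>. indicator B \<omega> * (LBINT t:{0..<\<delta>}. r (Z k (s + t) \<omega>) - \<nu>) \<partial>Q)"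
    by (rule Bochner_Integration.integral_cong) (auto simp: L split: split_indicator)
  finally show ?thesis
    unfolding right_diff_distrib using int_1 int_2 by (simp add: Bochner_Integration.integral_diff)
qed

section \<open>The steps taken by one copy\<close>

text \<open>Steps are laid from \<open>S k\<close> on until the next switch or \<open>T\<close> is
  reached; rounding up lets the last one overshoot.\<close>

definition steps :: "real \<Rightarrow> real \<Rightarrow> nat \<Rightarrow> (nat \<Rightarrow> 'w) \<Rightarrow> nat" where
  "steps T \<delta> k \<omega> = (if S k \<omega> \<le> ennreal T
     then nat \<lceil>(enn2real (min (S (Suc k) \<omega>) (ennreal T)) - enn2real (S k \<omega>)) / \<delta>\<rceil> else 0)"

lemma less_steps_iff:
  assumes T: "0 \<le> T" and \<delta>: "0 < \<delta>" and \<omega>: "\<omega> \<in> space Q"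
  shows "j < steps T \<delta> k \<omega> \<longleftrightarrow> S k \<omega> + ennreal (real j * \<delta>) < min (S (Suc k) \<omega>) (ennreal T)"
proof (cases "S k \<omega> \<le> ennreal T")
  case True
  then have "S k \<omega> \<noteq> top" by (auto simp: top_unique)
  then obtain a where a: "S k \<omega> = ennreal a" "0 \<le> a" by (cases "S k \<omega>") auto
  have "min (S (Suc k) \<omega>) (ennreal T) \<noteq> top" by (metis ennreal_neq_top min.cobounded2 top_unique)
  then obtain m where m: "min (S (Suc k) \<omega>) (ennreal T) = ennreal m" "0 \<le> m"
    by (cases "min (S (Suc k) \<omega>) (ennreal T)") auto
  have "j < steps T \<delta> k \<omega> \<longleftrightarrow> of_int (int j) < (m - a) / \<delta>"
    unfolding steps_def m a using True a by (simp add: zless_nat_eq_int_zless less_ceiling_iff m)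
  also have "\<dots> \<longleftrightarrow> a + real j * \<delta> < m" using \<delta> by (simp add: pos_less_divide_eq algebra_simps)
  also have "\<dots> \<longleftrightarrow> ennreal (a + real j * \<delta>) < ennreal m" using a \<delta> by (simp add: ennreal_less_iff del: ennreal_plus)
  also have "ennreal (a + real j * \<delta>) = S k \<omega> + ennreal (real j * \<delta>)"
    unfolding a(1) using a(2) \<delta> by (intro ennreal_plus) auto
  finally show ?thesis unfolding m .
next
  case False
  then have "ennreal T < S k \<omega> + ennreal (real j * \<delta>)"
    by (metis add_increasing2 less_le_trans not_le order_refl zero_le)
  then show ?thesis using False by (auto simp: steps_def dest: order.asym)
qed

lemma steps_le:
  assumes "0 \<le> T" "0 < \<delta>" "\<omega> \<in> space Q" "T \<le> real L * \<delta>"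
  shows "steps T \<delta> k \<omega> \<le> L"
proof (rule ccontr)
  assume "\<not> steps T \<delta> k \<omega> \<le> L"
  then have "S k \<omega> + ennreal (real L * \<delta>) < ennreal T"
    using less_steps_iff[OF assms(1-3), of L k] by (simp add: not_le)
  then have "ennreal (real L * \<delta>) < ennreal T"
    by (metis add_increasing le_less_trans order_refl zero_le)
  then show False using assms(2,4) by (simp add: ennreal_less_iff)
qed

lemma sum_steps:
  assumes "0 \<le> T" "0 < \<delta>" "\<omega> \<in> space Q" "T \<le> real L * \<delta>"
  shows "(\<Sum>j<steps T \<delta> k \<omega>. f j) = (\<Sum>j<L. indicator {\<omega> \<in> space Q. j < steps T \<delta> k \<omega>} \<omega> * (f j :: real))"
proof -
  have "(\<Sum>j<L. indicator {\<omega> \<in> space Q. j < steps T \<delta> k \<omega>} \<omega> * f j) = (\<Sum>j\<in>{..<L}. if j < steps T \<delta> k \<omega> then f j else 0)"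
    using assms(3) by (intro sum.cong) auto
  also have "\<dots> = (\<Sum>j\<in>{..<L} \<inter> {j. j < steps T \<delta> k \<omega>}. f j)"
    by (subst sum.inter_restrict) auto
  also have "{..<L} \<inter> {j. j < steps T \<delta> k \<omega>} = {..<steps T \<delta> k \<omega>}"
    using steps_le[OF assms, of k] by auto
  finally show ?thesis by simp
qed

text \<open>Whether step \<open>j\<close> is begun is known at its beginning, as it means that
  neither the next switch nor \<open>T\<close> has come yet. This is why the last step is completed
  and not cut.\<close>

lemma steps_pre_sigma:
  assumes "0 \<le> T" "0 < \<delta>"
  shows "{\<omega> \<in> space Q. j < steps T \<delta> k \<omega>}
    \<in> sets (filtration.pre_sigma (space Q) (past k) (\<lambda>\<omega>. S k \<omega> + ennreal (real j * \<delta>)))"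
proof -
  interpret past: filtration "space Q" "past k" using filtration_copies by (simp add: space_Q)
  have "Measurable.pred (past.pre_sigma (\<lambda>\<omega>. S k \<omega> + ennreal (real j * \<delta>)))
      (\<lambda>\<omega>. S k \<omega> + ennreal (real j * \<delta>) < min (S (Suc k) \<omega>) (ennreal T))"
    by (intro past.stopping_time_less S_add_stopping stopping_time_min S_stopping_Suc stopping_time_const)
  then show ?thesis
    using less_steps_iff[OF assms] by (simp add: pred_def past.space_pre_sigma cong: conj_cong)
qed

lemma steps_measurable:
  assumes "0 \<le> T" "0 < \<delta>"
  shows "steps T \<delta> k \<in> Q \<rightarrow>\<^sub>M count_space UNIV"
  unfolding steps_def by measurable

text \<open>Optional stopping on one copy: the step inequality is summed over the events that step
  \<open>j\<close> is begun. \<open>L\<close> bounds the number of steps for all \<omega>, so a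
  finite sum is exchanged with the expectation. For \<open>f1 = f2\<close> the sum \<open>A\<close>
  telescopes.\<close>

lemma copy_inequality:
  fixes k :: nat
  assumes T: "0 \<le> T" and \<delta>: "0 < \<delta>"
    and r: "r \<in> borel_measurable borel" "\<And>y. \<bar>r y\<bar> \<le> R"
    and slow: "\<And>t y. 0 \<le> t \<Longrightarrow> t \<le> \<delta> \<Longrightarrow> \<bar>semigroup t r y - r y\<bar> \<le> \<epsilon>"
    and f1: "f1 \<in> borel_measurable borel" "\<And>y. \<bar>f1 y\<bar> \<le> C"
    and f2: "f2 \<in> borel_measurable borel" "\<And>y. \<bar>f2 y\<bar> \<le> C"
    and le: "\<And>y. f1 y \<le> semigroup \<delta> f2 y + \<delta> * (r y - (\<nu> + \<epsilon>))"
  defines "A \<equiv> \<lambda>\<omega>. \<Sum>j<steps T \<delta> k \<omega>. f1 (Z k (real j * \<delta>) \<omega>) - f2 (Z k (real j * \<delta> + \<delta>) \<omega>)"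
    and "B \<equiv> \<lambda>\<omega>. LBINT t:{enn2real (S k \<omega>)..<enn2real (S k \<omega>) + real (steps T \<delta> k \<omega>) * \<delta>}. r (Y k t \<omega>) - \<nu>"
  shows "integrable Q A" "integrable Q B" "(\<integral>\<omega>. A \<omega> \<partial>Q) \<le> (\<integral>\<omega>. B \<omega> \<partial>Q)"
proof -
  define L where "L = nat \<lceil>T / \<delta>\<rceil>"
  have L: "T \<le> real L * \<delta>"
    using \<delta> real_nat_ceiling_ge[of "T / \<delta>"] by (simp add: L_def pos_divide_le_eq)
  have time: "0 \<le> real j * \<delta>" for j using \<delta> by simp
  let ?B = "\<lambda>j. {\<omega> \<in> space Q. j < steps T \<delta> k \<omega>}"
  have Bj: "?B j \<in> sets (filtration.pre_sigma (space Q) (past k) (\<lambda>\<omega>. S k \<omega> + ennreal (real j * \<delta>)))" for j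
    by (rule steps_pre_sigma[OF T \<delta>])
  have BQ [measurable]: "?B j \<in> sets Q" for j using Bj pre_sigma_le by blast
  have fin: "S k \<omega> < \<infinity>" if "\<omega> \<in> ?B j" for \<omega> j
  proof -
    have "S k \<omega> \<le> ennreal T" using that by (auto simp: steps_def split: if_splits)
    then show ?thesis by (auto simp: infinity_ennreal_def intro: le_less_trans)
  qed
  have r': "(\<lambda>y. r y - \<nu>) \<in> borel_measurable borel" "\<bar>r y - \<nu>\<bar> \<le> R + \<bar>\<nu>\<bar>" for y
    using r(1) r(2)[of y] by (measurable, linarith)
  let ?a = "\<lambda>j \<omega>. indicator (?B j) \<omega> * (f1 (Z k (real j * \<delta>) \<omega>) - f2 (Z k (real j * \<delta> + \<delta>) \<omega>))"
  let ?b = "\<lambda>j \<omega>. indicator (?B j) \<omega> * (LBINT t:{0..<\<delta>}. r (Z k (real j * \<delta> + t) \<omega>) - \<nu>)"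
  have A_eq: "A \<omega> = (\<Sum>j<L. ?a j \<omega>)" if "\<omega> \<in> space Q" for \<omega>
    unfolding A_def by (rule sum_steps[OF T \<delta> that L])
  have B_eq: "B \<omega> = (\<Sum>j<L. ?b j \<omega>)" if \<omega>: "\<omega> \<in> space Q" for \<omega>
  proof -
    have "B \<omega> = (\<Sum>j<steps T \<delta> k \<omega>. LBINT t:{enn2real (S k \<omega>) + real j * \<delta>..<enn2real (S k \<omega>) + real j * \<delta> + \<delta>}. r (Y k t \<omega>) - \<nu>)"
      unfolding B_def
      by (rule interval_integral_sum[symmetric, OF measurable_compose[OF Y_path_measurable[OF \<omega>] r'(1)] r'(2)])
        (use \<delta> in simp)
    also have "\<dots> = (\<Sum>j<steps T \<delta> k \<omega>. LBINT t:{0..<\<delta>}. r (Z k (real j * \<delta> + t) \<omega>) - \<nu>)"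
      by (simp only: running_cost_shift[OF time, where r="\<lambda>y. r y - \<nu>"])
    also have "\<dots> = (\<Sum>j<L. ?b j \<omega>)" by (rule sum_steps[OF T \<delta> \<omega> L])
    finally show ?thesis .
  qed
  have int_a: "integrable Q (?a j)" for j
    unfolding right_diff_distrib using \<delta> by (intro Bochner_Integration.integrable_diff integrable_Z[OF _ BQ f1] integrable_Z[OF _ BQ f2]) auto
  have int_b: "integrable Q (?b j)" for j
  proof (rule Q.integrable_const_bound[of _ "(R + \<bar>\<nu>\<bar>) * \<delta>"])
    have "0 \<le> (R + \<bar>\<nu>\<bar>) * \<delta>" using r(2)[of undefined] \<delta> by (intro mult_nonneg_nonneg) linarith+
    then show "AE \<omega> in Q. norm (?b j \<omega>) \<le> (R + \<bar>\<nu>\<bar>) * \<delta>"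
      using running_cost_bound[OF _ time less_imp_le[OF \<delta>] r'] by (intro AE_I2) (auto split: split_indicator)
    show "?b j \<in> borel_measurable Q"
      using running_cost_measurable(1)[OF time r'(1)] by measurable
  qed
  show "integrable Q A"
    by (rule Bochner_Integration.integrable_cong[OF refl A_eq, THEN iffD2], assumption, rule Bochner_Integration.integrable_sum[OF int_a])
  show "integrable Q B"
    by (rule Bochner_Integration.integrable_cong[OF refl B_eq, THEN iffD2], assumption, rule Bochner_Integration.integrable_sum[OF int_b])
  have "(\<integral>\<omega>. A \<omega> \<partial>Q) = (\<Sum>j<L. \<integral>\<omega>. ?a j \<omega> \<partial>Q)"
    using Bochner_Integration.integral_cong[OF refl A_eq] Bochner_Integration.integral_sum[OF int_a] by (rule trans)
  also have "\<dots> \<le> (\<Sum>j<L. \<integral>\<omega>. ?b j \<omega> \<partial>Q)"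
    by (intro sum_mono step_inequality[OF time \<delta> Bj fin r slow f1 f2 le]) auto
  also have "\<dots> = (\<integral>\<omega>. B \<omega> \<partial>Q)"
    using Bochner_Integration.integral_cong[OF refl B_eq] Bochner_Integration.integral_sum[OF int_b] by (rule trans[symmetric])
  finally show "(\<integral>\<omega>. A \<omega> \<partial>Q) \<le> (\<integral>\<omega>. B \<omega> \<partial>Q)" .
qed

end

section \<open>Lower bound for arbitrary strategies\<close>

context controlled_system
begin

section \<open>The controlled process as a concatenation of copies\<close>

abbreviation CP :: "real \<Rightarrow> (nat \<Rightarrow> 'w) \<Rightarrow> 'e" where
  "CP \<equiv> controlled_process X V"

definition active :: "real \<Rightarrow> nat \<Rightarrow> (nat \<Rightarrow> 'w) \<Rightarrow> real set" where
  "active T k \<omega> = {t. 0 \<le> t \<and> t < T \<and> S k \<omega> \<le> ennreal t \<and> ennreal t < S (Suc k) \<omega>}"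

lemma active_unique:
  assumes \<omega>: "\<omega> \<in> space Q" and i: "S i \<omega> \<le> t" "t < S (Suc i) \<omega>" and j: "S j \<omega> \<le> t" "t < S (Suc j) \<omega>"
  shows "i = j"
proof -
  have "\<not> Suc a \<le> b" if "t < S (Suc a) \<omega>" "S b \<omega> \<le> t" for a b
    using S_mono[OF \<omega>, of "Suc a" b] that by (auto dest: order.trans)
  then show ?thesis using i j by (metis linorder_neqE_nat Suc_leI)
qed

lemma CP_active:
  assumes "\<omega> \<in> space Q" "t \<in> active T k \<omega>"
  shows "CP t \<omega> = Y k t \<omega>"
proof -
  have "(THE k. S k \<omega> \<le> ennreal t \<and> ennreal t < S (Suc k) \<omega>) = k"
    using assms active_unique[OF assms(1)] by (intro the_equality) (auto simp: active_def)
  then show ?thesis using assms by (simp add: controlled_process_def Y_def active_def)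
qed

text \<open>The number of the copy in use is a measurable natural number,
  \<open>active_unique\<close> making its description unambiguous, so the process is pieced together
  from countably many jointly measurable ones.\<close>

lemma CP_joint:
  "(\<lambda>(t, \<omega>). CP (max 0 t) \<omega>) \<in> borel \<Otimes>\<^sub>M Q \<rightarrow>\<^sub>M borel"
proof -
  let ?k = "\<lambda>p. THE k. S k (snd p) \<le> ennreal (max 0 (fst p)) \<and> ennreal (max 0 (fst p)) < S (Suc k) (snd p)"
  have "(\<lambda>p. X (max 0 (fst p)) (snd p (?k p))) \<in> borel \<Otimes>\<^sub>M Q \<rightarrow>\<^sub>M borel"
  proof (rule measurable_compose_countable[where f="\<lambda>k p. X (max 0 (fst p)) (snd p k)"])
    show "(\<lambda>p. X (max 0 (fst p)) (snd p k)) \<in> borel \<Otimes>\<^sub>M Q \<rightarrow>\<^sub>M borel" for k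
      by (rule X_copy_measurable) measurable
    show "?k \<in> borel \<Otimes>\<^sub>M Q \<rightarrow>\<^sub>M count_space UNIV"
      by (rule measurable_THE) (auto simp: space_pair_measure intro: active_unique)
  qed
  then show ?thesis by (simp add: controlled_process_def split_beta')
qed

lemma CP_path_measurable:
  assumes "\<omega> \<in> space Q"
  shows "(\<lambda>t. CP (max 0 t) \<omega>) \<in> borel \<rightarrow>\<^sub>M borel"
  using measurable_compose[OF _ CP_joint, of "\<lambda>t. (t, \<omega>)" borel] assms by simp

lemma CP_integral_eq:
  fixes r :: "'e \<Rightarrow> real"
  assumes \<omega>: "\<omega> \<in> space Q" and r: "r \<in> borel_measurable borel"
  shows "(LBINT t:{0..T}. r (CP t \<omega>)) = (LBINT t:{0..<T}. r (CP (max 0 t) \<omega>))"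
proof -
  have [measurable]: "(\<lambda>t. r (CP (max 0 t) \<omega>)) \<in> borel_measurable borel"
    by (rule measurable_compose[OF CP_path_measurable[OF \<omega>] r])
  have "(LBINT t:{0..T}. r (CP t \<omega>)) = (LBINT t:{0..T}. r (CP (max 0 t) \<omega>))"
    unfolding set_lebesgue_integral_def by (intro Bochner_Integration.integral_cong) (auto split: split_indicator)
  also have "\<dots> = (LBINT t:{0..<T}. r (CP (max 0 t) \<omega>))"
    unfolding set_lebesgue_integral_def
  proof (rule integral_cong_AE)
    show "AE t in lborel. indicat_real {0..T} t *\<^sub>R r (CP (max 0 t) \<omega>) = indicat_real {0..<T} t *\<^sub>R r (CP (max 0 t) \<omega>)"
      using AE_lborel_singleton[of T] by eventually_elim (auto split: split_indicator)
  qed measurable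
  finally show ?thesis .
qed

lemma CP_integral_measurable:
  fixes r :: "'e \<Rightarrow> real"
  assumes r: "r \<in> borel_measurable borel"
  shows "(\<lambda>\<omega>. LBINT t:{0..T}. r (CP t \<omega>)) \<in> borel_measurable Q"
proof -
  have "(\<lambda>(\<omega>, t). r (CP (max 0 t) \<omega>)) \<in> borel_measurable (Q \<Otimes>\<^sub>M lborel)"
    using measurable_compose[OF measurable_pair_swap' measurable_compose[OF CP_joint r]]
    by (simp add: split_beta' cong: measurable_cong_sets)
  then have "(\<lambda>p. r (CP (max 0 (snd p)) (fst p))) \<in> borel_measurable (Q \<Otimes>\<^sub>M lborel)" by (simp add: split_beta')
  then have "(\<lambda>(\<omega>, t). indicator {0..<T} t *\<^sub>R r (CP (max 0 t) \<omega>)) \<in> borel_measurable (Q \<Otimes>\<^sub>M lborel)"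
    by measurable
  then have "(\<lambda>\<omega>. LBINT t:{0..<T}. r (CP (max 0 t) \<omega>)) \<in> borel_measurable Q"
    unfolding set_lebesgue_integral_def by (rule lborel.borel_measurable_lebesgue_integral)
  then show ?thesis by (simp add: CP_integral_eq[OF _ r] cong: measurable_cong)
qed

lemma CP_integral_bound:
  fixes r :: "'e \<Rightarrow> real"
  assumes "\<omega> \<in> space Q" "0 \<le> T" and r: "r \<in> borel_measurable borel" "\<And>y. \<bar>r y\<bar> \<le> R"
  shows "\<bar>LBINT t:{0..T}. r (CP t \<omega>)\<bar> \<le> R * T"
  unfolding CP_integral_eq[OF assms(1) r(1)]
  using interval_integral_bound[OF measurable_compose[OF CP_path_measurable[OF assms(1)] r(1)] r(2), of 0 T] assms(2) by simp

lemma active_eq: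
  assumes "0 \<le> T" "S k \<omega> \<le> ennreal T"
  shows "active T k \<omega> = {enn2real (S k \<omega>)..<enn2real (min (S (Suc k) \<omega>) (ennreal T))}"
proof -
  have "S k \<omega> \<noteq> top" using assms(2) by (auto simp: top_unique)
  then obtain a where a: "S k \<omega> = ennreal a" "0 \<le> a" by (cases "S k \<omega>") auto
  have "min (S (Suc k) \<omega>) (ennreal T) \<noteq> top" by (metis ennreal_neq_top min.cobounded2 top_unique)
  then obtain m where m: "min (S (Suc k) \<omega>) (ennreal T) = ennreal m" "0 \<le> m"
    by (cases "min (S (Suc k) \<omega>) (ennreal T)") auto
  have "t < m \<longleftrightarrow> t < T \<and> ennreal t < S (Suc k) \<omega>" if "0 \<le> t" for t
  proof -
    have "t < m \<longleftrightarrow> ennreal t < min (S (Suc k) \<omega>) (ennreal T)" using that by (simp add: m ennreal_less_iff)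
    then show ?thesis using that by (auto simp: ennreal_less_iff)
  qed
  then show ?thesis
    unfolding active_def m using a m(2) by (auto simp: ennreal_le_iff)
qed

lemma active_empty: "\<not> S k \<omega> \<le> ennreal T \<Longrightarrow> active T k \<omega> = {}"
  by (auto simp: active_def dest: order.strict_implies_order order.trans[OF _ ennreal_leI])

section \<open>The running cost, copy by copy\<close>

definition W :: "('e \<Rightarrow> real) \<Rightarrow> real \<Rightarrow> nat \<Rightarrow> (nat \<Rightarrow> 'w) \<Rightarrow> real" where
  "W r T k \<omega> = (LBINT t:active T k \<omega>. r (Y k t \<omega>))"

lemma active_integrable:
  fixes r :: "'e \<Rightarrow> real"
  assumes T: "0 \<le> T" and \<omega>: "\<omega> \<in> space Q" and r: "r \<in> borel_measurable borel" "\<And>y. \<bar>r y\<bar> \<le> R"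
  shows "set_integrable lborel (active T k \<omega>) (\<lambda>t. r (Y k t \<omega>))"
proof (cases "S k \<omega> \<le> ennreal T")
  case True
  show ?thesis
    unfolding active_eq[OF T True]
    by (rule interval_set_integrable[OF measurable_compose[OF Y_path_measurable[OF \<omega>, of k] r(1)]]) (rule r(2))
next
  case False
  then show ?thesis by (simp add: active_empty set_integrable_def)
qed

text \<open>The active sets of the first \<open>n\<close> copies tile the times before both
  \<open>T\<close> and \<open>S n\<close>. Nothing is assumed about \<open>S n\<close> passing
  \<open>T\<close>: if the impulses accumulate, the sums just cover less.\<close>

lemma sum_W:
  fixes r :: "'e \<Rightarrow> real"
  assumes T: "0 \<le> T" and \<omega>: "\<omega> \<in> space Q" and r: "r \<in> borel_measurable borel" "\<And>y. \<bar>r y\<bar> \<le> R"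
  shows "(\<Sum>k<n. W r T k \<omega>)
    = (\<integral>t. indicator {t. 0 \<le> t \<and> t < T \<and> ennreal t < S n \<omega>} t * r (CP (max 0 t) \<omega>) \<partial>lborel)"
proof -
  have pt: "(\<Sum>k<n. indicator (active T k \<omega>) t * r (Y k t \<omega>))
      = indicator {t. 0 \<le> t \<and> t < T \<and> ennreal t < S n \<omega>} t * r (CP (max 0 t) \<omega>)" for t
  proof (induction n)
    case (Suc n)
    show ?case
    proof (cases "t \<in> active T n \<omega>")
      case True
      then have "r (CP (max 0 t) \<omega>) = r (Y n t \<omega>)" "0 \<le> t" "t < T" "\<not> ennreal t < S n \<omega>" "ennreal t < S (Suc n) \<omega>"
        using CP_active[OF \<omega> True] by (auto simp: active_def)
      then show ?thesis using Suc True by simp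
    next
      case False
      then have "0 \<le> t \<and> t < T \<and> ennreal t < S n \<omega> \<longleftrightarrow> 0 \<le> t \<and> t < T \<and> ennreal t < S (Suc n) \<omega>"
        using S_Suc_mono[OF \<omega>, of n] by (auto simp: active_def)
      then show ?thesis using Suc False by (simp add: indicator_def)
    qed
  qed simp
  have "(\<Sum>k<n. W r T k \<omega>) = (\<integral>t. (\<Sum>k<n. indicator (active T k \<omega>) t * r (Y k t \<omega>)) \<partial>lborel)"
    unfolding W_def set_lebesgue_integral_def real_scaleR_def
    using active_integrable[OF T \<omega> r]
    by (intro Bochner_Integration.integral_sum[symmetric]) (simp add: set_integrable_def)
  then show ?thesis by (simp only: pt)
qed

lemma sum_W_finished:
  fixes r :: "'e \<Rightarrow> real"
  assumes T: "0 \<le> T" and \<omega>: "\<omega> \<in> space Q" and r: "r \<in> borel_measurable borel" "\<And>y. \<bar>r y\<bar> \<le> R"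
    and n: "ennreal T \<le> S n \<omega>"
  shows "(\<Sum>k<n. W r T k \<omega>) = (LBINT t:{0..T}. r (CP t \<omega>))"
proof -
  have "{t. 0 \<le> t \<and> t < T \<and> ennreal t < S n \<omega>} = {0..<T}"
    using n by (auto simp: ennreal_less_iff intro: less_le_trans[of "ennreal _" "ennreal T"])
  then show ?thesis
    unfolding sum_W[OF T \<omega> r] CP_integral_eq[OF \<omega> r(1)]
    unfolding set_lebesgue_integral_def by simp
qed

lemma sum_W_bound:
  fixes r :: "'e \<Rightarrow> real"
  assumes T: "0 \<le> T" and \<omega>: "\<omega> \<in> space Q" and r: "r \<in> borel_measurable borel" "\<And>y. \<bar>r y\<bar> \<le> R"
  shows "\<bar>\<Sum>k<n. W r T k \<omega>\<bar> \<le> R * T"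
proof -
  have R: "0 \<le> R" using r(2)[of undefined] by linarith
  have [measurable]: "(\<lambda>t. r (CP (max 0 t) \<omega>)) \<in> borel_measurable borel"
    by (rule measurable_compose[OF CP_path_measurable[OF \<omega>] r(1)])
  have "\<bar>\<Sum>k<n. W r T k \<omega>\<bar>
      = \<bar>LBINT t:{0..<0 + T}. indicator {t. ennreal t < S n \<omega>} t * r (CP (max 0 t) \<omega>)\<bar>"
    unfolding sum_W[OF T \<omega> r] set_lebesgue_integral_def
    by (intro arg_cong[where f=abs] Bochner_Integration.integral_cong) (auto split: split_indicator)
  also have "\<dots> \<le> R * (0 + T - 0)"
    using r(2) R T by (intro interval_integral_bound) (auto split: split_indicator)
  finally show ?thesis by simp
qed

lemma W_measurable:
  assumes r [measurable]: "r \<in> borel_measurable borel"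
  shows "W r T k \<in> borel_measurable Q"
proof -
  have "(\<lambda>p. X (max 0 (snd p)) (fst p k)) \<in> Q \<Otimes>\<^sub>M borel \<rightarrow>\<^sub>M borel"
    by (rule X_copy_measurable) measurable
  then have [measurable]: "(\<lambda>p. Y k (snd p) (fst p)) \<in> Q \<Otimes>\<^sub>M borel \<rightarrow>\<^sub>M borel" by (simp add: Y_def)
  have "(\<lambda>p. (if 0 \<le> snd p \<and> snd p < T \<and> S k (fst p) \<le> ennreal (snd p) \<and> ennreal (snd p) < S (Suc k) (fst p) then 1 else 0)
      *\<^sub>R r (Y k (snd p) (fst p))) \<in> borel_measurable (Q \<Otimes>\<^sub>M borel)"
    by measurable
  also have "(\<lambda>p. (if 0 \<le> snd p \<and> snd p < T \<and> S k (fst p) \<le> ennreal (snd p) \<and> ennreal (snd p) < S (Suc k) (fst p) then 1 else 0)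
      *\<^sub>R r (Y k (snd p) (fst p))) = (\<lambda>(\<omega>, t). indicator (active T k \<omega>) t *\<^sub>R r (Y k t \<omega>))"
    by (auto simp: fun_eq_iff active_def)
  also have "borel_measurable (Q \<Otimes>\<^sub>M borel) = borel_measurable (Q \<Otimes>\<^sub>M lborel)"
    by (intro measurable_cong_sets sets_pair_measure_cong) auto
  finally show ?thesis
    unfolding W_def set_lebesgue_integral_def by (rule lborel.borel_measurable_lebesgue_integral)
qed

text \<open>A difference of two consecutive partial sums, whence the factor 2.\<close>

lemma W_bound:
  assumes T: "0 \<le> T" and \<omega>: "\<omega> \<in> space Q" and r: "r \<in> borel_measurable borel" "\<And>y. \<bar>r y\<bar> \<le> R"
  shows "\<bar>W r T k \<omega>\<bar> \<le> 2 * R * T"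
  using sum_W_bound[OF T \<omega> r, of k] sum_W_bound[OF T \<omega> r, of "Suc k"] by simp

lemma W_integrable:
  assumes T: "0 \<le> T" and r: "r \<in> borel_measurable borel" "\<And>y. \<bar>r y\<bar> \<le> R"
  shows "integrable Q (W r T k)"
  by (rule Q.integrable_const_bound[of _ "2 * R * T"])
    (use W_bound[OF T _ r] W_measurable[OF r(1)] in \<open>auto intro!: AE_I2\<close>)

lemma steps_end:
  assumes T: "0 \<le> T" and \<delta>: "0 < \<delta>" and \<omega>: "\<omega> \<in> space Q" and k: "S k \<omega> \<le> ennreal T"
  defines "m \<equiv> enn2real (min (S (Suc k) \<omega>) (ennreal T))" and "e \<equiv> enn2real (S k \<omega>) + real (steps T \<delta> k \<omega>) * \<delta>"
  shows "m \<le> e" "e < m + \<delta>" "enn2real (S k \<omega>) \<le> m"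
proof -
  have "S k \<omega> \<le> min (S (Suc k) \<omega>) (ennreal T)" using k S_Suc_mono[OF \<omega>] by simp
  then show sm: "enn2real (S k \<omega>) \<le> m"
    unfolding m_def by (intro enn2real_mono) (simp_all add: min_less_iff_disj)
  define z where "z = (m - enn2real (S k \<omega>)) / \<delta>"
  have st: "real (steps T \<delta> k \<omega>) = of_int \<lceil>z\<rceil>"
    using k sm \<delta> by (simp add: steps_def z_def m_def)
  have "z \<le> of_int \<lceil>z\<rceil>" "of_int \<lceil>z\<rceil> < z + 1" by linarith+
  then have "z * \<delta> \<le> of_int \<lceil>z\<rceil> * \<delta>" "of_int \<lceil>z\<rceil> * \<delta> < (z + 1) * \<delta>" using \<delta> by simp_all
  moreover have "z * \<delta> = m - enn2real (S k \<omega>)" using \<delta> by (simp add: z_def)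
  ultimately show "m \<le> e" "e < m + \<delta>" unfolding e_def st by (simp_all add: algebra_simps)
qed

text \<open>The two integrals differ by the overshoot, which is shorter than
  \<open>\<delta>\<close>.\<close>

lemma steps_integral_near_W:
  fixes r :: "'e \<Rightarrow> real"
  assumes T: "0 \<le> T" and \<delta>: "0 < \<delta>" and \<omega>: "\<omega> \<in> space Q"
    and r: "r \<in> borel_measurable borel" "\<And>y. \<bar>r y\<bar> \<le> R"
  shows "\<bar>(LBINT t:{enn2real (S k \<omega>)..<enn2real (S k \<omega>) + real (steps T \<delta> k \<omega>) * \<delta>}. r (Y k t \<omega>)) - W r T k \<omega>\<bar> \<le> R * \<delta>"
proof (cases "S k \<omega> \<le> ennreal T")
  case True
  note y = measurable_compose[OF Y_path_measurable[OF \<omega>] r(1)] r(2)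
  have R: "0 \<le> R" using r(2)[of undefined] by linarith
  let ?m = "enn2real (min (S (Suc k) \<omega>) (ennreal T))" and ?e = "enn2real (S k \<omega>) + real (steps T \<delta> k \<omega>) * \<delta>"
  note e = steps_end[OF T \<delta> \<omega> True]
  have "\<bar>LBINT t:{?m..<?e}. r (Y k t \<omega>)\<bar> \<le> R * (?e - ?m)"
    by (rule interval_integral_bound[OF y e(1)])
  also have "\<dots> \<le> R * \<delta>" using e(2) R by (intro mult_left_mono) auto
  finally show ?thesis
    unfolding W_def active_eq[OF T True] using interval_integral_split[OF y e(3) e(1)] by simp
next
  case False
  have "0 \<le> R * \<delta>" using r(2)[of undefined] \<delta> by (intro mult_nonneg_nonneg) linarith+
  then show ?thesis using False by (simp add: steps_def W_def active_empty set_lebesgue_integral_def)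
qed

text \<open>\<open>Z (Suc k) 0\<close> is the state right after impulse \<open>k\<close>.\<close>

definition impulse_cost :: "real \<Rightarrow> nat \<Rightarrow> (nat \<Rightarrow> 'w) \<Rightarrow> real" where
  "impulse_cost T k \<omega> = (if S (Suc k) \<omega> \<le> ennreal T then c (Y k (enn2real (S (Suc k) \<omega>)) \<omega>) (Z (Suc k) 0 \<omega>) else 0)"

lemma expected_cost_eq:
  "expected_cost g c X Q V T = ereal (\<integral>\<omega>. (LBINT t:{0..T}. g (CP t \<omega>)) \<partial>Q)
    + enn2ereal (\<integral>\<^sup>+\<omega>. (\<Sum>k. ennreal (impulse_cost T k \<omega>)) \<partial>Q)"
  unfolding expected_cost_def impulse_cost_def Z_def Y_def
  by (intro arg_cong2[where f="(+)"] refl arg_cong[where f=enn2ereal] nn_integral_cong suminf_cong) simp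

lemma Y_switch_measurable [measurable]: "(\<lambda>\<omega>. Y k (enn2real (S j \<omega>)) \<omega>) \<in> Q \<rightarrow>\<^sub>M borel"
  unfolding Y_def by (rule X_copy_measurable) auto

lemma c_compose_measurable:
  assumes "a \<in> M \<rightarrow>\<^sub>M borel" "b \<in> M \<rightarrow>\<^sub>M borel"
  shows "(\<lambda>\<omega>. c (a \<omega>) (b \<omega>)) \<in> borel_measurable M"
  using measurable_compose[OF measurable_Pair[OF assms] c_measurable] by simp

lemma impulse_cost_measurable [measurable]: "impulse_cost T k \<in> borel_measurable Q"
proof -
  have [measurable]: "(\<lambda>\<omega>. c (Y k (enn2real (S (Suc k) \<omega>)) \<omega>) (Z (Suc k) 0 \<omega>)) \<in> borel_measurable Q"
    by (intro c_compose_measurable) auto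
  show ?thesis unfolding impulse_cost_def by measurable
qed

lemma impulse_cost_bounds: "0 \<le> impulse_cost T k \<omega>" "impulse_cost T k \<omega> \<le> K"
  using c_pos K_pos c_bound by (auto simp: impulse_cost_def intro: less_imp_le)

lemma impulse_cost_integrable: "integrable Q (impulse_cost T k)"
  by (rule Q.integrable_const_bound[of _ K]) (use impulse_cost_bounds in auto)

section \<open>Optional stopping for subsolutions\<close>

text \<open>On each copy \<open>u\<close> telescopes from the start to the overshot end, and
  \<open>u_c\<close> leads from there to the start of the next copy; this is why \<open>c\<close>
  appears at the overshot state. A copy that outlives \<open>T\<close> ends with at most
  \<open>C\<close> instead, on the event that exactly \<open>k\<close> impulses have occurred by
  \<open>T\<close>, and the probabilities of these events telescope. They contribute one
  \<open>C\<close>, the first and the last value of \<open>u\<close> the other two.\<close>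

lemma subsolution_bound:
  assumes T: "0 \<le> T" and \<delta>: "0 < \<delta>" and slow: "slowly_moving \<epsilon> \<delta>"
    and u: "u \<in> borel_measurable borel" "\<And>y. \<bar>u y\<bar> \<le> C"
    and u_step: "\<And>y. u y \<le> semigroup \<delta> u y + \<delta> * (g y - (\<nu> + \<epsilon>))"
    and u_c: "\<And>y \<xi>. u y \<le> c y \<xi> + u \<xi> + \<kappa>"
  shows "- (3 * C) \<le> (\<Sum>k<n. \<integral>\<omega>. indicator {\<omega> \<in> space Q. S (Suc k) \<omega> \<le> ennreal T} \<omega>
        * (c (Z k (real (steps T \<delta> k \<omega>) * \<delta>) \<omega>) (Z (Suc k) 0 \<omega>) + \<kappa>) \<partial>Q)
      + (\<Sum>k<n. \<integral>\<omega>. W (\<lambda>y. g y - \<nu>) T k \<omega> \<partial>Q) + real n * (\<delta> * (G + \<bar>\<nu>\<bar>))"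
proof -
  have C: "0 \<le> C" using u(2)[of undefined] by linarith
  let ?N = "\<lambda>k. {\<omega> \<in> space Q. S k \<omega> \<le> ennreal T}"
  have N [measurable]: "?N k \<in> sets Q" for k by measurable
  let ?a = "\<lambda>k. \<integral>\<omega>. indicator (?N k) \<omega> * u (Z k 0 \<omega>) \<partial>Q"
  let ?E = "\<lambda>k \<omega>. indicator (?N (Suc k)) \<omega> * (c (Z k (real (steps T \<delta> k \<omega>) * \<delta>) \<omega>) (Z (Suc k) 0 \<omega>) + \<kappa>)"
  let ?J = "\<lambda>k \<omega>. real (steps T \<delta> k \<omega>) * \<delta>"
  have slow_g: "\<bar>semigroup t g y - g y\<bar> \<le> \<epsilon>" if "0 \<le> t" "t \<le> \<delta>" for t y
    using slow that by (simp add: slowly_moving_def)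
  have r: "(\<lambda>y. g y - \<nu>) \<in> borel_measurable borel" "\<bar>g y - \<nu>\<bar> \<le> G + \<bar>\<nu>\<bar>" for y
    using g_bound[of y] by (measurable, linarith)
  have [measurable]: "steps T \<delta> k \<in> Q \<rightarrow>\<^sub>M count_space UNIV" for k by (rule steps_measurable[OF T \<delta>])
  have step: "?a k - ?a (Suc k) - (\<integral>\<omega>. ?E k \<omega> \<partial>Q) - C * (measure Q (?N k) - measure Q (?N (Suc k)))
      \<le> (\<integral>\<omega>. W (\<lambda>y. g y - \<nu>) T k \<omega> \<partial>Q) + \<delta> * (G + \<bar>\<nu>\<bar>)" for k
  proof -
    let ?A = "\<lambda>\<omega>. \<Sum>j<steps T \<delta> k \<omega>. u (Z k (real j * \<delta>) \<omega>) - u (Z k (real j * \<delta> + \<delta>) \<omega>)"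
    let ?B = "\<lambda>\<omega>. LBINT t:{enn2real (S k \<omega>)..<enn2real (S k \<omega>) + real (steps T \<delta> k \<omega>) * \<delta>}. g (Y k t \<omega>) - \<nu>"
    note AB = copy_inequality[OF T \<delta> g_measurable g_bound slow_g u u u_step, of k]
    have int_N: "integrable Q (\<lambda>\<omega>. indicator (?N k) \<omega> * b)" for k and b :: real
      by (intro integrable_mult_left integrable_real_indicator) (auto simp: Q.emeasure_eq_measure infinity_ennreal_def)
    have int_u: "integrable Q (\<lambda>\<omega>. indicator (?N k) \<omega> * u (Z k 0 \<omega>))" for k
      by (rule integrable_Z[OF order_refl N u])
    have int_E: "integrable Q (?E k)"
    proof (rule Q.integrable_const_bound[of _ "K + \<bar>\<kappa>\<bar>"])
      have "\<bar>c y z + \<kappa>\<bar> \<le> K + \<bar>\<kappa>\<bar>" for y z using abs_c_le[of y z] by linarith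
      then show "AE \<omega> in Q. norm (?E k \<omega>) \<le> K + \<bar>\<kappa>\<bar>"
        using K_pos by (intro AE_I2) (auto split: split_indicator)
      have "(\<lambda>\<omega>. X (enn2real (S k \<omega>) + ?J k \<omega>) (\<omega> k)) \<in> Q \<rightarrow>\<^sub>M borel"
        using \<delta> by (intro X_copy_measurable) auto
      then have [measurable]: "(\<lambda>\<omega>. Z k (?J k \<omega>) \<omega>) \<in> Q \<rightarrow>\<^sub>M borel" by (simp add: Z_def)
      have [measurable]: "(\<lambda>\<omega>. c (Z k (?J k \<omega>) \<omega>) (Z (Suc k) 0 \<omega>)) \<in> borel_measurable Q"
        by (intro c_compose_measurable) auto
      show "?E k \<in> borel_measurable Q" by measurable
    qed
    have A: "?A \<omega> = u (Z k 0 \<omega>) - u (Z k (?J k \<omega>) \<omega>)" for \<omega>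
      using sum_lessThan_telescope'[of "\<lambda>j. u (Z k (real j * \<delta>) \<omega>)" "steps T \<delta> k \<omega>"]
      by (simp add: distrib_right add.commute)
    \<comment> \<open>Copy \<open>k\<close> has been left by \<open>T\<close>, is still in use at
      \<open>T\<close>, or has not been started. In the second case the terms with \<open>C\<close>
      stand in for the missing next copy.\<close>
    have pt: "indicator (?N k) \<omega> * u (Z k 0 \<omega>) - indicator (?N (Suc k)) \<omega> * u (Z (Suc k) 0 \<omega>) - ?E k \<omega>
        - (indicator (?N k) \<omega> * C - indicator (?N (Suc k)) \<omega> * C) \<le> ?A \<omega>" if \<omega>: "\<omega> \<in> space Q" for \<omega>
    proof -
      consider "S (Suc k) \<omega> \<le> ennreal T" | "S k \<omega> \<le> ennreal T" "\<not> S (Suc k) \<omega> \<le> ennreal T" | "\<not> S k \<omega> \<le> ennreal T"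
        by blast
      then show ?thesis
      proof cases
        case 1
        moreover have "S k \<omega> \<le> ennreal T" using 1 S_Suc_mono[OF \<omega>, of k] by simp
        ultimately show ?thesis
          using u_c[of "Z k (?J k \<omega>) \<omega>" "Z (Suc k) 0 \<omega>"] \<omega> unfolding A by simp
      next
        case 2
        then show ?thesis using u(2)[of "Z k (?J k \<omega>) \<omega>"] \<omega> unfolding A by simp
      next
        case 3
        moreover have "\<not> S (Suc k) \<omega> \<le> ennreal T" using 3 S_Suc_mono[OF \<omega>, of k] by auto
        ultimately show ?thesis using \<omega> by (simp add: steps_def)
      qed
    qed
    have "?a k - ?a (Suc k) - (\<integral>\<omega>. ?E k \<omega> \<partial>Q) - C * (measure Q (?N k) - measure Q (?N (Suc k)))
        = (\<integral>\<omega>. indicator (?N k) \<omega> * u (Z k 0 \<omega>) - indicator (?N (Suc k)) \<omega> * u (Z (Suc k) 0 \<omega>) - ?E k \<omega>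
        - (indicator (?N k) \<omega> * C - indicator (?N (Suc k)) \<omega> * C) \<partial>Q)"
      using int_N[of k C] int_N[of "Suc k" C] int_u[of k] int_u[of "Suc k"] int_E
      by (simp only: Bochner_Integration.integral_diff Bochner_Integration.integrable_diff)
        (simp add: right_diff_distrib mult.commute)
    also have "\<dots> \<le> (\<integral>\<omega>. ?A \<omega> \<partial>Q)"
      using int_N int_u int_E AB(1)
      by (intro integral_mono Bochner_Integration.integrable_diff pt) auto
    also have "\<dots> \<le> (\<integral>\<omega>. ?B \<omega> \<partial>Q)" by (rule AB(3))
    also have "\<dots> \<le> (\<integral>\<omega>. W (\<lambda>y. g y - \<nu>) T k \<omega> + \<delta> * (G + \<bar>\<nu>\<bar>) \<partial>Q)"
    proof (rule integral_mono[OF AB(2)])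
      show "integrable Q (\<lambda>\<omega>. W (\<lambda>y. g y - \<nu>) T k \<omega> + \<delta> * (G + \<bar>\<nu>\<bar>))"
        using W_integrable[OF T r] by simp
      fix \<omega> assume "\<omega> \<in> space Q"
      from steps_integral_near_W[OF T \<delta> this r, of k]
      show "?B \<omega> \<le> W (\<lambda>y. g y - \<nu>) T k \<omega> + \<delta> * (G + \<bar>\<nu>\<bar>)" by (simp add: mult.commute)
    qed
    also have "\<dots> = (\<integral>\<omega>. W (\<lambda>y. g y - \<nu>) T k \<omega> \<partial>Q) + \<delta> * (G + \<bar>\<nu>\<bar>)"
      using W_integrable[OF T r] Q.prob_space by simp
    finally show ?thesis .
  qed
  have "(\<Sum>k<n. ?a k - ?a (Suc k) - (\<integral>\<omega>. ?E k \<omega> \<partial>Q) - C * (measure Q (?N k) - measure Q (?N (Suc k))))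
      \<le> (\<Sum>k<n. (\<integral>\<omega>. W (\<lambda>y. g y - \<nu>) T k \<omega> \<partial>Q) + \<delta> * (G + \<bar>\<nu>\<bar>))"
    by (rule sum_mono) (rule step)
  moreover have "(\<Sum>k<n. ?a k - ?a (Suc k) - (\<integral>\<omega>. ?E k \<omega> \<partial>Q) - C * (measure Q (?N k) - measure Q (?N (Suc k))))
      = (\<Sum>k<n. ?a k - ?a (Suc k)) - (\<Sum>k<n. \<integral>\<omega>. ?E k \<omega> \<partial>Q) - C * (\<Sum>k<n. measure Q (?N k) - measure Q (?N (Suc k)))"
    by (simp add: sum_subtractf sum_distrib_left right_diff_distrib)
  moreover have "(\<Sum>k<n. ?a k - ?a (Suc k)) = ?a 0 - ?a n" by (rule sum_lessThan_telescope')
  moreover have "(\<Sum>k<n. measure Q (?N k) - measure Q (?N (Suc k))) = measure Q (?N 0) - measure Q (?N n)"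
    by (rule sum_lessThan_telescope')
  moreover have "\<bar>?a k\<bar> \<le> C" for k
  proof -
    have "\<bar>?a k\<bar> \<le> (\<integral>\<omega>. C \<partial>Q)"
      using u(2) C by (intro integral_abs_bound[THEN order_trans] integral_mono integrable_abs integrable_Z[OF order_refl N u])
        (auto split: split_indicator)
    then show ?thesis using Q.prob_space by simp
  qed
  from this[of 0] this[of n] have "- (2 * C) \<le> ?a 0 - ?a n" by linarith
  moreover have "C * (measure Q (?N 0) - measure Q (?N n)) \<le> C * 1"
    using C Q.prob_le_1[of "?N 0"] measure_nonneg[of Q "?N n"] by (intro mult_left_mono) linarith+
  ultimately show ?thesis by (simp add: sum.distrib)
qed

end


context controlled_system
begin

text \<open>With \<open>n\<close> fixed, the overshot ends approach the switch times from the right.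
  Right continuity of copy \<open>k\<close> and continuity of \<open>c\<close> restore the true
  impulse cost, and the overshoot terms vanish. Of the functions \<open>u i\<close> only the common
  bound \<open>C\<close> is left, so they need not converge.\<close>

lemma subsolution_limit:
  fixes \<delta> :: "nat \<Rightarrow> real" and u :: "nat \<Rightarrow> 'e \<Rightarrow> real"
  assumes T: "0 \<le> T" and \<delta>: "\<And>i. 0 < \<delta> i" "\<delta> \<longlonglongrightarrow> 0" and slow: "\<And>i. slowly_moving \<epsilon> (\<delta> i)"
    and u: "\<And>i. u i \<in> borel_measurable borel" "\<And>i y. \<bar>u i y\<bar> \<le> C"
    and u_step: "\<And>i y. u i y \<le> semigroup (\<delta> i) (u i) y + \<delta> i * (g y - (\<nu> + \<epsilon>))"
    and u_c: "\<And>i y \<xi>. u i y \<le> c y \<xi> + u i \<xi> + \<kappa>"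
  shows "- (3 * C) \<le> (\<Sum>k<n. \<integral>\<omega>. impulse_cost T k \<omega> + \<kappa> * indicator {\<omega> \<in> space Q. S (Suc k) \<omega> \<le> ennreal T} \<omega> \<partial>Q)
      + (\<Sum>k<n. \<integral>\<omega>. W (\<lambda>y. g y - \<nu>) T k \<omega> \<partial>Q)"
proof (rule LIMSEQ_le_const)
  let ?E = "\<lambda>i k \<omega>. indicator {\<omega> \<in> space Q. S (Suc k) \<omega> \<le> ennreal T} \<omega>
    * (c (Z k (real (steps T (\<delta> i) k \<omega>) * \<delta> i) \<omega>) (Z (Suc k) 0 \<omega>) + \<kappa>)"
  let ?f = "\<lambda>i. (\<Sum>k<n. \<integral>\<omega>. ?E i k \<omega> \<partial>Q) + (\<Sum>k<n. \<integral>\<omega>. W (\<lambda>y. g y - \<nu>) T k \<omega> \<partial>Q)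
    + real n * (\<delta> i * (G + \<bar>\<nu>\<bar>))"
  show "\<exists>N. \<forall>i\<ge>N. - (3 * C) \<le> ?f i"
    using subsolution_bound[OF T \<delta>(1) slow u u_step u_c] by blast
  have "(\<lambda>i. \<integral>\<omega>. ?E i k \<omega> \<partial>Q)
      \<longlonglongrightarrow> (\<integral>\<omega>. impulse_cost T k \<omega> + \<kappa> * indicator {\<omega> \<in> space Q. S (Suc k) \<omega> \<le> ennreal T} \<omega> \<partial>Q)" for k
  proof (rule integral_dominated_convergence[where w="\<lambda>_. K + \<bar>\<kappa>\<bar>"])
    show "(\<lambda>\<omega>. ?E i k \<omega>) \<in> borel_measurable Q" for i
    proof -
      have [measurable]: "steps T (\<delta> i) k \<in> Q \<rightarrow>\<^sub>M count_space UNIV" by (rule steps_measurable[OF T \<delta>(1)])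
      have "(\<lambda>\<omega>. X (enn2real (S k \<omega>) + real (steps T (\<delta> i) k \<omega>) * \<delta> i) (\<omega> k)) \<in> Q \<rightarrow>\<^sub>M borel"
        using \<delta>(1)[of i] by (intro X_copy_measurable) auto
      then have [measurable]: "(\<lambda>\<omega>. Z k (real (steps T (\<delta> i) k \<omega>) * \<delta> i) \<omega>) \<in> Q \<rightarrow>\<^sub>M borel" by (simp add: Z_def)
      have [measurable]: "(\<lambda>\<omega>. c (Z k (real (steps T (\<delta> i) k \<omega>) * \<delta> i) \<omega>) (Z (Suc k) 0 \<omega>)) \<in> borel_measurable Q"
        by (intro c_compose_measurable) auto
      show ?thesis by measurable
    qed
    show "(\<lambda>\<omega>. impulse_cost T k \<omega> + \<kappa> * indicator {\<omega> \<in> space Q. S (Suc k) \<omega> \<le> ennreal T} \<omega>) \<in> borel_measurable Q"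
      by measurable
    have "\<bar>c y z + \<kappa>\<bar> \<le> K + \<bar>\<kappa>\<bar>" for y z using abs_c_le[of y z] by linarith
    then show "AE \<omega> in Q. norm (?E i k \<omega>) \<le> K + \<bar>\<kappa>\<bar>" for i
      using K_pos by (intro AE_I2) (auto split: split_indicator)
    show "AE \<omega> in Q. (\<lambda>i. ?E i k \<omega>)
        \<longlonglongrightarrow> impulse_cost T k \<omega> + \<kappa> * indicator {\<omega> \<in> space Q. S (Suc k) \<omega> \<le> ennreal T} \<omega>"
    proof (rule AE_I2)
      fix \<omega> assume \<omega>: "\<omega> \<in> space Q"
      show "(\<lambda>i. ?E i k \<omega>) \<longlonglongrightarrow> impulse_cost T k \<omega> + \<kappa> * indicator {\<omega> \<in> space Q. S (Suc k) \<omega> \<le> ennreal T} \<omega>"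
      proof (cases "S (Suc k) \<omega> \<le> ennreal T")
        case True
        then have k: "S k \<omega> \<le> ennreal T" using S_Suc_mono[OF \<omega>, of k] by simp
        define m where "m = enn2real (S (Suc k) \<omega>)"
        define e where "e i = enn2real (S k \<omega>) + real (steps T (\<delta> i) k \<omega>) * \<delta> i" for i
        have e: "m \<le> e i" "e i \<le> m + \<delta> i" for i
          using steps_end(1,2)[OF T \<delta>(1) \<omega> k, of i] True by (simp_all add: m_def e_def min_absorb1)
        have "e \<longlonglongrightarrow> m"
        proof (rule tendsto_sandwich[OF _ _ tendsto_const])
          show "(\<lambda>i. m + \<delta> i) \<longlonglongrightarrow> m" using tendsto_add[OF tendsto_const \<delta>(2), of m] by simp
        qed (use e in \<open>auto intro: always_eventually\<close>)
        \<comment> \<open>A grid may hit the switch time exactly, so the limit is taken over the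
          closed half-line.\<close>
        moreover have "continuous (at m within {m..}) (\<lambda>s. X s (\<omega> k))"
          using paths_right_continuous[OF component_space[OF \<omega>], of m k]
          by (simp add: at_within_Ici_at_right m_def)
        ultimately have "(\<lambda>i. X (e i) (\<omega> k)) \<longlonglongrightarrow> X m (\<omega> k)"
          using e by (intro continuous_within_tendsto_compose[where S="{m..}" and f="\<lambda>s. X s (\<omega> k)"]) auto
        then have "(\<lambda>i. c (X (e i) (\<omega> k)) (Z (Suc k) 0 \<omega>)) \<longlonglongrightarrow> c (X m (\<omega> k)) (Z (Suc k) 0 \<omega>)"
          using c_cont1[of "Z (Suc k) 0 \<omega>"]
          by (intro isCont_tendsto_compose[of _ "\<lambda>y. c y (Z (Suc k) 0 \<omega>)"]) (auto simp: continuous_on_eq_continuous_at)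
        then have "(\<lambda>i. c (X (e i) (\<omega> k)) (Z (Suc k) 0 \<omega>) + \<kappa>) \<longlonglongrightarrow> c (X m (\<omega> k)) (Z (Suc k) 0 \<omega>) + \<kappa>"
          by (intro tendsto_intros)
        then show ?thesis
          using True \<omega> by (simp add: impulse_cost_def Z_def[of k] Y_def e_def m_def)
      qed (simp add: impulse_cost_def)
    qed
  qed simp
  moreover have "(\<lambda>i. real n * (\<delta> i * (G + \<bar>\<nu>\<bar>))) \<longlonglongrightarrow> real n * (0 * (G + \<bar>\<nu>\<bar>))"
    by (intro tendsto_intros \<delta>)
  ultimately have "?f \<longlonglongrightarrow> (\<Sum>k<n. \<integral>\<omega>. impulse_cost T k \<omega> + \<kappa> * indicator {\<omega> \<in> space Q. S (Suc k) \<omega> \<le> ennreal T} \<omega> \<partial>Q)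
      + (\<Sum>k<n. \<integral>\<omega>. W (\<lambda>y. g y - \<nu>) T k \<omega> \<partial>Q) + real n * (0 * (G + \<bar>\<nu>\<bar>))"
    by (intro tendsto_add tendsto_sum tendsto_const)
  then show "?f \<longlonglongrightarrow> (\<Sum>k<n. \<integral>\<omega>. impulse_cost T k \<omega> + \<kappa> * indicator {\<omega> \<in> space Q. S (Suc k) \<omega> \<le> ennreal T} \<omega> \<partial>Q)
      + (\<Sum>k<n. \<integral>\<omega>. W (\<lambda>y. g y - \<nu>) T k \<omega> \<partial>Q)"
    by simp
qed

abbreviation total_impulse_cost :: "real \<Rightarrow> ennreal" where
  "total_impulse_cost T \<equiv> \<integral>\<^sup>+\<omega>. (\<Sum>k. ennreal (impulse_cost T k \<omega>)) \<partial>Q"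

lemma CP_integral_diff_const:
  assumes \<omega>: "\<omega> \<in> space Q" and T: "0 \<le> T"
  shows "(LBINT t:{0..T}. g (CP t \<omega>) - \<nu>) = (LBINT t:{0..T}. g (CP t \<omega>)) - \<nu> * T"
proof -
  have r: "(\<lambda>y. g y - \<nu>) \<in> borel_measurable borel" by measurable
  have "set_integrable lborel {0..<T} (\<lambda>t. g (CP (max 0 t) \<omega>))"
    by (rule interval_set_integrable[OF measurable_compose[OF CP_path_measurable[OF \<omega>] g_measurable]]) (rule g_bound)
  moreover have "set_integrable lborel {0..<T} (\<lambda>_. \<nu>)"
    by (rule interval_set_integrable[where C="\<bar>\<nu>\<bar>"]) auto
  ultimately have "(LBINT t:{0..<T}. g (CP (max 0 t) \<omega>) - \<nu>) = (LBINT t:{0..<T}. g (CP (max 0 t) \<omega>)) - (LBINT t:{0..<T}. \<nu>)"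
    by (rule set_integral_diff(2))
  also have "(LBINT t:{0..<T}. \<nu>) = \<nu> * T" using T by (simp add: set_lebesgue_integral_def)
  finally show ?thesis
    using CP_integral_eq[OF \<omega> r, of T] CP_integral_eq[OF \<omega> g_measurable, of T] by simp
qed

section \<open>From finitely many impulses to all of them\<close>

text \<open>If the expected impulse cost is finite, then almost surely only finitely many impulses
  occur by \<open>T\<close>, each costing at least \<open>c\<^sub>0\<close>. The partial sums then
  become constant and equal to the whole running cost, and they are bounded uniformly in
  \<open>n\<close>.\<close>

lemma sum_W_expectation_tendsto:
  assumes T: "0 \<le> T" and fin: "total_impulse_cost T \<noteq> \<infinity>"
  shows "(\<lambda>n. \<Sum>k<n. \<integral>\<omega>. W (\<lambda>y. g y - \<nu>) T k \<omega> \<partial>Q) \<longlonglongrightarrow> (\<integral>\<omega>. (LBINT t:{0..T}. g (CP t \<omega>)) \<partial>Q) - \<nu> * T"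
proof -
  have r: "(\<lambda>y. g y - \<nu>) \<in> borel_measurable borel" "\<bar>g y - \<nu>\<bar> \<le> G + \<bar>\<nu>\<bar>" for y
    using g_bound[of y] by (measurable, linarith)
  have [measurable]: "W (\<lambda>y. g y - \<nu>) T k \<in> borel_measurable Q" for k by (rule W_measurable[OF r(1)])
  have "(\<lambda>n. \<integral>\<omega>. (\<Sum>k<n. W (\<lambda>y. g y - \<nu>) T k \<omega>) \<partial>Q) \<longlonglongrightarrow> (\<integral>\<omega>. (LBINT t:{0..T}. g (CP t \<omega>) - \<nu>) \<partial>Q)"
  proof (rule integral_dominated_convergence[where w="\<lambda>_. (G + \<bar>\<nu>\<bar>) * T"])
    show "AE \<omega> in Q. norm (\<Sum>k<n. W (\<lambda>y. g y - \<nu>) T k \<omega>) \<le> (G + \<bar>\<nu>\<bar>) * T" for n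
      using sum_W_bound[OF T _ r] by (intro AE_I2) simp
    show "(\<lambda>\<omega>. LBINT t:{0..T}. g (CP t \<omega>) - \<nu>) \<in> borel_measurable Q"
      by (rule CP_integral_measurable[OF r(1)])
    have "AE \<omega> in Q. (\<Sum>k. ennreal (impulse_cost T k \<omega>)) \<noteq> \<infinity>"
      by (rule nn_integral_noteq_infinite[OF _ fin]) measurable
    then show "AE \<omega> in Q. (\<lambda>n. \<Sum>k<n. W (\<lambda>y. g y - \<nu>) T k \<omega>) \<longlonglongrightarrow> (LBINT t:{0..T}. g (CP t \<omega>) - \<nu>)"
    proof (rule AE_mp, intro AE_I2 impI)
      fix \<omega> assume \<omega>: "\<omega> \<in> space Q" and fin_\<omega>: "(\<Sum>k. ennreal (impulse_cost T k \<omega>)) \<noteq> \<infinity>"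
      have "\<exists>k. \<not> S (Suc k) \<omega> \<le> ennreal T"
      proof (rule ccontr)
        assume "\<nexists>k. \<not> S (Suc k) \<omega> \<le> ennreal T"
        then have ge: "c\<^sub>0 \<le> impulse_cost T k \<omega>" for k by (simp add: impulse_cost_def c_ge)
        have le: "ennreal (real n * c\<^sub>0) \<le> (\<Sum>k. ennreal (impulse_cost T k \<omega>))" for n
        proof -
          have "ennreal (real n * c\<^sub>0) = (\<Sum>k<n. ennreal c\<^sub>0)"
            using c0_pos by (simp add: ennreal_mult ennreal_of_nat_eq_real_of_nat)
          also have "\<dots> \<le> (\<Sum>k<n. ennreal (impulse_cost T k \<omega>))"
            by (intro sum_mono ennreal_leI ge)
          also have "\<dots> \<le> (\<Sum>k. ennreal (impulse_cost T k \<omega>))"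
            by (rule sum_le_suminf) auto
          finally show ?thesis .
        qed
        obtain b where b: "(\<Sum>k. ennreal (impulse_cost T k \<omega>)) = ennreal b" "0 \<le> b"
          using fin_\<omega> by (cases "\<Sum>k. ennreal (impulse_cost T k \<omega>)") (auto simp: infinity_ennreal_def)
        obtain n where "b < real n * c\<^sub>0" using reals_Archimedean3[OF c0_pos] by blast
        with le[of n] b show False by (simp add: ennreal_le_iff)
      qed
      then obtain k where k: "\<not> S (Suc k) \<omega> \<le> ennreal T" ..
      have "(\<Sum>k<n. W (\<lambda>y. g y - \<nu>) T k \<omega>) = (LBINT t:{0..T}. g (CP t \<omega>) - \<nu>)" if "Suc k \<le> n" for n
        using S_mono[OF \<omega> that] k by (intro sum_W_finished[OF T \<omega> r]) auto
      then show "(\<lambda>n. \<Sum>k<n. W (\<lambda>y. g y - \<nu>) T k \<omega>) \<longlonglongrightarrow> (LBINT t:{0..T}. g (CP t \<omega>) - \<nu>)"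
        by (intro tendsto_eventually) (auto simp: eventually_sequentially)
    qed
  qed (auto intro: measurable)
  moreover have "(\<integral>\<omega>. (\<Sum>k<n. W (\<lambda>y. g y - \<nu>) T k \<omega>) \<partial>Q) = (\<Sum>k<n. \<integral>\<omega>. W (\<lambda>y. g y - \<nu>) T k \<omega> \<partial>Q)" for n
    by (intro Bochner_Integration.integral_sum W_integrable[OF T r])
  moreover have "(\<integral>\<omega>. (LBINT t:{0..T}. g (CP t \<omega>) - \<nu>) \<partial>Q) = (\<integral>\<omega>. (LBINT t:{0..T}. g (CP t \<omega>)) \<partial>Q) - \<nu> * T"
  proof -
    have "integrable Q (\<lambda>\<omega>. LBINT t:{0..T}. g (CP t \<omega>))"
      by (rule Q.integrable_const_bound[of _ "G * T"])
        (use CP_integral_bound[OF _ T g_measurable g_bound] CP_integral_measurable[OF g_measurable] in \<open>auto intro!: AE_I2\<close>)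
    then have "(\<integral>\<omega>. (LBINT t:{0..T}. g (CP t \<omega>)) - \<nu> * T \<partial>Q) = (\<integral>\<omega>. (LBINT t:{0..T}. g (CP t \<omega>)) \<partial>Q) - \<nu> * T"
      using Q.prob_space by simp
    then show ?thesis
      by (simp add: CP_integral_diff_const[OF _ T] cong: Bochner_Integration.integral_cong)
  qed
  ultimately show ?thesis by simp
qed

lemma sum_impulse_cost_le:
  assumes "total_impulse_cost T \<noteq> \<infinity>"
  shows "(\<Sum>k<n. \<integral>\<omega>. impulse_cost T k \<omega> \<partial>Q) \<le> enn2real (total_impulse_cost T)"
proof -
  have "ennreal (\<Sum>k<n. \<integral>\<omega>. impulse_cost T k \<omega> \<partial>Q) = ennreal (\<integral>\<omega>. (\<Sum>k<n. impulse_cost T k \<omega>) \<partial>Q)"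
    by (subst Bochner_Integration.integral_sum) (auto intro: impulse_cost_integrable)
  also have "\<dots> = (\<integral>\<^sup>+\<omega>. ennreal (\<Sum>k<n. impulse_cost T k \<omega>) \<partial>Q)"
    by (rule nn_integral_eq_integral[symmetric])
      (auto intro!: Bochner_Integration.integrable_sum impulse_cost_integrable sum_nonneg impulse_cost_bounds)
  also have "\<dots> = (\<integral>\<^sup>+\<omega>. (\<Sum>k<n. ennreal (impulse_cost T k \<omega>)) \<partial>Q)"
    by (simp add: sum_ennreal impulse_cost_bounds)
  also have "\<dots> \<le> total_impulse_cost T"
    by (intro nn_integral_mono sum_le_suminf) auto
  finally have "enn2real (ennreal (\<Sum>k<n. \<integral>\<omega>. impulse_cost T k \<omega> \<partial>Q)) \<le> enn2real (total_impulse_cost T)"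
    using assms by (intro enn2real_mono) (auto simp: less_top infinity_ennreal_def)
  moreover have "0 \<le> (\<Sum>k<n. \<integral>\<omega>. impulse_cost T k \<omega> \<partial>Q)"
    by (intro sum_nonneg Bochner_Integration.integral_nonneg impulse_cost_bounds)
  ultimately show ?thesis by simp
qed

text \<open>\<open>\<kappa>\<close> is at most \<open>\<kappa> / c\<^sub>0\<close> times the cost of
  the impulse that causes it, so all these errors together are a fraction of the impulse cost. Then
  \<open>n\<close> tends to infinity.\<close>

lemma expected_cost_lower_bound:
  fixes \<delta> :: "nat \<Rightarrow> real" and u :: "nat \<Rightarrow> 'e \<Rightarrow> real"
  assumes T: "0 \<le> T" and \<delta>: "\<And>i. 0 < \<delta> i" "\<delta> \<longlonglongrightarrow> 0" and slow: "\<And>i. slowly_moving \<epsilon> (\<delta> i)"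
    and u: "\<And>i. u i \<in> borel_measurable borel" "\<And>i y. \<bar>u i y\<bar> \<le> C"
    and u_step: "\<And>i y. u i y \<le> semigroup (\<delta> i) (u i) y + \<delta> i * (g y - (\<nu> + \<epsilon>))"
    and u_c: "\<And>i y \<xi>. u i y \<le> c y \<xi> + u i \<xi> + \<kappa>" and \<kappa>: "0 \<le> \<kappa>"
    and fin: "total_impulse_cost T \<noteq> \<infinity>"
  shows "\<nu> * T - 3 * C \<le> (\<integral>\<omega>. (LBINT t:{0..T}. g (CP t \<omega>)) \<partial>Q) + (1 + \<kappa> / c\<^sub>0) * enn2real (total_impulse_cost T)"
proof -
  let ?I = "enn2real (total_impulse_cost T)"
  have "- (3 * C) - (1 + \<kappa> / c\<^sub>0) * ?I \<le> (\<Sum>k<n. \<integral>\<omega>. W (\<lambda>y. g y - \<nu>) T k \<omega> \<partial>Q)" for n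
  proof -
    have "(\<integral>\<omega>. impulse_cost T k \<omega> + \<kappa> * indicator {\<omega> \<in> space Q. S (Suc k) \<omega> \<le> ennreal T} \<omega> \<partial>Q)
        \<le> (\<integral>\<omega>. (1 + \<kappa> / c\<^sub>0) * impulse_cost T k \<omega> \<partial>Q)" for k
    proof (rule integral_mono)
      show "integrable Q (\<lambda>\<omega>. impulse_cost T k \<omega> + \<kappa> * indicator {\<omega> \<in> space Q. S (Suc k) \<omega> \<le> ennreal T} \<omega>)"
        by (intro Bochner_Integration.integrable_add impulse_cost_integrable integrable_mult_right integrable_real_indicator)
          (auto simp: Q.emeasure_eq_measure infinity_ennreal_def)
      show "integrable Q (\<lambda>\<omega>. (1 + \<kappa> / c\<^sub>0) * impulse_cost T k \<omega>)"
        by (intro integrable_mult_right impulse_cost_integrable)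
      fix \<omega> assume "\<omega> \<in> space Q"
      have "\<kappa> * 1 \<le> \<kappa> * (c y z / c\<^sub>0)" for y z
        using \<kappa> c0_pos c_ge[of y z] by (intro mult_left_mono) (simp_all add: pos_le_divide_eq)
      then show "impulse_cost T k \<omega> + \<kappa> * indicator {\<omega> \<in> space Q. S (Suc k) \<omega> \<le> ennreal T} \<omega>
          \<le> (1 + \<kappa> / c\<^sub>0) * impulse_cost T k \<omega>"
        using \<open>\<omega> \<in> space Q\<close> by (simp add: impulse_cost_def distrib_right)
    qed
    then have "(\<Sum>k<n. \<integral>\<omega>. impulse_cost T k \<omega> + \<kappa> * indicator {\<omega> \<in> space Q. S (Suc k) \<omega> \<le> ennreal T} \<omega> \<partial>Q)
        \<le> (\<Sum>k<n. (1 + \<kappa> / c\<^sub>0) * (\<integral>\<omega>. impulse_cost T k \<omega> \<partial>Q))"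
      by (intro sum_mono) simp
    also have "\<dots> \<le> (1 + \<kappa> / c\<^sub>0) * ?I"
      unfolding sum_distrib_left[symmetric] using \<kappa> c0_pos by (intro mult_left_mono sum_impulse_cost_le fin) simp
    finally show ?thesis using subsolution_limit[OF T \<delta> slow u u_step u_c, of n] by linarith
  qed
  then have "- (3 * C) - (1 + \<kappa> / c\<^sub>0) * ?I \<le> (\<integral>\<omega>. (LBINT t:{0..T}. g (CP t \<omega>)) \<partial>Q) - \<nu> * T"
    by (intro LIMSEQ_le_const[OF sum_W_expectation_tendsto[OF T fin]]) blast
  then show ?thesis by linarith
qed

text \<open>The factor \<open>1 + \<theta>\<close> stands at the impulse cost only. To have it at
  the whole cost, \<open>\<theta>\<close> times the running cost is added, which is at least
  \<open>- \<theta> * (G * T)\<close>. The term \<open>3 * C\<close> disappears in the average, and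
  an infinite impulse cost makes the inequality trivial.\<close>

lemma average_cost_ge:
  fixes \<delta> :: "nat \<Rightarrow> real" and u :: "nat \<Rightarrow> 'e \<Rightarrow> real"
  assumes \<delta>: "\<And>i. 0 < \<delta> i" "\<delta> \<longlonglongrightarrow> 0" and slow: "\<And>i. slowly_moving \<epsilon> (\<delta> i)"
    and u: "\<And>i. u i \<in> borel_measurable borel" "\<And>i y. \<bar>u i y\<bar> \<le> C"
    and u_step: "\<And>i y. u i y \<le> semigroup (\<delta> i) (u i) y + \<delta> i * (g y - (\<nu> + \<epsilon>))"
    and u_c: "\<And>i y \<xi>. u i y \<le> c y \<xi> + u i \<xi> + \<kappa>" and \<kappa>: "0 \<le> \<kappa>"
  defines "\<theta> \<equiv> \<kappa> / c\<^sub>0"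
  shows "ereal ((\<nu> - \<theta> * G) / (1 + \<theta>)) \<le> average_cost g c X Q V"
proof -
  have \<theta>: "0 \<le> \<theta>" using \<kappa> c0_pos by (simp add: \<theta>_def)
  let ?l = "\<lambda>T::real. (\<nu> - \<theta> * G - 3 * C / T) / (1 + \<theta>)"
  have "((\<lambda>T::real. 3 * C / T) \<longlongrightarrow> 0) at_top"
    by (intro tendsto_divide_0[OF tendsto_const] filterlim_at_top_imp_at_infinity filterlim_ident)
  then have "(?l \<longlongrightarrow> (\<nu> - \<theta> * G - 0) / (1 + \<theta>)) at_top"
    using \<theta> by (intro tendsto_intros) auto
  then have "((\<lambda>T. ereal (?l T)) \<longlongrightarrow> ereal ((\<nu> - \<theta> * G) / (1 + \<theta>))) at_top"
    by simp
  then have "Limsup at_top (\<lambda>T. ereal (?l T)) = ereal ((\<nu> - \<theta> * G) / (1 + \<theta>))"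
    by (intro lim_imp_Limsup) simp_all
  moreover have "Limsup at_top (\<lambda>T. ereal (?l T)) \<le> average_cost g c X Q V"
    unfolding average_cost_def
  proof (rule Limsup_mono, use eventually_gt_at_top[of 0] in eventually_elim)
    fix T :: real assume T: "0 < T"
    let ?A = "\<integral>\<omega>. (LBINT t:{0..T}. g (CP t \<omega>)) \<partial>Q"
    show "ereal (?l T) \<le> expected_cost g c X Q V T / ereal T"
    proof (cases "total_impulse_cost T = \<infinity>")
      case True
      then have "expected_cost g c X Q V T = \<infinity>"
        by (simp add: expected_cost_eq infinity_ennreal_def top_ereal_def)
      then show ?thesis using T by simp
    next
      case False
      define I where "I = enn2real (total_impulse_cost T)"
      have I: "enn2ereal (total_impulse_cost T) = ereal I" "0 \<le> I"
        using False by (cases "total_impulse_cost T"; simp add: I_def infinity_ennreal_def enn2ereal_ennreal)+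
      have "\<bar>?A\<bar> \<le> G * T"
      proof -
        have "\<bar>?A\<bar> \<le> (\<integral>\<omega>. G * T \<partial>Q)"
        proof (rule integral_abs_bound[THEN order_trans], rule integral_mono')
          show "\<bar>LBINT t:{0..T}. g (CP t \<omega>)\<bar> \<le> G * T" if "\<omega> \<in> space Q" for \<omega>
            using CP_integral_bound[OF that _ g_measurable g_bound, of T] T by simp
        qed (use G_nonneg T in auto)
        then show ?thesis using Q.prob_space by simp
      qed
      moreover have "\<nu> * T - 3 * C \<le> ?A + (1 + \<theta>) * I"
        unfolding I_def \<theta>_def
        by (rule expected_cost_lower_bound[OF _ \<delta> slow u u_step u_c \<kappa> False]) (use T in simp)
      moreover have "\<theta> * (- (G * T)) \<le> \<theta> * ?A"
        using calculation(1) \<theta> by (intro mult_left_mono) auto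
      ultimately have "\<nu> * T - 3 * C - \<theta> * (G * T) \<le> (1 + \<theta>) * (?A + I)"
        by (simp add: algebra_simps)
      moreover have "\<nu> * T - 3 * C - \<theta> * (G * T) = (\<nu> - \<theta> * G - 3 * C / T) * T"
        using T by (simp add: algebra_simps)
      ultimately have "(\<nu> - \<theta> * G - 3 * C / T) * T / (1 + \<theta>) \<le> ?A + I"
        using \<theta> by (simp add: pos_divide_le_eq mult.commute)
      then have "?l T \<le> (?A + I) / T"
        using T by (simp add: pos_le_divide_eq)
      then show ?thesis
        using T by (simp add: expected_cost_eq I)
    qed
  qed
  ultimately show ?thesis by simp
qed

end


section \<open>Threshold strategies on a grid\<close>

context standard_process
begin

lemma pred_copies_filtration_mono:
  assumes "Measurable.pred (copies_filtration F n s) p" "s \<le> t"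
  shows "Measurable.pred (copies_filtration F n t) p"
proof -
  have "{\<omega> \<in> space (copies F). p \<omega>} \<in> sets (copies_filtration F n s)"
    using assms(1) by (simp add: pred_def)
  then have "{\<omega> \<in> space (copies F). p \<omega>} \<in> sets (copies_filtration F n t)"
    by (rule subsetD[OF sets_copies_filtration_mono[OF order_refl assms(2)]])
  then show ?thesis by (simp add: pred_def)
qed

section \<open>Threshold times and their measurability\<close>

text \<open>For \<open>a = \<infinity>\<close> no grid time is later, so the value is \<infinity>
  without a case of its own.\<close>

definition next_time :: "real \<Rightarrow> 'e set \<Rightarrow> ennreal \<Rightarrow> 'w \<Rightarrow> ennreal" where
  "next_time h I a w = (if \<exists>j. a < ennreal (real j * h) \<and> X (real j * h) w \<in> I
     then ennreal (real (LEAST j. a < ennreal (real j * h) \<and> X (real j * h) w \<in> I) * h) else \<infinity>)"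

text \<open>The index counts copies: \<open>threshold_time h I k\<close> is the start of copy
  \<open>k\<close>. The first impulse has index 1 and happens at time \<open>h\<close> at the
  earliest, even if the initial state lies in \<open>I\<close>.\<close>

fun threshold_time :: "real \<Rightarrow> 'e set \<Rightarrow> nat \<Rightarrow> (nat \<Rightarrow> 'w) \<Rightarrow> ennreal" where
  "threshold_time h I 0 \<omega> = 0"
| "threshold_time h I (Suc k) \<omega> = next_time h I (threshold_time h I k \<omega>) (\<omega> k)"

text \<open>Since \<open>next_time\<close> is strictly later, there is at most one impulse at each point of the grid.\<close>

definition threshold_strategy :: "real \<Rightarrow> 'e set \<Rightarrow> ('e \<Rightarrow> 'e) \<Rightarrow> ('w, 'e) strategy" where
  "threshold_strategy h I s = (\<lambda>k. threshold_time h I (Suc k),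
     \<lambda>k \<omega>. s (X (enn2real (threshold_time h I (Suc k) \<omega>)) (\<omega> k)))"

lemma next_time_cases:
  obtains "next_time h I a w = \<infinity>" "\<And>j. a < ennreal (real j * h) \<Longrightarrow> X (real j * h) w \<notin> I"
  | j where "next_time h I a w = ennreal (real j * h)" "a < ennreal (real j * h)" "X (real j * h) w \<in> I"
      "\<And>i. i < j \<Longrightarrow> a < ennreal (real i * h) \<Longrightarrow> X (real i * h) w \<notin> I"
proof (cases "\<exists>j. a < ennreal (real j * h) \<and> X (real j * h) w \<in> I")
  case True
  let ?j = "LEAST j. a < ennreal (real j * h) \<and> X (real j * h) w \<in> I"
  have "a < ennreal (real ?j * h) \<and> X (real ?j * h) w \<in> I" using True by (rule LeastI_ex)
  moreover have "X (real i * h) w \<notin> I" if "i < ?j" "a < ennreal (real i * h)" for i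
    using not_less_Least[OF that(1)] that(2) by blast
  ultimately show ?thesis using that(2)[of ?j] True by (simp add: next_time_def)
next
  case False
  then have "next_time h I a w = \<infinity>" by (simp only: next_time_def if_False)
  then show ?thesis using that(1) False by blast
qed

lemma next_time_le_iff:
  assumes h: "0 < h" and t: "t \<noteq> \<infinity>"
  shows "next_time h I a w \<le> t \<longleftrightarrow> (\<exists>j. ennreal (real j * h) \<le> t \<and> a < ennreal (real j * h) \<and> X (real j * h) w \<in> I)"
proof (cases rule: next_time_cases[of h I a w])
  case 1
  then show ?thesis using t by (auto simp: infinity_ennreal_def top_unique)
next
  case (2 j)
  have "ennreal (real j * h) \<le> t" if "ennreal (real i * h) \<le> t" "a < ennreal (real i * h)" "X (real i * h) w \<in> I" for i
  proof -
    have "j \<le> i" using 2(4)[of i] that(2,3) by (meson not_le)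
    then have "ennreal (real j * h) \<le> ennreal (real i * h)"
      using h by (intro ennreal_leI mult_right_mono) auto
    then show ?thesis using that(1) by simp
  qed
  then show ?thesis using 2 by auto
qed

lemma threshold_time_less: "threshold_time h I k \<omega> < \<infinity> \<Longrightarrow> threshold_time h I k \<omega> < threshold_time h I (Suc k) \<omega>"
  by (cases rule: next_time_cases[of h I "threshold_time h I k \<omega>" "\<omega> k"]) auto

lemma threshold_time_grid:
  "threshold_time h I k \<omega> = \<infinity> \<or> (\<exists>j::nat. threshold_time h I k \<omega> = ennreal (real j * h))"
proof (cases k)
  case 0
  then show ?thesis by (auto intro: exI[of _ 0])
next
  case (Suc i)
  then show ?thesis
    by (cases rule: next_time_cases[of h I "threshold_time h I i \<omega>" "\<omega> i"]) auto
qed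

text \<open>The start of copy \<open>k\<close> depends on the earlier copies alone, so
  \<open>k\<close> copies suffice, and none for \<open>k = 0\<close>. For finite \<open>t\<close>
  the event is a countable union over grid points up to \<open>t\<close>, each decided at its own
  time.\<close>

lemma stopping_time_threshold_time:
  assumes h: "0 < h" and I [measurable]: "I \<in> sets borel"
  shows "stopping_time (copies_filtration F k) (threshold_time h I k)"
proof (induction k)
  case 0
  have "threshold_time h I 0 = (\<lambda>_. 0)" by auto
  then show ?case by (simp add: stopping_time_const)
next
  case (Suc k)
  interpret fc: filtration "space (copies F)" "copies_filtration F (Suc k)" by (rule filtration_copies)
  have prev: "stopping_time (copies_filtration F (Suc k)) (threshold_time h I k)"
    by (rule stopping_time_copies_mono[OF Suc]) simp
  show ?case
  proof (rule stopping_timeI)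
    fix t :: ennreal
    show "Measurable.pred (copies_filtration F (Suc k) t) (\<lambda>\<omega>. threshold_time h I (Suc k) \<omega> \<le> t)"
    proof (cases "t = \<infinity>")
      case True
      then show ?thesis by (simp add: infinity_ennreal_def)
    next
      case False
      have "Measurable.pred (copies_filtration F (Suc k) t)
          (\<lambda>\<omega>. ennreal (real j * h) \<le> t \<and> threshold_time h I k \<omega> < ennreal (real j * h) \<and> X (real j * h) (\<omega> k) \<in> I)" for j
      proof (cases "ennreal (real j * h) \<le> t")
        case True
        have "Measurable.pred (copies_filtration F (Suc k) (ennreal (real j * h))) (\<lambda>\<omega>. threshold_time h I k \<omega> < ennreal (real j * h))"
          by (rule fc.stopping_time_less_const[OF prev])
        then have [measurable]: "Measurable.pred (copies_filtration F (Suc k) t) (\<lambda>\<omega>. threshold_time h I k \<omega> < ennreal (real j * h))"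
          by (rule pred_copies_filtration_mono[OF _ True])
        have [measurable]: "(\<lambda>\<omega>. X (real j * h) (\<omega> k)) \<in> copies_filtration F (Suc k) t \<rightarrow>\<^sub>M borel"
          using measurable_compose[OF measurable_coarser[OF component_copies_filtration True] adapted] h by simp
        show ?thesis by measurable
      qed simp
      then have "Measurable.pred (copies_filtration F (Suc k) t)
          (\<lambda>\<omega>. \<exists>j. ennreal (real j * h) \<le> t \<and> threshold_time h I k \<omega> < ennreal (real j * h) \<and> X (real j * h) (\<omega> k) \<in> I)"
        by (rule pred_intros_countable)
      then show ?thesis unfolding threshold_time.simps next_time_le_iff[OF h False] .
    qed
  qed
qed

lemma threshold_strategy_grid:
  assumes h: "0 < h" and I: "I \<in> sets borel" and s: "s \<in> borel \<rightarrow>\<^sub>M borel"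
  shows "threshold_strategy h I s \<in> grid_strategies F h"
proof -
  let ?T = "threshold_time h I"
  let ?\<xi> = "\<lambda>k \<omega>. s (X (enn2real (?T (Suc k) \<omega>)) (\<omega> k))"
  note stop = stopping_time_threshold_time[OF h I]
  have "?\<xi> k \<in> filtration.pre_sigma (space (copies F)) (copies_filtration F (Suc k)) (?T (Suc k)) \<rightarrow>\<^sub>M borel" for k
  proof (rule measurableI)
    interpret fc: filtration "space (copies F)" "copies_filtration F (Suc k)" by (rule filtration_copies)
    fix A :: "'e set" assume [measurable]: "A \<in> sets borel"
    note [measurable] = s
    have "{\<omega> \<in> ?\<xi> k -` A \<inter> space (copies F). ?T (Suc k) \<omega> \<le> t} \<in> sets (copies_filtration F (Suc k) t)" for t
    proof -
      have state: "Measurable.pred (copies_filtration F (Suc k) t) (\<lambda>\<omega>. s (X (real j * h) (\<omega> k)) \<in> A)"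
        if "ennreal (real j * h) \<le> t" for j
      proof -
        have [measurable]: "(\<lambda>\<omega>. X (real j * h) (\<omega> k)) \<in> copies_filtration F (Suc k) t \<rightarrow>\<^sub>M borel"
          using measurable_compose[OF measurable_coarser[OF component_copies_filtration that] adapted] h by simp
        show ?thesis by measurable
      qed
      have eq: "Measurable.pred (copies_filtration F (Suc k) t) (\<lambda>\<omega>. ?T (Suc k) \<omega> = u)" if "u \<le> t" for u
        by (rule pred_copies_filtration_mono[OF fc.stopping_time_eq_const[OF stop] that])
      have "Measurable.pred (copies_filtration F (Suc k) t)
          (\<lambda>\<omega>. ennreal (real j * h) \<le> t \<and> ?T (Suc k) \<omega> = ennreal (real j * h) \<and> s (X (real j * h) (\<omega> k)) \<in> A)" for j
        using state[of j] eq[of "ennreal (real j * h)"] by (cases "ennreal (real j * h) \<le> t") simp_all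
      then have "Measurable.pred (copies_filtration F (Suc k) t)
          (\<lambda>\<omega>. \<exists>j. ennreal (real j * h) \<le> t \<and> ?T (Suc k) \<omega> = ennreal (real j * h) \<and> s (X (real j * h) (\<omega> k)) \<in> A)"
        by (rule pred_intros_countable)
      \<comment> \<open>Where the threshold time is infinite, \<open>enn2real\<close> yields 0 and
        the target is computed from the state at time 0; this default has to be measurable as
        well.\<close>
      moreover have "Measurable.pred (copies_filtration F (Suc k) t) (\<lambda>\<omega>. \<infinity> \<le> t \<and> ?T (Suc k) \<omega> = \<infinity> \<and> s (X 0 (\<omega> k)) \<in> A)"
        using state[of 0] eq[of \<infinity>] by (cases "\<infinity> \<le> t") simp_all
      ultimately have "Measurable.pred (copies_filtration F (Suc k) t)
          (\<lambda>\<omega>. (\<exists>j. ennreal (real j * h) \<le> t \<and> ?T (Suc k) \<omega> = ennreal (real j * h) \<and> s (X (real j * h) (\<omega> k)) \<in> A)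
            \<or> (\<infinity> \<le> t \<and> ?T (Suc k) \<omega> = \<infinity> \<and> s (X 0 (\<omega> k)) \<in> A))"
        by (rule pred_intros_logic)
      moreover have "{\<omega> \<in> ?\<xi> k -` A \<inter> space (copies F). ?T (Suc k) \<omega> \<le> t} = {\<omega> \<in> space (copies F).
          (\<exists>j. ennreal (real j * h) \<le> t \<and> ?T (Suc k) \<omega> = ennreal (real j * h) \<and> s (X (real j * h) (\<omega> k)) \<in> A)
            \<or> (\<infinity> \<le> t \<and> ?T (Suc k) \<omega> = \<infinity> \<and> s (X 0 (\<omega> k)) \<in> A)}"
      proof (intro Collect_cong)
        fix \<omega>
        show "(\<omega> \<in> ?\<xi> k -` A \<inter> space (copies F) \<and> ?T (Suc k) \<omega> \<le> t) = (\<omega> \<in> space (copies F) \<and>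
          ((\<exists>j. ennreal (real j * h) \<le> t \<and> ?T (Suc k) \<omega> = ennreal (real j * h) \<and> s (X (real j * h) (\<omega> k)) \<in> A)
            \<or> (\<infinity> \<le> t \<and> ?T (Suc k) \<omega> = \<infinity> \<and> s (X 0 (\<omega> k)) \<in> A)))"
        proof (cases "?T (Suc k) \<omega> = \<infinity>")
          case True
          have "enn2real \<infinity> = 0" "\<infinity> \<noteq> ennreal a" for a by (simp_all add: infinity_ennreal_def)
          then show ?thesis unfolding vimage_eq Int_iff True by auto
        next
          case False
          then obtain i where i: "?T (Suc k) \<omega> = ennreal (real i * h)"
            using threshold_time_grid[of h I "Suc k" \<omega>] by blast
          have inj: "ennreal (real i * h) = \<infinity> \<longleftrightarrow> False" "enn2real (ennreal (real i * h)) = real i * h"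
            "ennreal (real i * h) = ennreal (real j * h) \<longleftrightarrow> i = j" for j
            using h by (simp_all add: infinity_ennreal_def)
          show ?thesis unfolding vimage_eq Int_iff i inj by blast
        qed
      qed
      ultimately show ?thesis unfolding pred_def space_copies_filtration by (simp only:)
    qed
    then show "?\<xi> k -` A \<inter> space (fc.pre_sigma (?T (Suc k))) \<in> sets (fc.pre_sigma (?T (Suc k)))"
      by (intro fc.sets_pre_sigmaI[OF stop]) (simp add: fc.space_pre_sigma del: threshold_time.simps)
  qed simp
  moreover have "?T k \<omega> \<le> ?T (Suc k) \<omega>" for k \<omega>
  proof (cases "?T k \<omega> = \<infinity>")
    case True
    then show ?thesis
      by (cases rule: next_time_cases[of h I "?T k \<omega>" "\<omega> k"]) (auto simp: infinity_ennreal_def)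
  next
    case False
    then show ?thesis
      using threshold_time_less[of h I k \<omega>] by (simp add: infinity_ennreal_def less_top less_imp_le)
  qed
  ultimately show ?thesis
    using stop threshold_time_grid
    unfolding grid_strategies_def strategies_def threshold_strategy_def
    by (simp del: threshold_time.simps)
qed

lemma switch_time_threshold: "switch_time (threshold_strategy h I s) k \<omega> = threshold_time h I k \<omega>"
  by (cases k) (simp_all add: threshold_strategy_def)

end


section \<open>The cost of a threshold strategy\<close>

text \<open>The data come from \<open>average_cost_bellman\<close>: \<open>q\<close> is the value of
  waiting, \<open>w\<close> the optimal value. Up to multiples of \<open>h * \<epsilon>\<close>,
  waiting outside \<open>I\<close> and an impulse by \<open>s\<close> inside \<open>I\<close> cost
  no more than \<open>w\<close>.\<close>

locale threshold_controlled_system =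
  controlled_system F X P g c c\<^sub>0 G K x "standard_process.threshold_strategy X h I s" Q
  for F :: "ennreal \<Rightarrow> 'w measure" and X :: "real \<Rightarrow> 'w \<Rightarrow> 'e::polish_space" and P :: "'e \<Rightarrow> 'w measure"
    and g :: "'e \<Rightarrow> real" and c :: "'e \<Rightarrow> 'e \<Rightarrow> real" and c\<^sub>0 G K :: real
    and x :: 'e and h :: real and I :: "'e set" and s :: "'e \<Rightarrow> 'e" and Q :: "(nat \<Rightarrow> 'w) measure" +
  fixes q w :: "'e \<Rightarrow> real" and C \<mu> \<epsilon> :: real
  assumes h: "0 < h" and slow: "slowly_moving \<epsilon> h"
    and w: "w \<in> borel_measurable borel" "\<And>y. 0 \<le> w y" "\<And>y. w y \<le> C"
    and q: "q \<in> borel_measurable borel" "\<And>y. \<bar>q y\<bar> \<le> C"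
    and q_ge: "\<And>y. semigroup h w y + h * (g y - (\<mu> + \<epsilon>)) \<le> q y"
    and outside: "\<And>y. y \<notin> I \<Longrightarrow> q y \<le> w y"
    and inside: "\<And>y. y \<in> I \<Longrightarrow> c y (s y) + q (s y) \<le> w y + h * \<epsilon>"
begin

lemma S_threshold: "S k \<omega> = threshold_time h I k \<omega>"
  by (rule switch_time_threshold)

lemma S_grid: "S k \<omega> < \<infinity> \<Longrightarrow> \<exists>j::nat. S k \<omega> = ennreal (real j * h)"
  using threshold_time_grid[of h I k \<omega>] by (auto simp: S_threshold)

lemma S_less: "S k \<omega> < \<infinity> \<Longrightarrow> S k \<omega> < S (Suc k) \<omega>"
  unfolding S_threshold by (rule threshold_time_less)

text \<open>Switch times increase strictly along the grid. This bounds the number of impulses, keeps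
  their cost finite and limits how often the selection error \<open>h * \<epsilon>\<close> is
  made.\<close>

lemma S_ge: "ennreal (real k * h) \<le> S k \<omega>"
proof (induction k)
  case (Suc k)
  show ?case
  proof (cases "S (Suc k) \<omega> = \<infinity>")
    case False
    then obtain j where j: "S (Suc k) \<omega> = ennreal (real j * h)"
      using S_grid[of "Suc k" \<omega>] by (auto simp: infinity_ennreal_def less_top)
    have "ennreal (real k * h) < ennreal (real j * h)"
      using Suc S_less[of k \<omega>] unfolding j[symmetric]
      by (cases "S k \<omega> < \<infinity>") (auto simp: infinity_ennreal_def less_top[symmetric] S_threshold next_time_def split: if_splits)
    then have "k < j" using h by (simp add: ennreal_less_iff)
    then have "ennreal (real (Suc k) * h) \<le> ennreal (real j * h)"
      using h by (intro ennreal_leI mult_right_mono) auto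
    then show ?thesis by (simp only: j)
  qed (simp add: infinity_ennreal_def)
qed simp

lemma switch_in_I:
  assumes "S (Suc k) \<omega> < \<infinity>"
  shows "Y k (enn2real (S (Suc k) \<omega>)) \<omega> \<in> I"
    and "switch_state x (threshold_strategy h I s) (Suc k) \<omega> = s (Y k (enn2real (S (Suc k) \<omega>)) \<omega>)"
proof -
  have "Y k (enn2real (S (Suc k) \<omega>)) \<omega> = X (enn2real (threshold_time h I (Suc k) \<omega>)) (\<omega> k)"
    by (simp add: Y_def S_threshold del: threshold_time.simps)
  moreover have "X (enn2real (threshold_time h I (Suc k) \<omega>)) (\<omega> k) \<in> I"
  proof (cases rule: next_time_cases[of h I "threshold_time h I k \<omega>" "\<omega> k"])
    case (2 j)
    then show ?thesis using h by simp
  qed (use assms in \<open>simp add: S_threshold\<close>)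
  ultimately show "Y k (enn2real (S (Suc k) \<omega>)) \<omega> \<in> I"
    "switch_state x (threshold_strategy h I s) (Suc k) \<omega> = s (Y k (enn2real (S (Suc k) \<omega>)) \<omega>)"
    by (simp_all add: threshold_strategy_def)
qed

lemma no_switch_notin_I:
  assumes "S k \<omega> < ennreal (real j * h)" "ennreal (real j * h) < S (Suc k) \<omega>"
  shows "X (real j * h) (\<omega> k) \<notin> I"
proof
  assume "X (real j * h) (\<omega> k) \<in> I"
  then have "next_time h I (threshold_time h I k \<omega>) (\<omega> k) \<le> ennreal (real j * h)"
    using assms(1) by (subst next_time_le_iff[OF h]) (auto simp: infinity_ennreal_def S_threshold)
  then show False using assms(2) by (simp add: S_threshold)
qed

context
  fixes N :: nat and T :: real
  assumes T: "T = real N * h"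
begin

lemma T_nonneg: "0 \<le> T"
  using h by (simp add: T)

text \<open>Start and end of the copy are multiples of \<open>h\<close>, since \<open>T\<close> is
  one too, and the overshoot is less than \<open>h\<close>; so there is none.\<close>

lemma steps_end_grid:
  assumes \<omega>: "\<omega> \<in> space Q" and k: "S k \<omega> \<le> ennreal T"
  shows "enn2real (S k \<omega>) + real (steps T h k \<omega>) * h = enn2real (min (S (Suc k) \<omega>) (ennreal T))"
proof -
  let ?m = "enn2real (min (S (Suc k) \<omega>) (ennreal T))"
  have fin: "S k \<omega> < \<infinity>" using k by (auto simp: infinity_ennreal_def intro: le_less_trans)
  obtain i where i: "S k \<omega> = ennreal (real i * h)" using S_grid[OF fin] by blast
  obtain j where j: "?m = real j * h"
  proof (cases "S (Suc k) \<omega> \<le> ennreal T")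
    case True
    then have "S (Suc k) \<omega> < \<infinity>" by (auto simp: infinity_ennreal_def intro: le_less_trans)
    from S_grid[OF this] obtain j where "S (Suc k) \<omega> = ennreal (real j * h)" ..
    then show ?thesis using that[of j] True h by (simp add: min_absorb1)
  next
    case False
    then show ?thesis using that[of N] h by (simp add: min_absorb2 T)
  qed
  have "?m \<le> real (i + steps T h k \<omega>) * h" "real (i + steps T h k \<omega>) * h < ?m + h"
    using steps_end(1,2)[OF T_nonneg h \<omega> k] i h by (simp_all add: distrib_right)
  then have "real j * h \<le> real (i + steps T h k \<omega>) * h" "real (i + steps T h k \<omega>) * h < real (j + 1) * h"
    unfolding j by (simp_all add: distrib_right)
  then have "real j \<le> real (i + steps T h k \<omega>)" "real (i + steps T h k \<omega>) < real (j + 1)"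
    using h by (simp_all only: mult_le_cancel_right_pos mult_less_cancel_right_pos)
  then have "i + steps T h k \<omega> = j" by linarith
  then have "real i * h + real (steps T h k \<omega>) * h = ?m"
    unfolding j by (simp add: distrib_right[symmetric] del: of_nat_add add: of_nat_add[symmetric])
  then show ?thesis using i h by simp
qed

lemma grid_integral_eq_W:
  assumes \<omega>: "\<omega> \<in> space Q"
  shows "(LBINT t:{enn2real (S k \<omega>)..<enn2real (S k \<omega>) + real (steps T h k \<omega>) * h}. r (Y k t \<omega>)) = W r T k \<omega>"
proof (cases "S k \<omega> \<le> ennreal T")
  case True
  show ?thesis unfolding W_def active_eq[OF T_nonneg True] steps_end_grid[OF \<omega> True] ..
next
  case False
  then show ?thesis by (simp add: steps_def W_def active_empty set_lebesgue_integral_def)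
qed

text \<open>At grid points strictly between start and end of the copy the state is outside
  \<open>I\<close>, where \<open>q \<le> w\<close>, so the sum collapses to \<open>q\<close> at the
  start minus \<open>w\<close> at the end. The start keeps \<open>q\<close> because one step is
  waited there even if the state is in \<open>I\<close>. At the end \<open>inside\<close> trades
  \<open>w\<close> for the impulse cost and \<open>q\<close> at the next start, up to
  \<open>h * \<epsilon>\<close>. For a copy that outlives \<open>T\<close>, \<open>w \<ge> 0\<close>
  and the allowance \<open>C\<close> are used.\<close>

lemma copy_sum_le:
  assumes \<omega>: "\<omega> \<in> space Q" and start: "S (Suc k) \<omega> < \<infinity> \<longrightarrow> Z (Suc k) 0 \<omega> = switch_state x (threshold_strategy h I s) (Suc k) \<omega>"
  shows "(\<Sum>j<steps T h k \<omega>. q (Z k (real j * h) \<omega>) - w (Z k (real j * h + h) \<omega>))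
    \<le> indicator {\<omega> \<in> space Q. S k \<omega> \<le> ennreal T} \<omega> * q (Z k 0 \<omega>)
      - indicator {\<omega> \<in> space Q. S (Suc k) \<omega> \<le> ennreal T} \<omega> * q (Z (Suc k) 0 \<omega>)
      - impulse_cost T k \<omega> + indicator {\<omega> \<in> space Q. S (Suc k) \<omega> \<le> ennreal T} \<omega> * (h * \<epsilon>)
      + (indicator {\<omega> \<in> space Q. S k \<omega> \<le> ennreal T} \<omega> * C - indicator {\<omega> \<in> space Q. S (Suc k) \<omega> \<le> ennreal T} \<omega> * C)"
proof (cases "S k \<omega> \<le> ennreal T")
  case False
  then have "\<not> S (Suc k) \<omega> \<le> ennreal T" using S_Suc_mono[OF \<omega>, of k] by auto
  then show ?thesis using False \<omega> by (simp add: steps_def impulse_cost_def)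
next
  case True
  let ?J = "steps T h k \<omega>"
  let ?a = "enn2real (S k \<omega>)"
  have fin: "S k \<omega> < \<infinity>" using True by (auto simp: infinity_ennreal_def intro: le_less_trans)
  obtain i where i: "S k \<omega> = ennreal (real i * h)" using S_grid[OF fin] by blast
  have before: "q (Z k (real j * h) \<omega>) \<le> w (Z k (real j * h) \<omega>)" if "0 < j" "j < ?J" for j
  proof (rule outside)
    have sum: "S k \<omega> + ennreal (real j * h) = ennreal (real (i + j) * h)"
      unfolding i using h by (simp add: distrib_right)
    have "S k \<omega> < ennreal (real (i + j) * h)"
      unfolding i using that(1) h by (simp add: ennreal_less_iff del: of_nat_add)
    moreover have "ennreal (real (i + j) * h) < S (Suc k) \<omega>"
      using less_steps_iff[OF T_nonneg h \<omega>, of j k] that(2) by (simp add: sum[symmetric] del: of_nat_add)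
    ultimately have "X (real (i + j) * h) (\<omega> k) \<notin> I" by (rule no_switch_notin_I)
    then show "Z k (real j * h) \<omega> \<notin> I" using h by (simp add: Z_def i distrib_right)
  qed
  have sum_le: "(\<Sum>j<n. q (Z k (real j * h) \<omega>) - w (Z k (real j * h + h) \<omega>)) \<le> q (Z k 0 \<omega>) - w (Z k (real n * h) \<omega>)"
    if "0 < n" "n \<le> ?J" for n
    using that
  proof (induction n)
    case (Suc n)
    show ?case
    proof (cases "n = 0")
      case False
      then show ?thesis using Suc before[of n] by (simp add: algebra_simps)
    qed simp
  qed simp
  show ?thesis
  proof (cases "S (Suc k) \<omega> \<le> ennreal T")
    case False
    have "(\<Sum>j<?J. q (Z k (real j * h) \<omega>) - w (Z k (real j * h + h) \<omega>)) \<le> q (Z k 0 \<omega>) + C"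
    proof (cases "?J = 0")
      case True
      then show ?thesis using q(2)[of "Z k 0 \<omega>"] by simp
    next
      case False
      then show ?thesis
        using sum_le[of ?J] w(2)[of "Z k (real ?J * h) \<omega>"] q(2)[of undefined] by simp
    qed
    then show ?thesis using True False \<omega> by (simp add: impulse_cost_def)
  next
    case le: True
    then have fin': "S (Suc k) \<omega> < \<infinity>" by (auto simp: infinity_ennreal_def intro: le_less_trans)
    let ?b = "enn2real (S (Suc k) \<omega>)"
    have end_eq: "?a + real ?J * h = ?b"
      using steps_end_grid[OF \<omega> True] le by (simp add: min_absorb1)
    have "?a < ?b"
      using S_less[OF fin] fin fin' by (simp add: enn2real_less_iff infinity_ennreal_def less_top[symmetric])
    then have "0 < ?J" using end_eq by (cases "?J = 0") auto
    have end_Z: "Z k (real ?J * h) \<omega> = Y k ?b \<omega>" using h by (simp add: Z_eq_Y end_eq)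
    have "(\<Sum>j<?J. q (Z k (real j * h) \<omega>) - w (Z k (real j * h + h) \<omega>)) \<le> q (Z k 0 \<omega>) - w (Y k ?b \<omega>)"
      using sum_le[OF \<open>0 < ?J\<close> order_refl] by (simp add: end_Z)
    moreover have "c (Y k ?b \<omega>) (Z (Suc k) 0 \<omega>) + q (Z (Suc k) 0 \<omega>) \<le> w (Y k ?b \<omega>) + h * \<epsilon>"
      using inside[OF switch_in_I(1)[OF fin']] start fin' switch_in_I(2)[OF fin'] by simp
    ultimately show ?thesis using True le \<omega> by (simp add: impulse_cost_def)
  qed
qed

text \<open>Applied to \<open>- g\<close>, \<open>- q\<close> and \<open>- w\<close>,
  \<open>copy_inequality\<close> bounds the cost from above. Of the two \<epsilon> in
  \<open>\<mu> + 2 * \<epsilon>\<close>, one comes from \<open>q_ge\<close> and one from the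
  variation of \<open>g\<close> within a step.\<close>

lemma W_step:
  defines "N\<^sub>k \<equiv> \<lambda>k. {\<omega> \<in> space Q. S k \<omega> \<le> ennreal T}"
  shows "(\<integral>\<omega>. W (\<lambda>y. g y - (\<mu> + 2 * \<epsilon>)) T k \<omega> \<partial>Q) + (\<integral>\<omega>. impulse_cost T k \<omega> \<partial>Q)
    \<le> ((\<integral>\<omega>. indicator (N\<^sub>k k) \<omega> * q (Z k 0 \<omega>) \<partial>Q) - (\<integral>\<omega>. indicator (N\<^sub>k (Suc k)) \<omega> * q (Z (Suc k) 0 \<omega>) \<partial>Q))
      + measure Q (N\<^sub>k (Suc k)) * (h * \<epsilon>) + (measure Q (N\<^sub>k k) * C - measure Q (N\<^sub>k (Suc k)) * C)"
proof -
  have [measurable]: "N\<^sub>k k \<in> sets Q" for k unfolding N\<^sub>k_def by measurable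
  have int_N: "integrable Q (\<lambda>\<omega>. indicator (N\<^sub>k k) \<omega> * b)" for k and b :: real
    by (intro integrable_mult_left integrable_real_indicator) (auto simp: Q.emeasure_eq_measure infinity_ennreal_def)
  have N_mult: "(\<integral>\<omega>. indicator (N\<^sub>k k) \<omega> * b \<partial>Q) = measure Q (N\<^sub>k k) * b" for k and b :: real
    by simp
  have int_q: "integrable Q (\<lambda>\<omega>. indicator (N\<^sub>k k) \<omega> * q (Z k 0 \<omega>))" for k
    by (rule integrable_Z[OF order_refl _ q]) measurable
  let ?A = "\<lambda>\<omega>. \<Sum>j<steps T h k \<omega>. q (Z k (real j * h) \<omega>) - w (Z k (real j * h + h) \<omega>)"
  let ?A' = "\<lambda>\<omega>. \<Sum>j<steps T h k \<omega>. - q (Z k (real j * h) \<omega>) - - w (Z k (real j * h + h) \<omega>)"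
  let ?B' = "\<lambda>\<omega>. LBINT t:{enn2real (S k \<omega>)..<enn2real (S k \<omega>) + real (steps T h k \<omega>) * h}. - g (Y k t \<omega>) - - (\<mu> + 2 * \<epsilon>)"
  let ?R = "\<lambda>\<omega>. indicator (N\<^sub>k k) \<omega> * q (Z k 0 \<omega>) - indicator (N\<^sub>k (Suc k)) \<omega> * q (Z (Suc k) 0 \<omega>)
      - impulse_cost T k \<omega> + indicator (N\<^sub>k (Suc k)) \<omega> * (h * \<epsilon>)
      + (indicator (N\<^sub>k k) \<omega> * C - indicator (N\<^sub>k (Suc k)) \<omega> * C)"
  have minus: "semigroup t (\<lambda>y. - f y) y = - semigroup t f y" for t f y
    by (simp add: semigroup_def)
  have w_abs: "\<bar>w y\<bar> \<le> C" for y using w(2,3)[of y] by simp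
  have AB: "integrable Q ?A'" "integrable Q ?B'" "(\<integral>\<omega>. ?A' \<omega> \<partial>Q) \<le> (\<integral>\<omega>. ?B' \<omega> \<partial>Q)"
  proof -
    have le: "- q y \<le> semigroup h (\<lambda>y. - w y) y + h * (- g y - (- (\<mu> + 2 * \<epsilon>) + \<epsilon>))" for y
      using q_ge[of y] by (simp add: minus algebra_simps)
    have slow': "\<bar>semigroup t (\<lambda>y. - g y) y - - g y\<bar> \<le> \<epsilon>" if "0 \<le> t" "t \<le> h" for t y
    proof -
      have "\<bar>semigroup t g y - g y\<bar> \<le> \<epsilon>" using slow that by (simp add: slowly_moving_def)
      then show ?thesis by (simp add: minus)
    qed
    have bounds: "\<bar>- g y\<bar> \<le> G" "\<bar>- q y\<bar> \<le> C" "\<bar>- w y\<bar> \<le> C" for y using g_bound q(2) w_abs by simp_all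
    have meas: "(\<lambda>y. - g y) \<in> borel_measurable borel" "(\<lambda>y. - q y) \<in> borel_measurable borel" "(\<lambda>y. - w y) \<in> borel_measurable borel"
      using q(1) w(1) by simp_all
    show "integrable Q ?A'" "integrable Q ?B'" "(\<integral>\<omega>. ?A' \<omega> \<partial>Q) \<le> (\<integral>\<omega>. ?B' \<omega> \<partial>Q)"
      by (rule copy_inequality[OF T_nonneg h meas(1) bounds(1) slow' meas(2) bounds(2) meas(3) bounds(3) le]; assumption)+
  qed
  have A': "?A' \<omega> = - ?A \<omega>" for \<omega> by (simp add: sum_negf[symmetric])
  have B': "?B' \<omega> = - W (\<lambda>y. g y - (\<mu> + 2 * \<epsilon>)) T k \<omega>" if "\<omega> \<in> space Q" for \<omega>
  proof -
    have "?B' \<omega> = (LBINT t:{enn2real (S k \<omega>)..<enn2real (S k \<omega>) + real (steps T h k \<omega>) * h}. - (g (Y k t \<omega>) - (\<mu> + 2 * \<epsilon>)))"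
      by (simp add: algebra_simps)
    also have "\<dots> = - (LBINT t:{enn2real (S k \<omega>)..<enn2real (S k \<omega>) + real (steps T h k \<omega>) * h}. g (Y k t \<omega>) - (\<mu> + 2 * \<epsilon>))"
      unfolding set_lebesgue_integral_def by (simp only: scaleR_minus_right Bochner_Integration.integral_minus)
    finally show ?thesis
      using grid_integral_eq_W[OF that, where r="\<lambda>y. g y - (\<mu> + 2 * \<epsilon>)"] by simp
  qed
  have "(\<integral>\<omega>. W (\<lambda>y. g y - (\<mu> + 2 * \<epsilon>)) T k \<omega> \<partial>Q) = - (\<integral>\<omega>. ?B' \<omega> \<partial>Q)"
    by (simp only: Bochner_Integration.integral_cong[OF refl B'] Bochner_Integration.integral_minus minus_minus)
  also have "\<dots> \<le> (\<integral>\<omega>. ?A \<omega> \<partial>Q)" using AB(3) unfolding A' Bochner_Integration.integral_minus by linarith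
  \<comment> \<open>An almost sure inequality, because the next copy starts in its prescribed state
    only almost surely.\<close>
  also have "\<dots> \<le> (\<integral>\<omega>. ?R \<omega> \<partial>Q)"
  proof (rule integral_mono_AE)
    show "integrable Q ?A" using Bochner_Integration.integrable_minus[OF AB(1)] unfolding A' minus_minus .
    show "integrable Q ?R"
      by (intro Bochner_Integration.integrable_add Bochner_Integration.integrable_diff int_N int_q impulse_cost_integrable)
    show "AE \<omega> in Q. ?A \<omega> \<le> ?R \<omega>"
      using Z_start[of "Suc k"] AE_space by eventually_elim (unfold N\<^sub>k_def, rule copy_sum_le)
  qed
  also have "\<dots> = (\<integral>\<omega>. indicator (N\<^sub>k k) \<omega> * q (Z k 0 \<omega>) \<partial>Q) - (\<integral>\<omega>. indicator (N\<^sub>k (Suc k)) \<omega> * q (Z (Suc k) 0 \<omega>) \<partial>Q)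
      - (\<integral>\<omega>. impulse_cost T k \<omega> \<partial>Q) + measure Q (N\<^sub>k (Suc k)) * (h * \<epsilon>) + (measure Q (N\<^sub>k k) * C - measure Q (N\<^sub>k (Suc k)) * C)"
    unfolding N_mult[symmetric]
    by (simp only: Bochner_Integration.integral_add Bochner_Integration.integral_diff
        Bochner_Integration.integrable_add Bochner_Integration.integrable_diff int_N int_q impulse_cost_integrable)
  finally show ?thesis by simp
qed

lemma no_impulse_after: "N \<le> k \<Longrightarrow> \<omega> \<in> space Q \<Longrightarrow> impulse_cost T k \<omega> = 0"
proof -
  assume k: "N \<le> k"
  have "ennreal T < ennreal (real (Suc k) * h)"
    using k h T_nonneg by (intro ennreal_lessI) (auto simp: T intro!: mult_strict_right_mono)
  then have "\<not> S (Suc k) \<omega> \<le> ennreal T" using S_ge[of "Suc k" \<omega>] by auto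
  then show ?thesis by (simp add: impulse_cost_def)
qed

text \<open>Summation over the copies telescopes \<open>q\<close> and the probabilities, and each
  leaves one \<open>C\<close>. At most \<open>N\<close> impulses occur by \<open>T\<close>, so the
  selection errors add up to at most \<open>N * (h * \<epsilon>)\<close>, that is
  \<open>\<epsilon> * T\<close>; this is the third \<epsilon>.\<close>

lemma grid_cost_le:
  shows "total_impulse_cost T \<noteq> \<infinity>"
    and "(\<integral>\<omega>. (LBINT t:{0..T}. g (CP t \<omega>)) \<partial>Q) + enn2real (total_impulse_cost T) \<le> (\<mu> + 3 * \<epsilon>) * T + 2 * C"
proof -
  let ?l = "\<mu> + 2 * \<epsilon>"
  have r: "(\<lambda>y. g y - ?l) \<in> borel_measurable borel" "\<bar>g y - ?l\<bar> \<le> G + \<bar>?l\<bar>" for y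
    using g_bound[of y] by (measurable, linarith)
  have C: "0 \<le> C" using q(2)[of undefined] by linarith
  have "\<bar>semigroup h g undefined - g undefined\<bar> \<le> \<epsilon>" using slow h by (simp add: slowly_moving_def)
  then have \<epsilon>: "0 \<le> \<epsilon>" by linarith
  have S_N: "ennreal T < S (Suc N) \<omega>" for \<omega>
  proof (rule less_le_trans[OF _ S_ge])
    show "ennreal T < ennreal (real (Suc N) * h)"
      using h T_nonneg by (intro ennreal_lessI) (auto simp: T intro!: mult_strict_right_mono)
  qed
  have "total_impulse_cost T = (\<integral>\<^sup>+\<omega>. ennreal (\<Sum>k<Suc N. impulse_cost T k \<omega>) \<partial>Q)"
  proof (rule nn_integral_cong)
    fix \<omega> assume \<omega>: "\<omega> \<in> space Q"
    have "(\<Sum>k. ennreal (impulse_cost T k \<omega>)) = (\<Sum>k<Suc N. ennreal (impulse_cost T k \<omega>))"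
      by (rule suminf_finite) (auto simp: no_impulse_after[OF _ \<omega>])
    then show "(\<Sum>k. ennreal (impulse_cost T k \<omega>)) = ennreal (\<Sum>k<Suc N. impulse_cost T k \<omega>)"
      by (simp only: sum_ennreal impulse_cost_bounds)
  qed
  also have "\<dots> = ennreal (\<integral>\<omega>. (\<Sum>k<Suc N. impulse_cost T k \<omega>) \<partial>Q)"
    by (rule nn_integral_eq_integral)
      (auto intro!: Bochner_Integration.integrable_sum impulse_cost_integrable sum_nonneg impulse_cost_bounds simp del: sum.lessThan_Suc)
  also have "\<dots> = ennreal (\<Sum>k<Suc N. \<integral>\<omega>. impulse_cost T k \<omega> \<partial>Q)"
    by (subst Bochner_Integration.integral_sum) (auto intro: impulse_cost_integrable)
  finally have total: "total_impulse_cost T = ennreal (\<Sum>k<Suc N. \<integral>\<omega>. impulse_cost T k \<omega> \<partial>Q)" .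
  then show fin: "total_impulse_cost T \<noteq> \<infinity>" by (simp add: infinity_ennreal_def)
  have I: "enn2real (total_impulse_cost T) = (\<Sum>k<Suc N. \<integral>\<omega>. impulse_cost T k \<omega> \<partial>Q)"
    unfolding total by (intro enn2real_ennreal sum_nonneg Bochner_Integration.integral_nonneg impulse_cost_bounds)
  let ?N = "\<lambda>k. {\<omega> \<in> space Q. S k \<omega> \<le> ennreal T}"
  let ?a = "\<lambda>k. \<integral>\<omega>. indicator (?N k) \<omega> * q (Z k 0 \<omega>) \<partial>Q"
  have empty: "?N (Suc N) = {}" using S_N by (auto simp: not_le[symmetric])
  have "(\<integral>\<omega>. (LBINT t:{0..T}. g (CP t \<omega>)) \<partial>Q) - ?l * T = (\<Sum>k<Suc N. \<integral>\<omega>. W (\<lambda>y. g y - ?l) T k \<omega> \<partial>Q)"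
  proof -
    have int: "integrable Q (\<lambda>\<omega>. LBINT t:{0..T}. g (CP t \<omega>))"
      by (rule Q.integrable_const_bound[of _ "G * T"])
        (use CP_integral_bound[OF _ T_nonneg g_measurable g_bound] CP_integral_measurable[OF g_measurable] in \<open>auto intro!: AE_I2\<close>)
    have "(\<Sum>k<Suc N. \<integral>\<omega>. W (\<lambda>y. g y - ?l) T k \<omega> \<partial>Q) = (\<integral>\<omega>. (\<Sum>k<Suc N. W (\<lambda>y. g y - ?l) T k \<omega>) \<partial>Q)"
      by (intro Bochner_Integration.integral_sum[symmetric] W_integrable[OF T_nonneg r])
    also have "\<dots> = (\<integral>\<omega>. (LBINT t:{0..T}. g (CP t \<omega>)) - ?l * T \<partial>Q)"
    proof (rule Bochner_Integration.integral_cong[OF refl])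
      fix \<omega> assume \<omega>: "\<omega> \<in> space Q"
      show "(\<Sum>k<Suc N. W (\<lambda>y. g y - ?l) T k \<omega>) = (LBINT t:{0..T}. g (CP t \<omega>)) - ?l * T"
        using sum_W_finished[OF T_nonneg \<omega> r less_imp_le[OF S_N]] CP_integral_diff_const[OF \<omega> T_nonneg, of ?l] by simp
    qed
    also have "\<dots> = (\<integral>\<omega>. (LBINT t:{0..T}. g (CP t \<omega>)) \<partial>Q) - ?l * T"
      using int Q.prob_space by simp
    finally show ?thesis by simp
  qed
  then have "(\<integral>\<omega>. (LBINT t:{0..T}. g (CP t \<omega>)) \<partial>Q) - ?l * T + enn2real (total_impulse_cost T)
      = (\<Sum>k<Suc N. (\<integral>\<omega>. W (\<lambda>y. g y - ?l) T k \<omega> \<partial>Q) + (\<integral>\<omega>. impulse_cost T k \<omega> \<partial>Q))"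
    by (simp only: I sum.distrib)
  also have "\<dots> \<le> (\<Sum>k<Suc N. (?a k - ?a (Suc k)) + measure Q (?N (Suc k)) * (h * \<epsilon>)
      + (measure Q (?N k) * C - measure Q (?N (Suc k)) * C))"
    by (intro sum_mono W_step)
  also have "\<dots> = (?a 0 - ?a (Suc N)) + (\<Sum>k<Suc N. measure Q (?N (Suc k)) * (h * \<epsilon>))
      + (measure Q (?N 0) * C - measure Q (?N (Suc N)) * C)"
    unfolding sum.distrib
    using sum_lessThan_telescope'[of ?a "Suc N"] sum_lessThan_telescope'[of "\<lambda>k. measure Q (?N k) * C" "Suc N"]
    by simp
  also have "\<dots> \<le> C + \<epsilon> * T + C"
  proof -
    have "\<bar>?a 0\<bar> \<le> (\<integral>\<omega>. C \<partial>Q)"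
      using q(2) C by (intro integral_abs_bound[THEN order_trans] integral_mono integrable_abs integrable_Z[OF order_refl _ q])
        (auto split: split_indicator)
    then have "?a 0 \<le> C" using Q.prob_space by simp
    moreover have "?a (Suc N) = 0" unfolding empty by simp
    moreover have "(\<Sum>k<Suc N. measure Q (?N (Suc k)) * (h * \<epsilon>)) \<le> (\<Sum>k<N. 1 * (h * \<epsilon>))"
    proof -
      have "(\<Sum>k<N. measure Q (?N (Suc k)) * (h * \<epsilon>)) \<le> (\<Sum>k<N. 1 * (h * \<epsilon>))"
        using h \<epsilon> by (intro sum_mono mult_right_mono Q.prob_le_1) simp
      then show ?thesis unfolding sum.lessThan_Suc empty by simp
    qed
    moreover have "(\<Sum>k<N. 1 * (h * \<epsilon>)) = \<epsilon> * T" by (simp add: T)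
    moreover have "measure Q (?N 0) * C \<le> 1 * C" using C by (intro mult_right_mono Q.prob_le_1) auto
    moreover have "measure Q (?N (Suc N)) * C = 0" unfolding empty by simp
    ultimately show ?thesis by linarith
  qed
  finally show "(\<integral>\<omega>. (LBINT t:{0..T}. g (CP t \<omega>)) \<partial>Q) + enn2real (total_impulse_cost T) \<le> (\<mu> + 3 * \<epsilon>) * T + 2 * C"
    by (simp add: algebra_simps)
qed

end

text \<open>The horizon is rounded up to a multiple of \<open>h\<close>: impulse costs only grow,
  and the running cost of the added time is at most \<open>G * h\<close> in size. The corrections
  are constants in \<open>T\<close> and vanish in the average.\<close>

lemma average_cost_le: "average_cost g c X Q (threshold_strategy h I s) \<le> ereal (\<mu> + 3 * \<epsilon>)"
proof -
  let ?D = "2 * C + \<bar>\<mu> + 3 * \<epsilon>\<bar> * h + G * h"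
  have cost: "expected_cost g c X Q (threshold_strategy h I s) T \<le> ereal ((\<mu> + 3 * \<epsilon>) * T + ?D)" if T: "0 \<le> T" for T
  proof -
    define N where "N = nat \<lceil>T / h\<rceil>"
    define U where "U = real N * h"
    have "T / h \<le> real N" "real N \<le> T / h + 1" using T h by (simp_all add: N_def)
    then have TU: "T \<le> U" "U \<le> T + h" using h by (simp_all add: U_def field_simps)
    note le = grid_cost_le[OF U_def]
    have int: "integrable Q (\<lambda>\<omega>. LBINT t:{0..a}. g (CP t \<omega>))" if "0 \<le> a" for a
      by (rule Q.integrable_const_bound[of _ "G * a"])
        (use CP_integral_bound[OF _ that g_measurable g_bound] CP_integral_measurable[OF g_measurable] in \<open>auto intro!: AE_I2\<close>)
    have "(\<integral>\<omega>. (LBINT t:{0..T}. g (CP t \<omega>)) \<partial>Q) \<le> (\<integral>\<omega>. (LBINT t:{0..U}. g (CP t \<omega>)) + G * h \<partial>Q)"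
    proof (rule integral_mono)
      show "integrable Q (\<lambda>\<omega>. LBINT t:{0..T}. g (CP t \<omega>))" by (rule int[OF T])
      show "integrable Q (\<lambda>\<omega>. (LBINT t:{0..U}. g (CP t \<omega>)) + G * h)" using int[of U] T TU by simp
      fix \<omega> assume \<omega>: "\<omega> \<in> space Q"
      note y = measurable_compose[OF CP_path_measurable[OF \<omega>] g_measurable]
      have "\<bar>LBINT t:{T..<U}. g (CP (max 0 t) \<omega>)\<bar> \<le> G * (U - T)"
        by (rule interval_integral_bound[OF y g_bound TU(1)])
      also have "\<dots> \<le> G * h" using TU G_nonneg by (intro mult_left_mono) auto
      finally show "(LBINT t:{0..T}. g (CP t \<omega>)) \<le> (LBINT t:{0..U}. g (CP t \<omega>)) + G * h"
        using interval_integral_split[OF y g_bound T TU(1)] by (simp add: CP_integral_eq[OF \<omega> g_measurable])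
    qed
    also have "\<dots> = (\<integral>\<omega>. (LBINT t:{0..U}. g (CP t \<omega>)) \<partial>Q) + G * h"
      using int[of U] T TU Q.prob_space by simp
    finally have A: "(\<integral>\<omega>. (LBINT t:{0..T}. g (CP t \<omega>)) \<partial>Q) \<le> \<dots>" .
    have mono: "total_impulse_cost T \<le> total_impulse_cost U"
    proof (intro nn_integral_mono suminf_le ennreal_leI)
      fix \<omega> k
      have "S (Suc k) \<omega> \<le> ennreal U" if "S (Suc k) \<omega> \<le> ennreal T"
        using that ennreal_leI[OF TU(1)] by simp
      then show "impulse_cost T k \<omega> \<le> impulse_cost U k \<omega>"
        using c_pos by (auto simp: impulse_cost_def intro: less_imp_le)
    qed auto
    have fin: "total_impulse_cost T \<noteq> \<infinity>"
      using mono le(1) by (auto simp: infinity_ennreal_def top_unique)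
    have B: "enn2real (total_impulse_cost T) \<le> enn2real (total_impulse_cost U)"
      using mono le(1) by (intro enn2real_mono) (auto simp: infinity_ennreal_def less_top)
    have "(\<mu> + 3 * \<epsilon>) * U = (\<mu> + 3 * \<epsilon>) * T + (\<mu> + 3 * \<epsilon>) * (U - T)" by (simp add: algebra_simps)
    moreover have "(\<mu> + 3 * \<epsilon>) * (U - T) \<le> \<bar>\<mu> + 3 * \<epsilon>\<bar> * h"
      using TU by (intro mult_mono) auto
    ultimately have "(\<integral>\<omega>. (LBINT t:{0..T}. g (CP t \<omega>)) \<partial>Q) + enn2real (total_impulse_cost T) \<le> (\<mu> + 3 * \<epsilon>) * T + ?D"
      using le(2) A B by linarith
    moreover have "enn2ereal (total_impulse_cost T) = ereal (enn2real (total_impulse_cost T))"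
      using fin by (cases "total_impulse_cost T") (simp_all add: infinity_ennreal_def enn2ereal_ennreal)
    ultimately show ?thesis by (simp add: expected_cost_eq)
  qed
  let ?u = "\<lambda>T::real. \<mu> + 3 * \<epsilon> + ?D / T"
  have "((\<lambda>T::real. ?D / T) \<longlongrightarrow> 0) at_top"
    by (intro tendsto_divide_0[OF tendsto_const] filterlim_at_top_imp_at_infinity filterlim_ident)
  then have "(?u \<longlongrightarrow> \<mu> + 3 * \<epsilon> + 0) at_top" by (intro tendsto_intros)
  then have "((\<lambda>T. ereal (?u T)) \<longlongrightarrow> ereal (\<mu> + 3 * \<epsilon>)) at_top" by simp
  then have "Limsup at_top (\<lambda>T. ereal (?u T)) = ereal (\<mu> + 3 * \<epsilon>)"
    by (intro lim_imp_Limsup) simp_all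
  moreover have "average_cost g c X Q (threshold_strategy h I s) \<le> Limsup at_top (\<lambda>T. ereal (?u T))"
    unfolding average_cost_def
  proof (rule Limsup_mono, use eventually_gt_at_top[of 0] in eventually_elim)
    fix T :: real assume T: "0 < T"
    have "expected_cost g c X Q (threshold_strategy h I s) T / ereal T \<le> ereal ((\<mu> + 3 * \<epsilon>) * T + ?D) / ereal T"
      using cost[of T] T by (intro ereal_divide_right_mono) auto
    also have "\<dots> = ereal (?u T)" using T by (simp add: add_divide_distrib)
    finally show "expected_cost g c X Q (threshold_strategy h I s) T / ereal T \<le> ereal (?u T)" .
  qed
  ultimately show ?thesis by simp
qed

end


section \<open>Convergence of the values\<close>

context impulse_costs
begin

lemma grid_strategies_subset: "grid_strategies F h \<subseteq> strategies F"
  by (auto simp: grid_strategies_def)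

text \<open>Both infima are compared with one number: no strategy does better than \<open>m\<close>,
  and a threshold strategy reaches \<open>\<mu> + 3 * \<epsilon>\<close>. That \<open>m\<close>
  varies with \<open>h\<close> does no harm, since the two infima are compared with each other for
  each \<open>h\<close> separately.\<close>

lemma grid_values_close:
  assumes law: "\<And>V. V \<in> strategies F \<Longrightarrow> controlled_law F X P x V (Q V)" and \<eta>: "0 < \<eta>"
  obtains h\<^sub>0 where "0 < h\<^sub>0" "\<And>h. 0 < h \<Longrightarrow> h < h\<^sub>0 \<Longrightarrow>
    \<exists>m::real. ereal m \<le> (INF V\<in>strategies F. average_cost g c X (Q V) V) \<and>
      (INF V\<in>grid_strategies F h. average_cost g c X (Q V) V) \<le> ereal (m + \<eta>)"
proof -
  \<comment> \<open>The gap between \<open>\<mu> + 3 * \<epsilon>\<close> and \<open>m\<close> will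
    be at most \<open>6 * \<epsilon> + 4 * \<epsilon> * G / c\<^sub>0\<close>, which
    \<open>\<epsilon> * B\<close> covers with room to spare. The minimum with 1 gives a bound on
    \<open>\<nu>\<close> that does not depend on \<epsilon>.\<close>
  define B where "B = 6 + (6 * G + 6) / c\<^sub>0"
  have B: "0 < B" using G_nonneg c0_pos by (simp add: B_def add_pos_nonneg)
  define \<epsilon> where "\<epsilon> = min 1 (\<eta> / B)"
  have \<epsilon>: "0 < \<epsilon>" "\<epsilon> \<le> 1" "\<epsilon> * B \<le> \<eta>"
    using \<eta> B by (auto simp: \<epsilon>_def min_def field_simps)
  obtain h\<^sub>1 where h1: "0 < h\<^sub>1" "\<And>h. h \<le> h\<^sub>1 \<Longrightarrow> slowly_moving \<epsilon> h"
    using slowly_moving_ex[OF \<epsilon>(1)] by blast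
  \<comment> \<open>Three demands on \<open>h\<close>: slow motion, a positive discount factor, and
    \<open>h * (2 * G + 2) \<le> \<epsilon>\<close>, which keeps \<open>\<kappa>\<close> at most
    \<open>2 * \<epsilon>\<close>.\<close>
  define h\<^sub>0 where "h\<^sub>0 = min h\<^sub>1 (min (2 * K / \<epsilon>) (\<epsilon> / (2 * G + 2)))"
  show ?thesis
  proof (rule that[of h\<^sub>0])
    show "0 < h\<^sub>0" using h1 K_pos \<epsilon> G_nonneg by (simp add: h\<^sub>0_def)
    fix h assume h: "0 < h" "h < h\<^sub>0"
    have slow: "slowly_moving \<epsilon> h" using h h1(2)[of h] by (simp add: h\<^sub>0_def)
    have h_disc: "h * (\<epsilon> / (2 * K)) < 1" using h \<epsilon> K_pos by (simp add: h\<^sub>0_def field_simps)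
    have h_small: "h * (2 * G + 2) \<le> \<epsilon>" using h G_nonneg by (simp add: h\<^sub>0_def pos_less_divide_eq less_imp_le)
    obtain \<mu> w q C s I where \<mu>: "\<bar>\<mu>\<bar> \<le> G" and meas: "w \<in> borel_measurable borel" "q \<in> borel_measurable borel"
      and w_bounds: "\<And>x. 0 \<le> w x" "\<And>x. w x \<le> K" and q_bound: "\<And>x. \<bar>q x\<bar> \<le> C"
      and w_c: "\<And>x \<xi>. w x \<le> c x \<xi> + w \<xi>"
      and w_h: "\<And>x. w x \<le> semigroup h w x + h * (g x - (\<mu> - \<epsilon>))"
      and q_ge: "\<And>x. semigroup h w x + h * (g x - (\<mu> + \<epsilon>)) \<le> q x"
      and I: "I \<in> sets borel" and s: "s \<in> borel \<rightarrow>\<^sub>M borel"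
      and outside: "\<And>x. x \<notin> I \<Longrightarrow> q x \<le> w x" and inside: "\<And>x. x \<in> I \<Longrightarrow> c x (s x) + q (s x) \<le> w x + h * \<epsilon>"
      by (rule average_cost_bellman[OF \<epsilon>(1) h(1) h_disc]) (rule that, assumption+)
    note w = meas(1) w_bounds and q = meas(2) q_bound
    \<comment> \<open>The constant \<open>\<mu> - \<epsilon>\<close> of the Bellman inequality is
      read as \<open>\<nu> + \<epsilon>\<close>, whose \<epsilon> is spent on the refinement. One
      more is spent within the fine steps, whence \<open>\<nu> - \<epsilon>\<close> in
      \<open>m\<close>.\<close>
    define \<nu> where "\<nu> = \<mu> - 2 * \<epsilon>"
    have \<nu>: "\<bar>\<nu>\<bar> \<le> G + 2" using \<mu> \<epsilon> by (auto simp: \<nu>_def)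
    define \<kappa> where "\<kappa> = \<epsilon> + h * (G + \<bar>\<nu>\<bar>)"
    have "h * (G + \<bar>\<nu>\<bar>) \<le> h * (2 * G + 2)" using h \<nu> by (intro mult_left_mono) auto
    moreover have "0 \<le> h * (G + \<bar>\<nu>\<bar>)" using h(1) G_nonneg by simp
    ultimately have \<kappa>: "0 \<le> \<kappa>" "\<kappa> \<le> 2 * \<epsilon>"
      using h_small \<epsilon>(1) unfolding \<kappa>_def by linarith+
    define \<theta> where "\<theta> = \<kappa> / c\<^sub>0"
    have \<theta>: "0 \<le> \<theta>" "\<theta> \<le> 2 * \<epsilon> / c\<^sub>0" using \<kappa> c0_pos by (simp_all add: \<theta>_def divide_right_mono)
    define m where "m = (\<nu> - \<epsilon> - \<theta> * G) / (1 + \<theta>)"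
    define \<delta> where "\<delta> i = h / real (Suc i)" for i
    have \<delta>: "0 < \<delta> i" "\<delta> i \<le> h" for i
      using h(1) by (simp_all add: \<delta>_def pos_divide_le_eq mult_le_cancel_left1 del: of_nat_Suc)
    have \<delta>_lim: "\<delta> \<longlonglongrightarrow> 0"
      using tendsto_mult[OF tendsto_const[of h] lim_1_over_n[THEN LIMSEQ_Suc]] by (simp add: \<delta>_def[abs_def])
    have \<delta>_slow: "slowly_moving \<epsilon> (\<delta> i)" for i
      using slow \<delta>(2)[of i] by (force simp: slowly_moving_def)
    have w_h': "w x \<le> semigroup h w x + h * (g x - (\<nu> + \<epsilon>))" for x
      using w_h[of x] by (simp add: \<nu>_def)
    have "\<exists>u. u \<in> borel_measurable borel \<and> (\<forall>x. \<bar>u x\<bar> \<le> K + h * (G + \<bar>\<nu>\<bar>)) \<and>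
        (\<forall>x. u x \<le> semigroup (\<delta> i) u x + \<delta> i * (g x - \<nu>)) \<and> (\<forall>x \<xi>. u x \<le> c x \<xi> + u \<xi> + \<kappa>)" for i
      by (rule refined_subsolution[OF w w_c w_h' h(1) slow, of "Suc i" "\<delta> i"]) (auto simp: \<delta>_def \<kappa>_def)
    then obtain u where u: "\<And>i. u i \<in> borel_measurable borel" "\<And>i x. \<bar>u i x\<bar> \<le> K + h * (G + \<bar>\<nu>\<bar>)"
      "\<And>i x. u i x \<le> semigroup (\<delta> i) (u i) x + \<delta> i * (g x - \<nu>)" "\<And>i x \<xi>. u i x \<le> c x \<xi> + u i \<xi> + \<kappa>"
      by metis
    have u_step: "u i x \<le> semigroup (\<delta> i) (u i) x + \<delta> i * (g x - ((\<nu> - \<epsilon>) + \<epsilon>))" for i x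
      using u(3)[of i x] by simp
    have "ereal m \<le> average_cost g c X (Q V) V" if V: "V \<in> strategies F" for V
    proof -
      interpret controlled_system F X P g c c\<^sub>0 G K x V "Q V"
        by unfold_locales (use V law in auto)
      show ?thesis
        unfolding m_def \<theta>_def by (rule average_cost_ge[OF \<delta>(1) \<delta>_lim \<delta>_slow u(1,2) u_step u(4) \<kappa>(1)])
    qed
    then have "ereal m \<le> (INF V\<in>strategies F. average_cost g c X (Q V) V)" by (rule INF_greatest)
    moreover have "(INF V\<in>grid_strategies F h. average_cost g c X (Q V) V) \<le> ereal (\<mu> + 3 * \<epsilon>)"
    proof (rule INF_lower2[OF threshold_strategy_grid[OF h(1) I s]])
      let ?V = "threshold_strategy h I s"
      have V: "?V \<in> strategies F" using threshold_strategy_grid[OF h(1) I s] grid_strategies_subset by blast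
      have CK: "w x \<le> max C K" "\<bar>q x\<bar> \<le> max C K" for x using w(3)[of x] q(2)[of x] by auto
      interpret threshold_controlled_system F X P g c c\<^sub>0 G K x h I s "Q ?V" q w "max C K" \<mu> \<epsilon>
        using V law h(1) slow w q(1) q_ge outside inside CK by unfold_locales auto
      show "average_cost g c X (Q ?V) ?V \<le> ereal (\<mu> + 3 * \<epsilon>)" by (rule average_cost_le)
    qed
    \<comment> \<open>Division by \<open>1 + \<theta>\<close> costs \<open>\<theta> * m\<close>,
      which is at most \<open>\<theta> * G\<close>; with the \<open>\<theta> * G\<close> inside
      \<open>a\<close> the loss is \<open>2 * \<theta> * G\<close>.\<close>
    moreover have "\<mu> + 3 * \<epsilon> \<le> m + \<eta>"
    proof -
      define a where "a = \<nu> - \<epsilon> - \<theta> * G"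
      have m_eq: "m = a / (1 + \<theta>)" by (simp only: m_def a_def)
      then have "m * (1 + \<theta>) = a" using \<theta>(1) by simp
      then have "a - m = \<theta> * m" by (simp add: algebra_simps)
      moreover have "m \<le> G"
      proof -
        have "a \<le> G" using \<mu> \<epsilon>(1) mult_nonneg_nonneg[OF \<theta>(1) G_nonneg] unfolding a_def \<nu>_def by linarith
        also have "\<dots> \<le> G * (1 + \<theta>)" using \<theta>(1) G_nonneg by (simp add: distrib_left)
        finally show ?thesis using \<theta>(1) by (simp add: m_eq pos_divide_le_eq)
      qed
      then have "\<theta> * m \<le> \<theta> * G" using \<theta>(1) by (rule mult_left_mono)
      moreover have "\<theta> * G \<le> 2 * \<epsilon> / c\<^sub>0 * G" using \<theta>(2) G_nonneg by (rule mult_right_mono)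
      moreover have "6 * \<epsilon> + 2 * (2 * \<epsilon> / c\<^sub>0 * G) \<le> \<epsilon> * B"
        using c0_pos \<epsilon>(1) G_nonneg by (simp add: B_def field_simps)
      ultimately show ?thesis using \<epsilon>(3) unfolding a_def \<nu>_def by linarith
    qed
    ultimately show "\<exists>m::real. ereal m \<le> (INF V\<in>strategies F. average_cost g c X (Q V) V) \<and>
        (INF V\<in>grid_strategies F h. average_cost g c X (Q V) V) \<le> ereal (m + \<eta>)"
      by (meson ereal_less_eq(3) order_trans)
  qed
qed

text \<open>One inequality is the inclusion of the strategy classes, the other is
  \<open>grid_values_close\<close>. Arithmetic in the extended reals needs the limit to be finite:
  \<open>ereal m\<close> bounds it from below, the value of a single grid from above.\<close>

lemma grid_values_tendsto:
  assumes law: "\<And>V. V \<in> strategies F \<Longrightarrow> controlled_law F X P x V (Q V)"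
  shows "((\<lambda>h. INF V\<in>grid_strategies F h. average_cost g c X (Q V) V)
    \<longlongrightarrow> (INF V\<in>strategies F. average_cost g c X (Q V) V)) (at_right 0)"
proof -
  let ?L = "INF V\<in>strategies F. average_cost g c X (Q V) V"
  let ?G = "\<lambda>h. INF V\<in>grid_strategies F h. average_cost g c X (Q V) V"
  have L_le: "?L \<le> ?G h" for h by (rule INF_superset_mono[OF grid_strategies_subset]) simp
  have close: "eventually (\<lambda>h. ?G h \<le> ?L + ereal \<eta>) (at_right 0)" and fin: "\<bar>?L\<bar> \<noteq> \<infinity>" if \<eta>: "0 < \<eta>" for \<eta>
  proof -
    obtain h\<^sub>0 where h0: "0 < h\<^sub>0" "\<And>h. 0 < h \<Longrightarrow> h < h\<^sub>0 \<Longrightarrow> \<exists>m::real. ereal m \<le> ?L \<and> ?G h \<le> ereal (m + \<eta>)"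
      using grid_values_close[OF law \<eta>] by blast
    show "eventually (\<lambda>h. ?G h \<le> ?L + ereal \<eta>) (at_right 0)"
      unfolding eventually_at_right[OF h0(1)]
    proof (intro exI[of _ h\<^sub>0] conjI h0(1) allI impI)
      fix h assume "0 < h" "h < h\<^sub>0"
      from h0(2)[OF this] obtain m :: real where m: "ereal m \<le> ?L" "?G h \<le> ereal (m + \<eta>)" by blast
      have "ereal (m + \<eta>) = ereal m + ereal \<eta>" by simp
      also have "\<dots> \<le> ?L + ereal \<eta>" by (rule add_right_mono[OF m(1)])
      finally show "?G h \<le> ?L + ereal \<eta>" using m(2) by (rule order_trans[rotated])
    qed
    from h0(2)[of "h\<^sub>0 / 2"] h0(1) obtain m :: real where "ereal m \<le> ?L" "?G (h\<^sub>0 / 2) \<le> ereal (m + \<eta>)" by auto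
    with L_le[of "h\<^sub>0 / 2"] have "ereal m \<le> ?L" "?L \<le> ereal (m + \<eta>)" by (auto intro: order_trans)
    then show "\<bar>?L\<bar> \<noteq> \<infinity>" by (cases ?L) auto
  qed
  show ?thesis
  proof (rule order_tendstoI)
    fix a assume "a < ?L"
    then show "eventually (\<lambda>h. a < ?G h) (at_right 0)"
      using L_le by (intro always_eventually allI) (rule less_le_trans)
  next
    fix a assume a: "?L < a"
    obtain l where l: "?L = ereal l" using fin[of 1] by (cases ?L) auto
    obtain b where b: "l < b" "ereal b < a"
      using ereal_dense2[OF a[unfolded l]] by auto
    show "eventually (\<lambda>h. ?G h < a) (at_right 0)"
      using close[of "b - l"] b
      by (auto simp: l elim!: eventually_mono intro: le_less_trans)
  qed
qed

end


theorem theorem4p6: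
  fixes F :: "ennreal \<Rightarrow> 'w measure"
    and X :: "real \<Rightarrow> 'w \<Rightarrow> 'e::polish_space"
    and P :: "'e \<Rightarrow> 'w measure"
    and g :: "'e \<Rightarrow> real"
    and c :: "'e \<Rightarrow> 'e \<Rightarrow> real"
    and c\<^sub>0 :: real
    and PV :: "'e \<Rightarrow> ('w, 'e) strategy \<Rightarrow> (nat \<Rightarrow> 'w) measure"
    and x :: 'e
  assumes E_compact: "compact (UNIV :: 'e set)"
    and process: "standard_process F X P"
    and g: "continuous_on UNIV g" "bounded (range g)"
    and c: "continuous_on UNIV (\<lambda>(x, \<xi>). c x \<xi>)" "bounded (range (\<lambda>(x, \<xi>). c x \<xi>))"
    and c\<^sub>0: "0 < c\<^sub>0" "\<And>x \<xi>. c\<^sub>0 \<le> c x \<xi>"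
    and c_triangle: "\<And>x \<xi> \<eta>. c x \<xi> \<le> c x \<eta> + c \<eta> \<xi>"
    and feller: "\<And>f :: 'e \<Rightarrow> real. \<And>t. continuous_on UNIV f \<Longrightarrow> bounded (range f) \<Longrightarrow> 0 < t \<Longrightarrow>
        continuous_on UNIV (\<lambda>x. \<integral>\<omega>. f (X t \<omega>) \<partial>P x) \<and> bounded (range (\<lambda>x. \<integral>\<omega>. f (X t \<omega>) \<partial>P x))"
    and ergodic: "\<And>t. 0 < t \<Longrightarrow> \<exists>\<Lambda>\<in>{0<..<1}. \<forall>x y. \<forall>A\<in>sets borel.
        \<bar>transition P X t x A - transition P X t y A\<bar> \<le> \<Lambda>"
    and law: "\<And>x V. V \<in> strategies F \<Longrightarrow> controlled_law F X P x V (PV x V)"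
  shows "((\<lambda>h. INF V\<in>grid_strategies F h. average_cost g c X (PV x V) V)
           \<longlongrightarrow> (INF V\<in>strategies F. average_cost g c X (PV x V) V)) (at_right 0)"
proof -
  obtain G where G: "\<And>y. \<bar>g y\<bar> \<le> G" using g(2) by (auto simp: bounded_iff)
  obtain K where K: "\<And>y \<xi>. \<bar>c y \<xi>\<bar> \<le> K" using c(2) by (auto simp: bounded_iff)
  interpret standard_process F X P by (rule process)
  interpret impulse_costs F X P g c c\<^sub>0 G K
  proof unfold_locales
    show "continuous_on UNIV (semigroup t f)" if f: "continuous_on UNIV f" and t: "0 < t" for f :: "'e \<Rightarrow> real" and t
    proof -
      have "bounded (range f)" by (rule compact_imp_bounded[OF compact_continuous_image[OF f E_compact]])
      then show ?thesis using feller[OF f _ t] by (simp add: semigroup_def[abs_def])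
    qed
    show "c y \<xi> \<le> K" for y \<xi> using K[of y \<xi>] by linarith
  qed (use E_compact g c c\<^sub>0 c_triangle G in auto)
  show ?thesis by (rule grid_values_tendsto[OF law])
qed

end
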